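(* Let $d\ge 2$ and let $D\subset\mathbb{R}^d$ be a bounded connected open set with $C^2$-smooth boundary. Let $\{X^x\}_{x\in\overline D}$ be the synchronous coupling of reflected Brownian motions in $\overline D$ driven by a single standard $d$-dimensional Brownian motion $B$, with local times $\{L^x\}_{x\in\overline D}$ on $\partial D$ (see context). For $x\in\overline D$ let $\mu^x_L$ be the (random) measure on $[0,\infty)$ defined by $\mu^x_L([s,t])=L^x_t-L^x_s$ for $t\ge s\ge0$. Consider any $x,y\in\overline D$ with $x\neq y$, and let $$T=\inf\{t\ge 0:\ X^x_t\in\partial D,\ X^y_t\in\partial D,\ \mathbf{n}(X^x_t)=\mathbf{n}(X^y_t)\}.$$ Then, with probability $1$, the measures $\mu^x_L$ and $\mu^y_L$ are mutually singular on $[0,T]$.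
   Context: For $x\in\partial D$, $\mathbf{n}(x)$ is the unit inward normal vector to $\partial D$ at $x$. Synchronous coupling: let $B$ be a standard $d$-dimensional Brownian motion (with $B_0=0$). For $x\in\overline D$ consider the Skorokhod equation $$X^x_t = x + B_t+\int_0^t \mathbf{n}(X^x_s)\,dL^x_s,\qquad t\ge 0,$$ where $X^x$ is continuous with $X^x_t\in\overline D$ for all $t\ge0$, and $L^x$ (the local time of $X^x$ on $\partial D$) is a non-decreasing continuous process with $L^x_0=0$ which does not increase when $X^x$ is in $D$, i.e. $\int_0^\infty \mathbf{1}_{D}(X^x_t)\,dL^x_t=0$ a.s. This equation has a unique pathwise solution $(X^x,L^x)$, simultaneously for all $x\in\overline D$ (with the same $B$), and $(x,t)\mapsto X^x_t$ is jointly continuous a.s. Conventions: $\inf\emptyset=\infty$, and if $T=\infty$ then $[0,T]$ is read as $[0,\infty)$. "Mutually singular on $[0,T]$" means that the restrictions of the two measures to $[0,T]$ are mutually singular. *)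

theory Defs
  imports "HOL-Probability.Probability"
begin

section \<open>Domains with \<open>C\<^sup>2\<close> boundary and the inward normal\<close>

definition C2_on :: "'a::euclidean_space set \<Rightarrow> ('a \<Rightarrow> real) \<Rightarrow> bool" where
  "C2_on U \<rho> \<longleftrightarrow>
     (\<exists>(g :: 'a \<Rightarrow> 'a) (H :: 'a \<Rightarrow> 'a \<Rightarrow>\<^sub>L 'a).
        (\<forall>z\<in>U. GDERIV \<rho> z :> g z) \<and>
        (\<forall>z\<in>U. (g has_derivative blinfun_apply (H z)) (at z)) \<and>
        continuous_on U H)"

text \<open>\<open>\<rho>\<close> is a local defining function of \<open>D\<close> on the neighbourhood \<open>U\<close> of \<open>x\<close>: it is \<open>C\<^sup>2\<close> on \<open>U\<close>
  with non-vanishing gradient, and \<open>D\<close> is locally its positivity set. In particular \<open>D\<close> lies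
  locally on one side of its boundary, and the gradient of \<open>\<rho>\<close> points into \<open>D\<close>.\<close>

definition C2_defining_function :: "'a::euclidean_space set \<Rightarrow> 'a \<Rightarrow> 'a set \<Rightarrow> ('a \<Rightarrow> real) \<Rightarrow> bool" where
  "C2_defining_function D x U \<rho> \<longleftrightarrow>
     open U \<and> x \<in> U \<and> C2_on U \<rho> \<and>
     (\<forall>z\<in>U. \<not> GDERIV \<rho> z :> 0) \<and>
     D \<inter> U = {z \<in> U. \<rho> z > 0}"

definition C2_boundary :: "'a::euclidean_space set \<Rightarrow> bool" where
  "C2_boundary D \<longleftrightarrow> (\<forall>x\<in>frontier D. \<exists>U \<rho>. C2_defining_function D x U \<rho>)"

text \<open>At a boundary point of an open set the normalised gradient does not depend on the choice of
  the defining function (lemma \<open>inward_normal_eq\<close> below). The value \<open>0\<close> off the boundary is a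
  dummy, but it has to be fixed: it makes \<open>inward_normal D\<close> Borel measurable, so that the integrals
  \<open>\<integral> \<^bold>n(X) dL\<close> below are genuine integrals.\<close>

definition inward_normal :: "'a::euclidean_space set \<Rightarrow> 'a \<Rightarrow> 'a" where
  "inward_normal D x =
     (if x \<in> frontier D
      then THE \<nu>. \<exists>U \<rho> g. C2_defining_function D x U \<rho> \<and> GDERIV \<rho> x :> g \<and> \<nu> = g /\<^sub>R norm g
      else 0)"

lemma GDERIV_pos_direction:
  assumes "GDERIV \<rho> x :> g" "\<rho> x = 0" "h \<bullet> g > 0"
  shows "eventually (\<lambda>t::real. \<rho> (x + t *\<^sub>R h) > 0) (at_right 0)"
proof -
  have 1: "((\<lambda>t::real. x + t *\<^sub>R h) has_derivative (\<lambda>t. t *\<^sub>R h)) (at 0)"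
    by (auto intro!: derivative_eq_intros)
  have 2: "(\<rho> has_derivative (\<lambda>h. h \<bullet> g)) (at (x + 0 *\<^sub>R h))"
    using assms(1) by (simp add: gderiv_def)
  have "((\<lambda>t::real. \<rho> (x + t *\<^sub>R h)) has_derivative (\<lambda>t. (t *\<^sub>R h) \<bullet> g)) (at 0)"
    using has_derivative_compose[OF 1 2] by simp
  then have "((\<lambda>t::real. \<rho> (x + t *\<^sub>R h)) has_real_derivative (h \<bullet> g)) (at 0)"
    by (simp add: has_field_derivative_def mult_commute_abs)
  from DERIV_pos_inc_right[OF this assms(3)]
  obtain d where "d > 0" "\<And>t. 0 < t \<Longrightarrow> t < d \<Longrightarrow> \<rho> (x + t *\<^sub>R h) > 0"
    using assms(2) by auto
  then show ?thesis
    unfolding eventually_at_right_field by (intro exI[of _ d]) auto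
qed

lemma C2_defining_function_zero:
  assumes "open D" "x \<in> frontier D" "C2_defining_function D x U \<rho>" "GDERIV \<rho> x :> g"
  shows "\<rho> x = 0"
proof (rule antisym)
  have U: "open U" "x \<in> U" "D \<inter> U = {z \<in> U. \<rho> z > 0}"
    using assms(3) by (auto simp: C2_defining_function_def)
  have "x \<notin> D" using assms(1,2) by (simp add: frontier_def interior_open)
  then show "\<rho> x \<le> 0" using U by force
  show "0 \<le> \<rho> x"
  proof (rule ccontr)
    assume neg: "\<not> 0 \<le> \<rho> x"
    have "isCont \<rho> x"
      using assms(4) by (auto simp: gderiv_def intro: has_derivative_continuous)
    then have "eventually (\<lambda>z. \<rho> z < 0) (nhds x)"
      using neg order_tendstoD(2)[of \<rho> "\<rho> x" "nhds x" 0]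
      by (simp add: continuous_at_imp_continuous_at_within isCont_def tendsto_at_iff_tendsto_nhds)
    then obtain V where V: "open V" "x \<in> V" "\<forall>z\<in>V. \<rho> z < 0"
      by (auto simp: eventually_nhds)
    have "x \<in> closure D" using assms(2) by (simp add: frontier_def)
    then have "D \<inter> (U \<inter> V) \<noteq> {}"
      using U V by (metis IntI closure_iff_nhds_not_empty open_Int order_refl)
    then show False using U V by force
  qed
qed

lemma inward_normal_eq:
  fixes D :: "'a::euclidean_space set"
  assumes "open D" "x \<in> frontier D" "C2_defining_function D x U \<rho>" "GDERIV \<rho> x :> g"
  shows "inward_normal D x = g /\<^sub>R norm g"
proof -
  have half: "h \<bullet> g2 \<ge> 0"
    if 1: "C2_defining_function D x U1 \<rho>1" "GDERIV \<rho>1 x :> g1"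
      and 2: "C2_defining_function D x U2 \<rho>2" "GDERIV \<rho>2 x :> g2" and h: "h \<bullet> g1 > 0"
    for U1 U2 \<rho>1 \<rho>2 g1 g2 and h :: 'a
  proof (rule ccontr)
    assume "\<not> h \<bullet> g2 \<ge> 0"
    then have neg: "h \<bullet> (- g2) > 0" by simp
    have "GDERIV (\<lambda>z. - \<rho>2 z) x :> - g2"
      using 2(2) by (rule GDERIV_minus)
    with neg have A: "eventually (\<lambda>t::real. - \<rho>2 (x + t *\<^sub>R h) > 0) (at_right 0)"
      by (intro GDERIV_pos_direction) (use C2_defining_function_zero[OF assms(1,2) 2] in auto)
    have B: "eventually (\<lambda>t::real. \<rho>1 (x + t *\<^sub>R h) > 0) (at_right 0)"
      using 1(2) C2_defining_function_zero[OF assms(1,2) 1] h by (rule GDERIV_pos_direction)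
    have "((\<lambda>t::real. x + t *\<^sub>R h) \<longlongrightarrow> x + 0 *\<^sub>R h) (at_right 0)"
      by (intro tendsto_intros)
    then have C: "eventually (\<lambda>t::real. x + t *\<^sub>R h \<in> U1 \<inter> U2) (at_right 0)"
      by (rule topological_tendstoD) (use 1(1) 2(1) in \<open>auto simp: C2_defining_function_def\<close>)
    have "eventually (\<lambda>t::real. False) (at_right 0)"
      using A B C
      by eventually_elim (use 1(1) 2(1) in \<open>force simp: C2_defining_function_def\<close>)
    then show False by simp
  qed
  have uniq: "g1 /\<^sub>R norm g1 = g2 /\<^sub>R norm g2"
    if 1: "C2_defining_function D x U1 \<rho>1" "GDERIV \<rho>1 x :> g1"
      and 2: "C2_defining_function D x U2 \<rho>2" "GDERIV \<rho>2 x :> g2"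
    for U1 U2 \<rho>1 \<rho>2 and g1 g2 :: 'a
  proof -
    define a where "a = g1 /\<^sub>R norm g1"
    define b where "b = g2 /\<^sub>R norm g2"
    have nz: "g1 \<noteq> 0" "g2 \<noteq> 0" using 1 2 by (auto simp: C2_defining_function_def)
    have [simp]: "norm a = 1" "norm b = 1" using nz by (simp_all add: a_def b_def)
    have aa: "a \<bullet> a = 1" "b \<bullet> b = 1" by (simp_all add: dot_square_norm)
    have ab: "h \<bullet> b \<ge> 0" if "h \<bullet> a > 0" for h
      using half[OF 1 2, of h] that nz by (auto simp: a_def b_def zero_less_mult_iff)
    show ?thesis
    proof (rule ccontr)
      assume "g1 /\<^sub>R norm g1 \<noteq> g2 /\<^sub>R norm g2"
      then have "a \<noteq> b" by (simp add: a_def b_def)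
      then have "(a - b) \<bullet> (a - b) > 0" by simp
      then have lt: "a \<bullet> b < 1" by (simp add: algebra_simps aa inner_commute)
      have "(a - b) \<bullet> a > 0" using lt by (simp add: algebra_simps aa inner_commute)
      from ab[OF this] show False using lt by (simp add: algebra_simps aa inner_commute)
    qed
  qed
  have "(THE \<nu>. \<exists>U \<rho> g. C2_defining_function D x U \<rho> \<and> GDERIV \<rho> x :> g \<and> \<nu> = g /\<^sub>R norm g)
      = g /\<^sub>R norm g"
  proof (rule the_equality)
    show "\<exists>U \<rho> g'. C2_defining_function D x U \<rho> \<and> GDERIV \<rho> x :> g' \<and> g /\<^sub>R norm g = g' /\<^sub>R norm g'"
      using assms(3,4) by blast
  next
    fix \<nu>
    assume "\<exists>U \<rho> g. C2_defining_function D x U \<rho> \<and> GDERIV \<rho> x :> g \<and> \<nu> = g /\<^sub>R norm g"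
    then obtain U' \<rho>' g' where "C2_defining_function D x U' \<rho>'" "GDERIV \<rho>' x :> g'"
      and \<nu>: "\<nu> = g' /\<^sub>R norm g'"
      by blast
    then show "\<nu> = g /\<^sub>R norm g"
      using uniq[OF _ _ assms(3,4)] by blast
  qed
  then show ?thesis
    using assms(2) by (simp only: inward_normal_def if_True)
qed

section \<open>Stieltjes measures on the half line and mutual singularity\<close>

text \<open>The measure on \<open>[0, \<infinity>)\<close> with distribution function \<open>F\<close>; only the values of \<open>F\<close> on \<open>[0, \<infinity>)\<close>
  matter.\<close>

definition stieltjes_measure :: "(real \<Rightarrow> real) \<Rightarrow> real measure" where
  "stieltjes_measure F = restrict_space (interval_measure (\<lambda>t. F (max 0 t))) {0..}"

lemma emeasure_stieltjes_measure_Icc: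
  assumes "mono_on {0..} F" "continuous_on {0..} F" "0 \<le> s" "s \<le> t"
  shows "emeasure (stieltjes_measure F) {s..t} = ennreal (F t - F s)"
proof -
  have "continuous_on UNIV (\<lambda>t. F (max 0 t))"
    by (rule continuous_on_compose2[OF assms(2)]) (auto intro!: continuous_intros)
  moreover have "F (max 0 a) \<le> F (max 0 b)" if "a \<le> b" for a b
    using assms(1) that by (auto intro: mono_onD)
  ultimately have "emeasure (interval_measure (\<lambda>t. F (max 0 t))) {s..t} = F t - F s"
    using assms(3,4) by (subst emeasure_interval_measure_Icc) (auto simp: max_def)
  then show ?thesis
    using assms(3) by (simp add: stieltjes_measure_def emeasure_restrict_space)
qed

definition mutually_singular :: "'a measure \<Rightarrow> 'a measure \<Rightarrow> bool" where
  "mutually_singular M N \<longleftrightarrow>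
     sets M = sets N \<and> (\<exists>A\<in>sets M. emeasure M A = 0 \<and> emeasure N (space N - A) = 0)"

section \<open>Brownian motion and the Skorokhod equation\<close>

text \<open>Processes are indexed by \<open>real\<close>; only times \<open>t \<ge> 0\<close> are ever referred to.\<close>

locale brownian_motion = prob_space M
  for M :: "'w measure" and B :: "real \<Rightarrow> 'w \<Rightarrow> 'a::euclidean_space" +
  assumes measurable_B: "\<And>t. 0 \<le> t \<Longrightarrow> random_variable borel (B t)"
    and B_zero: "AE \<omega> in M. B 0 \<omega> = 0"
    and continuous_B: "AE \<omega> in M. continuous_on {0..} (\<lambda>t. B t \<omega>)"
    and gaussian_increments: "\<And>s t. 0 \<le> s \<Longrightarrow> s < t \<Longrightarrow>
      distributed M lborel (\<lambda>\<omega>. B t \<omega> - B s \<omega>)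
        (\<lambda>z. ennreal (\<Prod>b\<in>Basis. normal_density 0 (sqrt (t - s)) (z \<bullet> b)))"
    and indep_increments: "\<And>(n::nat) (\<tau> :: nat \<Rightarrow> real).
      0 \<le> \<tau> 0 \<Longrightarrow> (\<And>i. i < n \<Longrightarrow> \<tau> i < \<tau> (Suc i)) \<Longrightarrow>
      indep_vars (\<lambda>_. borel) (\<lambda>i \<omega>. B (\<tau> (Suc i)) \<omega> - B (\<tau> i) \<omega>) {..<n}"

text \<open>The Skorokhod equation in \<open>D\<close> for a single trajectory, with starting point \<open>x\<close> and
  driving path \<open>w\<close>.\<close>

definition skorokhod_solution ::
  "'a::euclidean_space set \<Rightarrow> 'a \<Rightarrow> (real \<Rightarrow> 'a) \<Rightarrow> (real \<Rightarrow> 'a) \<Rightarrow> (real \<Rightarrow> real) \<Rightarrow> bool" where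
  "skorokhod_solution D x w X L \<longleftrightarrow>
     continuous_on {0..} X \<and> (\<forall>t\<ge>0. X t \<in> closure D) \<and>
     continuous_on {0..} L \<and> mono_on {0..} L \<and> L 0 = 0 \<and>
     (\<integral>\<^sup>+ t. indicator D (X t) \<partial>stieltjes_measure L) = 0 \<and>
     (\<forall>t\<ge>0. X t = x + w t + (LINT s:{0..t}|stieltjes_measure L. inward_normal D (X s)))"

locale synchronous_coupling = brownian_motion M B
  for M :: "'w measure" and B :: "real \<Rightarrow> 'w \<Rightarrow> 'a::euclidean_space" +
  fixes D :: "'a set" and X :: "'a \<Rightarrow> real \<Rightarrow> 'w \<Rightarrow> 'a" and L :: "'a \<Rightarrow> real \<Rightarrow> 'w \<Rightarrow> real"
  assumes measurable_X: "\<And>x t. x \<in> closure D \<Longrightarrow> 0 \<le> t \<Longrightarrow> random_variable borel (X x t)"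
    and measurable_L: "\<And>x t. x \<in> closure D \<Longrightarrow> 0 \<le> t \<Longrightarrow> random_variable borel (L x t)"
    and skorokhod: "AE \<omega> in M. \<forall>x\<in>closure D.
      skorokhod_solution D x (\<lambda>t. B t \<omega>) (\<lambda>t. X x t \<omega>) (\<lambda>t. L x t \<omega>)"
    and jointly_continuous: "AE \<omega> in M.
      continuous_on (closure D \<times> {0..}) (\<lambda>(x, t). X x t \<omega>)"

end

theory Submission
  imports Defs
begin

text \<open>The argument uses the coupling only path by path. If \<open>X\<^sup>x\<close> is on the boundary at time \<open>t\<close>, with
  inward normal \<open>n\<close>, then reading the Skorokhod equation backwards from \<open>t\<close> shows that
  \<open>n \<bullet> (B\<^sub>s - B\<^sub>t) \<ge> - \<epsilon> |B\<^sub>s - B\<^sub>t|\<close> and \<open>L\<^sup>x\<^sub>t - L\<^sup>x\<^sub>s \<le> 5 |B\<^sub>s - B\<^sub>t|\<close> for \<open>s < t\<close> close to \<open>t\<close>. Hence a time at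
  which both processes are on the boundary with different normals \<open>a \<noteq> b\<close> is a backward cone time
  of \<open>B\<close>, for a cone strictly smaller than a half space. Such a cone carries a positive
  superharmonic function which is homogeneous of a degree \<open>p > 1\<close>, so a given interval of length
  \<open>2\<^sup>-\<^sup>m\<close> contains a cone time with probability about \<open>2\<^sup>-\<^sup>m\<^sup>p\<^sup>/\<^sup>2\<close>, while the part of it that matters has
  local time at most about \<open>2\<^sup>-\<^sup>m\<^sup>/\<^sup>2\<close>. Summing over the \<open>2\<^sup>m\<close> intervals, \<open>\<mu>\<^sup>x\<^sub>L\<close> does not charge the common
  boundary times before \<open>T\<close>.\<close>

section \<open>Centred Gaussian measures\<close>

text \<open>An estimate for one measure suffices: once \<open>\<mu>\<^sup>x\<^sub>L\<close> does not
  charge the common boundary times before \<open>T\<close>, the times at which only X^x is on the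
  boundary separate the two measures.

  What decides is the inequality p > 1. With 2^m intervals the sum has exponent m * (1 - p) / 2. A
  half space, the case of equal normals, has p = 1 and yields nothing. The margin p - 1 also pays
  for the losses: logarithms, and path oscillation with an exponent slightly below 1/2.

  The normals met by the processes vary with time, whereas the probability estimate is for a fixed
  pair. The cones therefore carry a slack \<epsilon> that absorbs small changes of the normals, so
  that countably many pairs are enough.

  The path is seen only on a grid running backwards from a dyadic time. Superharmonicity thus
  becomes a statement about one Gaussian step: an expansion to second order whose quadratic part has
  a negative mean. It is available only at distances from the apex that are large compared with the
  step, and the visits near the apex have to be counted separately.\<close>

definition gauss :: "real \<Rightarrow> 'a::euclidean_space measure" where
  "gauss \<sigma> = density lborel (\<lambda>z. ennreal (\<Prod>b\<in>Basis. normal_density 0 \<sigma> (z \<bullet> b)))"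

lemma sets_gauss [simp, measurable_cong]: "sets (gauss \<sigma>) = sets borel"
  by (simp add: gauss_def)

lemma space_gauss [simp]: "space (gauss \<sigma>) = UNIV"
  by (simp add: gauss_def)

text \<open>The density factorises over the coordinates and \<open>lborel\<close> is a product
  measure, so Fubini reduces a product of coordinate functions to one-dimensional normal moments.
  The Gaussian moments used later are derived from this.\<close>

lemma has_bochner_integral_gauss_prod:
  fixes f :: "'a::euclidean_space \<Rightarrow> real \<Rightarrow> real"
  assumes [measurable]: "\<And>b. b \<in> Basis \<Longrightarrow> f b \<in> borel_measurable borel"
    and int: "\<And>b. b \<in> Basis \<Longrightarrow> has_bochner_integral lborel (\<lambda>t. normal_density 0 \<sigma> t * f b t) (I b)"
  shows "has_bochner_integral (gauss \<sigma>) (\<lambda>z. \<Prod>b\<in>Basis. f b (z \<bullet> b)) (\<Prod>b\<in>Basis. I b)"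
proof -
  interpret product_sigma_finite "\<lambda>_::'a. lborel :: real measure"
    by standard
  have int': "integrable lborel (\<lambda>t. normal_density 0 \<sigma> t * f b t)"
    "(\<integral>t. normal_density 0 \<sigma> t * f b t \<partial>lborel) = I b" if "b \<in> Basis" for b
    using int[OF that] by (auto simp: has_bochner_integral_iff)
  have [measurable]: "(\<lambda>z::'a. \<Prod>b\<in>Basis. f b (z \<bullet> b)) \<in> borel_measurable borel"
    by (intro borel_measurable_prod) (auto intro: measurable_compose[OF _ assms(1)])
  let ?F = "\<lambda>z::'a. \<Prod>b\<in>Basis. normal_density 0 \<sigma> (z \<bullet> b) * f b (z \<bullet> b)"
  have [measurable]: "?F \<in> borel_measurable borel"
    by (simp add: prod.distrib)
  let ?P = "Pi\<^sub>M (Basis::'a set) (\<lambda>_. lborel :: real measure)"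
  let ?G = "\<lambda>x. \<Prod>b\<in>Basis. normal_density 0 \<sigma> (x b) * f b (x b)"
  have "integrable ?P ?G"
    by (rule product_integrable_prod) (simp_all add: int')
  moreover have "integral\<^sup>L ?P ?G = (\<Prod>b\<in>Basis. \<integral>t. normal_density 0 \<sigma> t * f b t \<partial>lborel)"
    by (rule product_integral_prod) (simp_all add: int')
  moreover have "(\<Prod>b\<in>Basis. \<integral>t. normal_density 0 \<sigma> t * f b t \<partial>lborel) = (\<Prod>b\<in>Basis. I b)"
    by (intro prod.cong) (simp_all add: int')
  ultimately have G: "has_bochner_integral ?P ?G (\<Prod>b\<in>Basis. I b)"
    by (simp only: has_bochner_integral_iff simp_thms)
  have eq: "?F (\<Sum>b\<in>Basis. x b *\<^sub>R b) = ?G x" for x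
    by (intro prod.cong) (simp_all add: inner_sum_left_Basis)
  have "has_bochner_integral (distr ?P borel (\<lambda>x. \<Sum>b\<in>Basis. x b *\<^sub>R b)) ?F (\<Prod>b\<in>Basis. I b)"
  proof (subst has_bochner_integral_distr)
    show "has_bochner_integral ?P (\<lambda>x. ?F (\<Sum>b\<in>Basis. x b *\<^sub>R b)) (\<Prod>b\<in>Basis. I b)"
      using G unfolding eq .
  qed measurable
  then have "has_bochner_integral lborel ?F (\<Prod>b\<in>Basis. I b)"
    by (subst lborel_eq)
  then show ?thesis
    unfolding gauss_def
    by (subst has_bochner_integral_density)
       (auto simp: prod.distrib intro!: prod_nonneg)
qed

section \<open>Moments of centred Gaussian measures\<close>

lemma has_bochner_integral_normal_const:
  assumes "\<sigma> > 0"
  shows "has_bochner_integral lborel (\<lambda>t. normal_density 0 \<sigma> t * 1) 1"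
  using normal_moment_even[OF assms, of 0 0] by simp

lemma has_bochner_integral_gauss_coordinate:
  fixes b :: "'a::euclidean_space"
  assumes "\<sigma> > 0" "b \<in> Basis" "g \<in> borel_measurable borel"
    and "has_bochner_integral lborel (\<lambda>t. normal_density 0 \<sigma> t * g t) I"
  shows "has_bochner_integral (gauss \<sigma>) (\<lambda>z. g (z \<bullet> b)) I"
proof -
  have "has_bochner_integral (gauss \<sigma>) (\<lambda>z::'a. \<Prod>c\<in>Basis. if c = b then g (z \<bullet> c) else 1)
      (\<Prod>c\<in>Basis. if c = b then I else 1)"
    by (rule has_bochner_integral_gauss_prod[where f="\<lambda>c t. if c = b then g t else 1"])
       (use assms has_bochner_integral_normal_const[OF assms(1)] in auto)
  then show ?thesis
    using assms(2) by (simp only: prod.delta finite_Basis if_True)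
qed

lemma prob_space_gauss:
  assumes "\<sigma> > 0"
  shows "prob_space (gauss \<sigma> :: 'a::euclidean_space measure)"
proof
  have "has_bochner_integral (gauss \<sigma>) (\<lambda>z::'a. \<Prod>c\<in>(Basis::'a set). 1 :: real) (\<Prod>c\<in>(Basis::'a set). 1)"
    using has_bochner_integral_normal_const[OF assms]
    by (intro has_bochner_integral_gauss_prod[where f="\<lambda>c t. 1" and I="\<lambda>c. 1"]) simp_all
  then have i: "integrable (gauss \<sigma> :: 'a measure) (\<lambda>z. 1 :: real)"
    and I: "(\<integral>z. 1 \<partial>(gauss \<sigma> :: 'a measure)) = (1 :: real)"
    unfolding has_bochner_integral_iff prod.neutral_const by blast+
  have "(\<integral>\<^sup>+ z. ennreal 1 \<partial>(gauss \<sigma> :: 'a measure)) = ennreal 1"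
    by (subst nn_integral_eq_integral[OF i]) (simp_all only: I AE_I2 zero_le_one)
  then show "emeasure (gauss \<sigma> :: 'a measure) (space (gauss \<sigma>)) = 1"
    by simp
qed

lemma gauss_first_moment:
  assumes "\<sigma> > 0" "b \<in> Basis"
  shows "has_bochner_integral (gauss \<sigma>) (\<lambda>z::'a::euclidean_space. z \<bullet> b) 0"
  using normal_moment_odd[OF assms(1), of 0 0]
  by (intro has_bochner_integral_gauss_coordinate[OF assms]) auto

lemma gauss_even_moment:
  assumes "\<sigma> > 0" "b \<in> Basis"
  shows "has_bochner_integral (gauss \<sigma>) (\<lambda>z::'a::euclidean_space. (z \<bullet> b) ^ (2 * k))
    (fact (2 * k) / ((2 / \<sigma>\<^sup>2)^k * fact k))"
  using normal_moment_even[OF assms(1), of 0 k]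
  by (intro has_bochner_integral_gauss_coordinate[OF assms, where g="\<lambda>t. t ^ (2 * k)"]) auto

lemma gauss_second_moment:
  assumes "\<sigma> > 0" and bc: "b \<in> Basis" "c \<in> Basis"
  shows "has_bochner_integral (gauss \<sigma>) (\<lambda>z::'a::euclidean_space. (z \<bullet> b) * (z \<bullet> c))
    (if b = c then \<sigma>\<^sup>2 else 0)"
proof (cases "b = c")
  case True
  then show ?thesis
    using gauss_even_moment[OF assms(1,2), of 1] by (simp add: power2_eq_square)
next
  case False
  have 1: "has_bochner_integral lborel (\<lambda>t. normal_density 0 \<sigma> t * t) 0"
    using normal_moment_odd[OF assms(1), of 0 0] by simp
  have "has_bochner_integral (gauss \<sigma>) (\<lambda>z::'a. \<Prod>b'\<in>Basis. if b' \<in> {b,c} then z \<bullet> b' else 1)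
    (\<Prod>b'\<in>Basis. if b' \<in> {b,c} then 0 else 1)"
    by (rule has_bochner_integral_gauss_prod[where f="\<lambda>b' t. if b' \<in> {b,c} then t else 1"])
       (use 1 has_bochner_integral_normal_const[OF assms(1)] in auto)
  moreover have "(\<Prod>b'\<in>Basis. if b' \<in> {b,c} then z \<bullet> b' else 1) = (z \<bullet> b) * (z \<bullet> c)" for z :: 'a
  proof -
    have "(\<Prod>b'\<in>Basis. if b' \<in> {b,c} then z \<bullet> b' else 1) = (\<Prod>b'\<in>Basis \<inter> {b,c}. z \<bullet> b')"
      by (simp only: prod.inter_restrict finite_Basis)
    also have "Basis \<inter> {b,c} = {b,c}" using bc by auto
    finally show ?thesis using False by simp
  qed
  moreover have "(\<Prod>b'\<in>Basis. if b' \<in> {b,c} then 0 else 1) = (0::real)"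
    using bc by (intro prod_zero) auto
  ultimately show ?thesis using False by (simp only: if_False)
qed

lemma has_bochner_integral_gauss_inner:
  fixes u :: "'a::euclidean_space"
  assumes "\<sigma> > 0"
  shows "has_bochner_integral (gauss \<sigma>) (\<lambda>z. u \<bullet> z) 0"
proof -
  have "has_bochner_integral (gauss \<sigma>) (\<lambda>z. \<Sum>b\<in>Basis. (u \<bullet> b) * (z \<bullet> b)) (\<Sum>b\<in>Basis. (u \<bullet> b) * 0)"
    by (intro has_bochner_integral_sum has_bochner_integral_mult_right gauss_first_moment assms)
  then show ?thesis by (simp only: euclidean_inner[symmetric] mult_zero_right sum.neutral_const)
qed

lemma has_bochner_integral_gauss_inner_mult:
  fixes u v :: "'a::euclidean_space"
  assumes "\<sigma> > 0"
  shows "has_bochner_integral (gauss \<sigma>) (\<lambda>z. (u \<bullet> z) * (v \<bullet> z)) (\<sigma>\<^sup>2 * (u \<bullet> v))"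
proof -
  have "has_bochner_integral (gauss \<sigma>)
     (\<lambda>z. \<Sum>b\<in>Basis. \<Sum>c\<in>Basis. ((u \<bullet> b) * (v \<bullet> c)) * ((z \<bullet> b) * (z \<bullet> c)))
     (\<Sum>b\<in>Basis. \<Sum>c\<in>Basis. ((u \<bullet> b) * (v \<bullet> c)) * (if b = c then \<sigma>\<^sup>2 else 0))"
    by (intro has_bochner_integral_sum has_bochner_integral_mult_right gauss_second_moment assms)
  moreover have "(\<Sum>b\<in>Basis. \<Sum>c\<in>Basis. ((u \<bullet> b) * (v \<bullet> c)) * ((z \<bullet> b) * (z \<bullet> c))) = (u \<bullet> z) * (v \<bullet> z)" for z
  proof -
    have "(u \<bullet> z) * (v \<bullet> z) = (\<Sum>b\<in>Basis. (u \<bullet> b) * (z \<bullet> b)) * (\<Sum>c\<in>Basis. (v \<bullet> c) * (z \<bullet> c))"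
      by (simp only: euclidean_inner[symmetric])
    also have "\<dots> = (\<Sum>b\<in>Basis. \<Sum>c\<in>Basis. ((u \<bullet> b) * (v \<bullet> c)) * ((z \<bullet> b) * (z \<bullet> c)))"
      unfolding sum_product by (intro sum.cong refl) (simp only: mult_ac)
    finally show ?thesis ..
  qed
  moreover have "(\<Sum>b\<in>Basis. \<Sum>c\<in>Basis. ((u \<bullet> b) * (v \<bullet> c)) * (if b = c then \<sigma>\<^sup>2 else 0)) = \<sigma>\<^sup>2 * (u \<bullet> v)"
  proof -
    have "(\<Sum>c\<in>Basis. ((u \<bullet> b) * (v \<bullet> c)) * (if b = c then \<sigma>\<^sup>2 else 0)) = \<sigma>\<^sup>2 * ((u \<bullet> b) * (v \<bullet> b))"
      if "b \<in> Basis" for b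
    proof -
      have "(\<Sum>c\<in>Basis. ((u \<bullet> b) * (v \<bullet> c)) * (if b = c then \<sigma>\<^sup>2 else 0))
        = (\<Sum>c\<in>Basis. if b = c then \<sigma>\<^sup>2 * ((u \<bullet> b) * (v \<bullet> c)) else 0)"
        by (intro sum.cong refl) simp
      then show ?thesis using that by simp
    qed
    then show ?thesis
      by (simp only: euclidean_inner[of u v] sum_distrib_left cong: sum.cong)
  qed
  ultimately show ?thesis by (simp only:)
qed

lemma has_bochner_integral_gauss_norm_square:
  assumes "\<sigma> > 0"
  shows "has_bochner_integral (gauss \<sigma>) (\<lambda>z::'a::euclidean_space. (norm z)\<^sup>2) (\<sigma>\<^sup>2 * DIM('a))"
proof -
  have "has_bochner_integral (gauss \<sigma>) (\<lambda>z::'a. \<Sum>b\<in>Basis. (z \<bullet> b) * (z \<bullet> b)) (\<Sum>b\<in>(Basis::'a set). \<sigma>\<^sup>2)"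
  proof (intro has_bochner_integral_sum)
    show "has_bochner_integral (gauss \<sigma>) (\<lambda>z::'a. (z \<bullet> b) * (z \<bullet> b)) (\<sigma>\<^sup>2)" if "b \<in> Basis" for b
      using gauss_second_moment[OF assms that that] by simp
  qed
  then show ?thesis
    by (simp only: power2_norm_eq_inner mult.commute sum_constant flip: euclidean_inner)
qed

lemma norm_power_le_sum_Basis:
  fixes z :: "'a::euclidean_space"
  shows "norm z ^ (2 * k) \<le> real DIM('a) ^ (2*k) * (\<Sum>b\<in>Basis. (z \<bullet> b) ^ (2 * k))"
proof -
  obtain b where b: "b \<in> Basis" "\<And>c. c \<in> Basis \<Longrightarrow> \<bar>z \<bullet> c\<bar> \<le> \<bar>z \<bullet> b\<bar>"
    using ex_is_arg_min_if_finite[of "Basis::'a set" "\<lambda>c. - \<bar>z \<bullet> c\<bar>"]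
    by (auto simp: is_arg_min_linorder)
  have "norm z \<le> (\<Sum>c\<in>Basis. \<bar>z \<bullet> c\<bar>)" by (rule norm_le_l1)
  also have "\<dots> \<le> real DIM('a) * \<bar>z \<bullet> b\<bar>"
    using b by (intro sum_bounded_above) auto
  finally have "norm z ^ (2*k) \<le> (real DIM('a) * \<bar>z \<bullet> b\<bar>) ^ (2*k)"
    by (intro power_mono) auto
  also have "\<dots> = real DIM('a) ^ (2*k) * (z \<bullet> b) ^ (2*k)"
    by (simp add: power_mult_distrib power_even_abs)
  also have "(z \<bullet> b) ^ (2*k) \<le> (\<Sum>b\<in>Basis. (z \<bullet> b) ^ (2 * k))"
    using b by (intro member_le_sum) auto
  finally show ?thesis by simp
qed

text \<open>By scaling, one constant serves all standard deviations. The exponent stays free: the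
  fourth moment will control the cubic error in the expansion of the superharmonic function, and
  high moments give the tails behind the oscillation of the path.\<close>

lemma gauss_norm_moment:
  obtains C where "C > 0" "\<And>\<sigma>. \<sigma> > 0 \<Longrightarrow>
     integrable (gauss \<sigma>) (\<lambda>z::'a::euclidean_space. norm z ^ (2*k)) \<and>
     (\<integral>z. norm z ^ (2*k) \<partial>(gauss \<sigma> :: 'a measure)) \<le> C * \<sigma> ^ (2*k)"
proof -
  define C where "C = real DIM('a) ^ (2*k) * (DIM('a) * (fact (2 * k) / (2 ^ k * fact k)))"
  show ?thesis
  proof (rule that[of C])
    show "C > 0" unfolding C_def
      by (intro mult_pos_pos divide_pos_pos zero_less_power) simp_all
    fix \<sigma> :: real assume \<sigma>: "\<sigma> > 0"
    have h: "has_bochner_integral (gauss \<sigma>) (\<lambda>z::'a. real DIM('a) ^ (2*k) * (\<Sum>b\<in>Basis. (z \<bullet> b) ^ (2 * k)))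
       (real DIM('a) ^ (2*k) * (\<Sum>b\<in>(Basis::'a set). (fact (2 * k) / ((2 / \<sigma>\<^sup>2)^k * fact k))))"
      by (intro has_bochner_integral_mult_right has_bochner_integral_sum gauss_even_moment \<sigma>)
    have i: "integrable (gauss \<sigma>) (\<lambda>z::'a. norm z ^ (2*k))"
    proof (rule Bochner_Integration.integrable_bound)
      show "integrable (gauss \<sigma>) (\<lambda>z::'a. real DIM('a) ^ (2*k) * (\<Sum>b\<in>Basis. (z \<bullet> b) ^ (2 * k)))"
        using h by (simp only: has_bochner_integral_iff)
      show "(\<lambda>z::'a. norm z ^ (2*k)) \<in> borel_measurable (gauss \<sigma>)" by measurable
      have "norm (norm z ^ (2*k)) \<le> norm (real DIM('a) ^ (2*k) * (\<Sum>b\<in>Basis. (z \<bullet> b) ^ (2 * k)))" for z :: 'a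
        using norm_power_le_sum_Basis[of z k] by (simp add: abs_mult sum_nonneg)
      then show "AE z::'a in gauss \<sigma>. norm (norm z ^ (2*k)) \<le> norm (real DIM('a) ^ (2*k) * (\<Sum>b\<in>Basis. (z \<bullet> b) ^ (2 * k)))"
        by (intro AE_I2)
    qed
    have "(\<integral>z. norm z ^ (2*k) \<partial>(gauss \<sigma> :: 'a measure)) \<le> (real DIM('a) ^ (2*k) * (\<Sum>b\<in>(Basis::'a set). (fact (2 * k) / ((2 / \<sigma>\<^sup>2)^k * fact k))))"
      using integral_mono[OF i h[THEN has_bochner_integral_iff[THEN iffD1], THEN conjunct1]] norm_power_le_sum_Basis[where 'a='a, of _ k]
      unfolding has_bochner_integral_integral_eq[OF h] by blast
    also have "\<dots> = C * \<sigma> ^ (2*k)"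
      using \<sigma> by (simp add: C_def power_mult power_divide)
    finally show "integrable (gauss \<sigma>) (\<lambda>z::'a::euclidean_space. norm z ^ (2*k)) \<and>
       (\<integral>z. norm z ^ (2*k) \<partial>(gauss \<sigma> :: 'a measure)) \<le> C * \<sigma> ^ (2*k)" using i by simp
  qed
qed

text \<open>The density is largest at the origin, so its maximum times the volume bounds the mass.
  The exponent \<open>DIM('a)\<close> matters: in dimension at least 2 it makes the probability that
  a walk is within a multiple of its step size of the origin after \<open>j\<close> steps at most of
  order \<open>1 / j\<close>.\<close>

lemma emeasure_gauss_ball_le:
  obtains C where "C > 0" "\<And>\<sigma> r. \<sigma> > 0 \<Longrightarrow> r \<ge> 0 \<Longrightarrow>
     emeasure (gauss \<sigma>) (ball (0::'a::euclidean_space) r) \<le> ennreal (C * (r / \<sigma>) ^ DIM('a))"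
proof -
  define C where "C = unit_ball_vol (DIM('a)) * (1 / sqrt (2 * pi)) ^ DIM('a)"
  show ?thesis
  proof (rule that[of C])
    show "C > 0" unfolding C_def
      by (intro mult_pos_pos zero_less_power unit_ball_vol_pos) simp_all
    fix \<sigma> r :: real assume \<sigma>: "\<sigma> > 0" and r: "r \<ge> 0"
    have bd: "(\<Prod>b\<in>Basis. normal_density 0 \<sigma> (z \<bullet> b)) \<le> (1 / (sqrt (2 * pi) * \<sigma>)) ^ DIM('a)" for z :: 'a
    proof -
      have "(\<Prod>b\<in>Basis. normal_density 0 \<sigma> (z \<bullet> b)) \<le> (\<Prod>b\<in>(Basis::'a set). 1 / (sqrt (2 * pi) * \<sigma>))"
        using \<sigma> by (intro prod_mono) (auto simp: normal_density_def real_sqrt_mult field_simps)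
      then show ?thesis by simp
    qed
    have "emeasure (gauss \<sigma>) (ball (0::'a) r) = (\<integral>\<^sup>+z. ennreal (\<Prod>b\<in>Basis. normal_density 0 \<sigma> (z \<bullet> b)) * indicator (ball (0::'a) r) z \<partial>lborel)"
      unfolding gauss_def by (subst emeasure_density) auto
    also have "\<dots> \<le> (\<integral>\<^sup>+z. ennreal ((1 / (sqrt (2 * pi) * \<sigma>)) ^ DIM('a)) * indicator (ball (0::'a) r) z \<partial>lborel)"
      using bd by (intro nn_integral_mono mult_right_mono ennreal_leI) auto
    also have "\<dots> = ennreal ((1 / (sqrt (2 * pi) * \<sigma>)) ^ DIM('a)) * emeasure lborel (ball (0::'a) r)"
      by (subst nn_integral_cmult_indicator) auto
    also have "emeasure lborel (ball (0::'a) r) = ennreal (unit_ball_vol DIM('a) * r ^ DIM('a))"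
      using r by (rule emeasure_ball)
    also have "ennreal ((1 / (sqrt (2 * pi) * \<sigma>)) ^ DIM('a)) * \<dots> = ennreal (C * (r / \<sigma>) ^ DIM('a))"
      using r \<sigma> by (subst ennreal_mult[symmetric]) (simp_all add: C_def power_mult_distrib power_divide field_simps)
    finally show "emeasure (gauss \<sigma>) (ball (0::'a) r) \<le> ennreal (C * (r / \<sigma>) ^ DIM('a))" .
  qed
qed

section \<open>Second order expansions with Gaussian quadratic part\<close>

text \<open>The number \<open>\<tau>\<close> is half the Laplacian of \<open>F\<close> at \<open>0\<close>: it is read off the Gaussian mean of the
  quadratic part, so that no second derivatives have to be computed.\<close>

definition jet :: "real \<Rightarrow> real \<Rightarrow> ('a::euclidean_space \<Rightarrow> real) \<Rightarrow> real \<Rightarrow> 'a \<Rightarrow> real \<Rightarrow> bool" where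
  "jet \<rho> C F c g \<tau> \<longleftrightarrow> \<bar>c\<bar> \<le> C \<and> norm g \<le> C \<and>
    (\<exists>q. (\<forall>z. \<bar>q z\<bar> \<le> C * (norm z)\<^sup>2) \<and> (\<forall>a z. q (a *\<^sub>R z) = a\<^sup>2 * q z) \<and>
      (\<forall>\<sigma>>0. has_bochner_integral (gauss \<sigma>) q (\<sigma>\<^sup>2 * \<tau>)) \<and>
      (\<forall>z. norm z \<le> \<rho> \<longrightarrow> \<bar>F z - (c + g \<bullet> z + q z)\<bar> \<le> C * norm z ^ 3))"

lemma jetE:
  assumes "jet \<rho> C F c g \<tau>"
  obtains q where "\<bar>c\<bar> \<le> C" "norm g \<le> C" "\<And>z. \<bar>q z\<bar> \<le> C * (norm z)\<^sup>2"
    "\<And>a z. q (a *\<^sub>R z) = a\<^sup>2 * q z"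
    "\<And>\<sigma>. \<sigma> > 0 \<Longrightarrow> has_bochner_integral (gauss \<sigma>) q (\<sigma>\<^sup>2 * \<tau>)"
    "\<And>z. norm z \<le> \<rho> \<Longrightarrow> \<bar>F z - (c + g \<bullet> z + q z)\<bar> \<le> C * norm z ^ 3"
  using assms unfolding jet_def by blast

lemma jetI:
  assumes "\<bar>c\<bar> \<le> C" "norm g \<le> C" "\<And>z. \<bar>q z\<bar> \<le> C * (norm z)\<^sup>2"
    "\<And>a z. q (a *\<^sub>R z) = a\<^sup>2 * q z"
    "\<And>\<sigma>. \<sigma> > 0 \<Longrightarrow> has_bochner_integral (gauss \<sigma>) q (\<sigma>\<^sup>2 * \<tau>)"
    "\<And>z. norm z \<le> \<rho> \<Longrightarrow> \<bar>F z - (c + g \<bullet> z + q z)\<bar> \<le> C * norm z ^ 3"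
  shows "jet \<rho> C F c g \<tau>"
  using assms unfolding jet_def by blast

section \<open>Rules for second order expansions\<close>

lemma jet_linear:
  assumes "\<bar>c\<bar> \<le> C" "norm g \<le> C" "0 \<le> C"
  shows "jet \<rho> C (\<lambda>z. c + g \<bullet> z) c g 0"
  by (rule jetI[where q="\<lambda>_. 0"]) (use assms in auto)

lemma jet_norm_square:
  fixes v :: "'a::euclidean_space"
  assumes "norm v = 1"
  shows "jet \<rho> 2 (\<lambda>z. (norm (v + z))\<^sup>2) 1 (2 *\<^sub>R v) (real DIM('a))"
proof (rule jetI[where q="\<lambda>z. (norm z)\<^sup>2"])
  show "\<bar>(norm (v + z))\<^sup>2 - (1 + 2 *\<^sub>R v \<bullet> z + (norm z)\<^sup>2)\<bar> \<le> 2 * norm z ^ 3" for z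
  proof -
    have "(norm (v + z))\<^sup>2 = 1 + 2 * (v \<bullet> z) + (norm z)\<^sup>2"
      using dot_norm[of v z] assms by simp
    then show ?thesis by simp
  qed
qed (use assms has_bochner_integral_gauss_norm_square in \<open>auto simp: power_mult_distrib\<close>)

lemma jet_add:
  assumes "jet \<rho> C F c g \<tau>" "jet \<rho> D H d k \<upsilon>"
  shows "jet \<rho> (C + D) (\<lambda>z. F z + H z) (c + d) (g + k) (\<tau> + \<upsilon>)"
proof -
  from assms(1) obtain q where q: "\<bar>c\<bar> \<le> C" "norm g \<le> C" "\<And>z. \<bar>q z\<bar> \<le> C * (norm z)\<^sup>2"
    "\<And>a z. q (a *\<^sub>R z) = a\<^sup>2 * q z"
    "\<And>\<sigma>. \<sigma> > 0 \<Longrightarrow> has_bochner_integral (gauss \<sigma>) q (\<sigma>\<^sup>2 * \<tau>)"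
    "\<And>z. norm z \<le> \<rho> \<Longrightarrow> \<bar>F z - (c + g \<bullet> z + q z)\<bar> \<le> C * norm z ^ 3"
    by (rule jetE) blast
  from assms(2) obtain r where r: "\<bar>d\<bar> \<le> D" "norm k \<le> D" "\<And>z. \<bar>r z\<bar> \<le> D * (norm z)\<^sup>2"
    "\<And>a z. r (a *\<^sub>R z) = a\<^sup>2 * r z"
    "\<And>\<sigma>. \<sigma> > 0 \<Longrightarrow> has_bochner_integral (gauss \<sigma>) r (\<sigma>\<^sup>2 * \<upsilon>)"
    "\<And>z. norm z \<le> \<rho> \<Longrightarrow> \<bar>H z - (d + k \<bullet> z + r z)\<bar> \<le> D * norm z ^ 3"
    by (rule jetE) blast
  show ?thesis
  proof (rule jetI[where q="\<lambda>z. q z + r z"])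
    show "norm (g + k) \<le> C + D" using q(2) r(2) norm_triangle_ineq[of g k] by linarith
    show "\<bar>q z + r z\<bar> \<le> (C + D) * (norm z)\<^sup>2" for z
      using q(3)[of z] r(3)[of z] by (simp add: distrib_right)
    show "q (a *\<^sub>R z) + r (a *\<^sub>R z) = a\<^sup>2 * (q z + r z)" for a z
      by (simp add: q(4) r(4) distrib_left)
    show "has_bochner_integral (gauss \<sigma>) (\<lambda>z. q z + r z) (\<sigma>\<^sup>2 * (\<tau> + \<upsilon>))" if "\<sigma> > 0" for \<sigma>
      unfolding distrib_left by (intro has_bochner_integral_add q(5) r(5) that)
    show "\<bar>F z + H z - (c + d + (g + k) \<bullet> z + (q z + r z))\<bar> \<le> (C + D) * norm z ^ 3" if "norm z \<le> \<rho>" for z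
      using q(6)[OF that] r(6)[OF that] by (simp add: distrib_right inner_add_left)
  qed (use q r in auto)
qed

lemma jet_cmult:
  assumes "jet \<rho> C F c g \<tau>"
  shows "jet \<rho> (\<bar>a\<bar> * C) (\<lambda>z. a * F z) (a * c) (a *\<^sub>R g) (a * \<tau>)"
proof -
  from assms(1) obtain q where q: "\<bar>c\<bar> \<le> C" "norm g \<le> C" "\<And>z. \<bar>q z\<bar> \<le> C * (norm z)\<^sup>2"
    "\<And>a z. q (a *\<^sub>R z) = a\<^sup>2 * q z"
    "\<And>\<sigma>. \<sigma> > 0 \<Longrightarrow> has_bochner_integral (gauss \<sigma>) q (\<sigma>\<^sup>2 * \<tau>)"
    "\<And>z. norm z \<le> \<rho> \<Longrightarrow> \<bar>F z - (c + g \<bullet> z + q z)\<bar> \<le> C * norm z ^ 3"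
    by (rule jetE) blast
  show ?thesis
  proof (rule jetI[where q="\<lambda>z. a * q z"])
    show "\<bar>a * q z\<bar> \<le> \<bar>a\<bar> * C * (norm z)\<^sup>2" for z
      using mult_left_mono[OF q(3)[of z], of "\<bar>a\<bar>"] by (simp add: abs_mult mult.assoc)
    show "a * q (b *\<^sub>R z) = b\<^sup>2 * (a * q z)" for b z
      by (simp add: q(4))
    have "has_bochner_integral (gauss \<sigma>) (\<lambda>z. a * q z) (a * (\<sigma>\<^sup>2 * \<tau>))" if "\<sigma> > 0" for \<sigma>
      by (intro has_bochner_integral_mult_right q(5) that)
    then show "has_bochner_integral (gauss \<sigma>) (\<lambda>z. a * q z) (\<sigma>\<^sup>2 * (a * \<tau>))" if "\<sigma> > 0" for \<sigma>
      using that by (simp add: mult_ac)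
    show "\<bar>a * F z - (a * c + a *\<^sub>R g \<bullet> z + a * q z)\<bar> \<le> \<bar>a\<bar> * C * norm z ^ 3" if "norm z \<le> \<rho>" for z
    proof -
      have "\<bar>a * F z - (a * c + a *\<^sub>R g \<bullet> z + a * q z)\<bar> = \<bar>a\<bar> * \<bar>F z - (c + g \<bullet> z + q z)\<bar>"
        by (simp add: abs_mult[symmetric] algebra_simps)
      then show ?thesis using mult_left_mono[OF q(6)[OF that], of "\<bar>a\<bar>"] by (simp add: mult.assoc)
    qed
  qed (use q in \<open>auto simp: abs_mult intro!: mult_left_mono\<close>)
qed

lemma abs_mult_le:
  fixes a b :: real
  shows "\<bar>a\<bar> \<le> A \<Longrightarrow> \<bar>b\<bar> \<le> B \<Longrightarrow> \<bar>a * b\<bar> \<le> A * B"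
  by (simp add: abs_mult mult_mono)

text \<open>This is the product rule for half the Laplacian: the term \<open>g \<bullet> k\<close>
  arises as the Gaussian mean of \<open>(g \<bullet> z) * (k \<bullet> z)\<close>. The factor 10
  counts the products of order three or higher that are left over, with
  \<open>norm z \<le> 1\<close> used to lower the exponents.\<close>

lemma jet_mult:
  assumes "jet \<rho> C F c g \<tau>" "jet \<rho> D H d k \<upsilon>" "\<rho> \<le> 1"
  shows "jet \<rho> (10 * C * D) (\<lambda>z. F z * H z) (c * d) (c *\<^sub>R k + d *\<^sub>R g) (c * \<upsilon> + d * \<tau> + g \<bullet> k)"
proof -
  from assms(1) obtain q where q: "\<bar>c\<bar> \<le> C" "norm g \<le> C" "\<And>z. \<bar>q z\<bar> \<le> C * (norm z)\<^sup>2"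
    "\<And>a z. q (a *\<^sub>R z) = a\<^sup>2 * q z"
    "\<And>\<sigma>. \<sigma> > 0 \<Longrightarrow> has_bochner_integral (gauss \<sigma>) q (\<sigma>\<^sup>2 * \<tau>)"
    "\<And>z. norm z \<le> \<rho> \<Longrightarrow> \<bar>F z - (c + g \<bullet> z + q z)\<bar> \<le> C * norm z ^ 3"
    by (rule jetE) blast
  from assms(2) obtain r where r: "\<bar>d\<bar> \<le> D" "norm k \<le> D" "\<And>z. \<bar>r z\<bar> \<le> D * (norm z)\<^sup>2"
    "\<And>a z. r (a *\<^sub>R z) = a\<^sup>2 * r z"
    "\<And>\<sigma>. \<sigma> > 0 \<Longrightarrow> has_bochner_integral (gauss \<sigma>) r (\<sigma>\<^sup>2 * \<upsilon>)"
    "\<And>z. norm z \<le> \<rho> \<Longrightarrow> \<bar>H z - (d + k \<bullet> z + r z)\<bar> \<le> D * norm z ^ 3"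
    by (rule jetE) blast
  have CD: "0 \<le> C" "0 \<le> D" "0 \<le> C * D" using q(1) r(1) by auto
  have l: "\<bar>g \<bullet> z\<bar> \<le> C * norm z" "\<bar>k \<bullet> z\<bar> \<le> D * norm z" for z
    using Cauchy_Schwarz_ineq2[of g z] Cauchy_Schwarz_ineq2[of k z] q(2) r(2)
    by (meson mult_right_mono norm_ge_zero order_trans)+
  show ?thesis
  proof (rule jetI[where q="\<lambda>z. c * r z + d * q z + (g \<bullet> z) * (k \<bullet> z)"])
    show "\<bar>c * d\<bar> \<le> 10 * C * D" using abs_mult_le[OF q(1) r(1)] CD by simp
    have "norm (c *\<^sub>R k + d *\<^sub>R g) \<le> \<bar>c\<bar> * norm k + \<bar>d\<bar> * norm g"
      by (metis norm_scaleR norm_triangle_ineq)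
    also have "\<dots> \<le> C * D + D * C"
      using q r CD by (intro add_mono mult_mono) auto
    also have "\<dots> \<le> 10 * (C * D)" using CD(3) mult.commute[of C D] by linarith
    finally show "norm (c *\<^sub>R k + d *\<^sub>R g) \<le> 10 * C * D" by (simp only: mult.assoc)
    show "\<bar>c * r z + d * q z + (g \<bullet> z) * (k \<bullet> z)\<bar> \<le> 10 * C * D * (norm z)\<^sup>2" for z
    proof -
      have "\<bar>c * r z + d * q z + (g \<bullet> z) * (k \<bullet> z)\<bar> \<le> C * (D * (norm z)\<^sup>2) + D * (C * (norm z)\<^sup>2) + (C * norm z) * (D * norm z)"
        using abs_mult_le[OF q(1) r(3)[of z]] abs_mult_le[OF r(1) q(3)[of z]] abs_mult_le[OF l(1)[of z] l(2)[of z]]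
        by linarith
      also have "\<dots> = 3 * (C * D * (norm z)\<^sup>2)" by (simp add: power2_eq_square algebra_simps)
      also have "\<dots> \<le> 10 * (C * D * (norm z)\<^sup>2)" using CD by (intro mult_right_mono) auto
      finally show ?thesis by (simp add: mult_ac)
    qed
    show "c * r (a *\<^sub>R z) + d * q (a *\<^sub>R z) + (g \<bullet> (a *\<^sub>R z)) * (k \<bullet> (a *\<^sub>R z))
        = a\<^sup>2 * (c * r z + d * q z + (g \<bullet> z) * (k \<bullet> z))" for a z
      by (simp add: q(4) r(4) algebra_simps power2_eq_square)
    show "has_bochner_integral (gauss \<sigma>) (\<lambda>z. c * r z + d * q z + (g \<bullet> z) * (k \<bullet> z))
        (\<sigma>\<^sup>2 * (c * \<upsilon> + d * \<tau> + g \<bullet> k))" if "\<sigma> > 0" for \<sigma>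
    proof -
      have "has_bochner_integral (gauss \<sigma>) (\<lambda>z. c * r z + d * q z + (g \<bullet> z) * (k \<bullet> z))
        (c * (\<sigma>\<^sup>2 * \<upsilon>) + d * (\<sigma>\<^sup>2 * \<tau>) + \<sigma>\<^sup>2 * (g \<bullet> k))"
        by (intro has_bochner_integral_add has_bochner_integral_mult_right q(5) r(5)
              has_bochner_integral_gauss_inner_mult that)
      then show ?thesis by (simp add: algebra_simps)
    qed
    show "\<bar>F z * H z - (c * d + (c *\<^sub>R k + d *\<^sub>R g) \<bullet> z + (c * r z + d * q z + (g \<bullet> z) * (k \<bullet> z)))\<bar>
        \<le> 10 * C * D * norm z ^ 3" if z: "norm z \<le> \<rho>" for z
    proof -
      define n where "n = norm z"
      define e where "e = F z - (c + g \<bullet> z + q z)"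
      define e' where "e' = H z - (d + k \<bullet> z + r z)"
      have n: "0 \<le> n" "n \<le> 1" using z assms(3) by (auto simp: n_def)
      have n2: "n ^ 2 \<le> 1" "n ^ 3 \<le> 1" "n ^ 4 \<le> n ^ 3"
        using n by (auto intro: power_le_one power_decreasing)
      have e: "\<bar>e\<bar> \<le> C * n ^ 3" "\<bar>e'\<bar> \<le> D * n ^ 3"
        using q(6)[OF z] r(6)[OF z] by (auto simp: e_def e'_def n_def)
      have F: "F z = c + g \<bullet> z + q z + e" and H: "H z = d + k \<bullet> z + r z + e'"
        by (auto simp: e_def e'_def)
      have b1: "C * n \<le> C" "C * n ^ 2 \<le> C" "D * n \<le> D" "D * n ^ 2 \<le> D" "D * n ^ 3 \<le> D"
        using n n2 CD by (auto intro: mult_left_le)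
      have b: "\<bar>d + k \<bullet> z + r z + e'\<bar> \<le> 4 * D" "\<bar>c + g \<bullet> z + q z\<bar> \<le> 3 * C"
        using r(1) r(3)[of z] l(2)[of z] e(2) q(1) q(3)[of z] l(1)[of z] b1 unfolding n_def[symmetric] by linarith+
      have "F z * H z - (c * d + (c *\<^sub>R k + d *\<^sub>R g) \<bullet> z + (c * r z + d * q z + (g \<bullet> z) * (k \<bullet> z)))
        = (g \<bullet> z) * r z + q z * (k \<bullet> z) + q z * r z + e * (d + k \<bullet> z + r z + e') + (c + g \<bullet> z + q z) * e'"
        unfolding F H by (simp add: algebra_simps)
      also have "\<bar>\<dots>\<bar> \<le> (C * n) * (D * n\<^sup>2) + (C * n\<^sup>2) * (D * n) + (C * n\<^sup>2) * (D * n\<^sup>2)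
          + (C * n ^ 3) * (4 * D) + (3 * C) * (D * n ^ 3)"
        using abs_mult_le[OF l(1)[of z] r(3)[of z]] abs_mult_le[OF q(3)[of z] l(2)[of z]]
          abs_mult_le[OF q(3)[of z] r(3)[of z]] abs_mult_le[OF e(1) b(1)] abs_mult_le[OF b(2) e(2)]
        unfolding n_def[symmetric] by linarith
      also have "\<dots> = C * D * (9 * n ^ 3 + n ^ 4)"
        by (simp add: power2_eq_square power3_eq_cube power4_eq_xxxx algebra_simps)
      also have "\<dots> \<le> C * D * (10 * n ^ 3)"
        using CD n2 by (intro mult_left_mono) auto
      finally show ?thesis by (simp add: n_def mult_ac)
    qed
  qed
qed

section \<open>Real powers of second order expansions\<close>

lemma powr_bound_interval:
  fixes a b t :: real
  assumes "0 < a" "a \<le> t" "t \<le> b"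
  shows "t powr \<beta> \<le> a powr \<beta> + b powr \<beta>"
proof (cases "\<beta> \<ge> 0")
  case True
  then have "t powr \<beta> \<le> b powr \<beta>" using assms by (intro powr_mono2) auto
  then show ?thesis by (simp add: add_increasing)
next
  case False
  then have "t powr \<beta> \<le> a powr \<beta>" using assms by (intro powr_mono2') auto
  then show ?thesis by (simp add: add_increasing2)
qed

text \<open>The constant is uniform over base points in a compact interval away from 0: increments
  up to \<open>c0 / 2\<close> keep the intermediate point of Taylor's formula at least
  \<open>c0 / 2\<close>.\<close>

lemma powr_taylor:
  fixes c0 c1 \<alpha> :: real
  assumes "0 < c0" "c0 \<le> c1"
  obtains D where "0 \<le> D" "\<And>c u. c0 \<le> c \<Longrightarrow> c \<le> c1 \<Longrightarrow> \<bar>u\<bar> \<le> c0 / 2 \<Longrightarrow>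
    \<bar>(c + u) powr \<alpha> - (c powr \<alpha> + \<alpha> * c powr (\<alpha> - 1) * u + \<alpha> * (\<alpha> - 1) / 2 * c powr (\<alpha> - 2) * u\<^sup>2)\<bar> \<le> D * \<bar>u\<bar> ^ 3"
proof -
  define D where "D = \<bar>\<alpha> * (\<alpha> - 1) * (\<alpha> - 2)\<bar> / 6 * ((c0 / 2) powr (\<alpha> - 3) + (c1 + c0) powr (\<alpha> - 3))"
  show ?thesis
  proof (rule that)
    show "0 \<le> D" by (auto simp: D_def)
    fix c u :: real assume c: "c0 \<le> c" "c \<le> c1" "\<bar>u\<bar> \<le> c0 / 2"
    define diff where "diff = (\<lambda>(m::nat) t. (\<Prod>i<m. \<alpha> - real i) * t powr (\<alpha> - m))"
    show "\<bar>(c + u) powr \<alpha> - (c powr \<alpha> + \<alpha> * c powr (\<alpha> - 1) * u + \<alpha> * (\<alpha> - 1) / 2 * c powr (\<alpha> - 2) * u\<^sup>2)\<bar> \<le> D * \<bar>u\<bar> ^ 3"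
    proof (cases "u = 0")
      case False
      have D: "\<forall>m t. m < 3 \<and> c0 / 2 \<le> t \<and> t \<le> c1 + c0 \<longrightarrow> DERIV (diff m) t :> diff (Suc m) t"
      proof (intro allI impI)
        fix m :: nat and t assume "m < 3 \<and> c0 / 2 \<le> t \<and> t \<le> c1 + c0"
        then have "t > 0" using assms by linarith
        then show "DERIV (diff m) t :> diff (Suc m) t"
          unfolding diff_def
          by (auto intro!: derivative_eq_intros simp: mult_ac algebra_simps)
      qed
      have "c0 / 2 \<le> c" "c \<le> c1 + c0" "c0 / 2 \<le> c + u" "c + u \<le> c1 + c0"
        using c assms by linarith+
      then obtain t where t: "if c + u < c then c + u < t \<and> t < c else c < t \<and> t < c + u"
        "(c + u) powr \<alpha> = (\<Sum>m<3. diff m c / fact m * (c + u - c) ^ m) + diff 3 t / fact 3 * (c + u - c) ^ 3"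
        using Taylor[of 3 diff "\<lambda>t. t powr \<alpha>" "c0 / 2" "c1 + c0" c "c + u", OF _ _ D] c False assms
        by (auto simp: diff_def)
      have tt: "c0 / 2 \<le> t" "t \<le> c1 + c0" using t(1) c assms by (auto split: if_splits)
      have "(c + u) powr \<alpha> - (c powr \<alpha> + \<alpha> * c powr (\<alpha> - 1) * u + \<alpha> * (\<alpha> - 1) / 2 * c powr (\<alpha> - 2) * u\<^sup>2)
         = (\<alpha> * (\<alpha> - 1) * (\<alpha> - 2)) / 6 * t powr (\<alpha> - 3) * u ^ 3"
        using t(2) by (simp add: diff_def numeral_3_eq_3 lessThan_Suc fact_numeral power2_eq_square algebra_simps)
      also have "\<bar>\<dots>\<bar> = \<bar>\<alpha> * (\<alpha> - 1) * (\<alpha> - 2)\<bar> / 6 * t powr (\<alpha> - 3) * \<bar>u\<bar> ^ 3"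
        by (simp add: abs_mult power_abs)
      also have "\<dots> \<le> D * \<bar>u\<bar> ^ 3"
        unfolding D_def using powr_bound_interval[OF _ tt, of "\<alpha> - 3"] assms
        by (intro mult_right_mono mult_left_mono) auto
      finally show ?thesis .
    qed simp
  qed
qed

text \<open>The chain rule, with the term in \<open>g \<bullet> g\<close> coming from the second
  derivative of the power. \<open>D\<close> depends only on \<open>c0\<close>, \<open>C\<close> and
  the exponent, because the base point of the expansion will run over a part of the unit sphere and
  one error constant must serve all of it. The condition on \<open>\<rho>\<close> keeps
  \<open>F z\<close> within \<open>c0 / 2\<close> of \<open>c\<close>.\<close>

lemma jet_powr:
  fixes c0 C \<alpha> :: real
  assumes "0 < c0" "c0 \<le> C"
  obtains D where "\<And>\<rho> (F :: 'a::euclidean_space \<Rightarrow> real) c g \<tau>. jet \<rho> C F c g \<tau> \<Longrightarrow> c0 \<le> c \<Longrightarrow> \<rho> \<le> 1 \<Longrightarrow> 3 * C * \<rho> \<le> c0 / 2 \<Longrightarrow>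
    jet \<rho> D (\<lambda>z. F z powr \<alpha>) (c powr \<alpha>) ((\<alpha> * c powr (\<alpha> - 1)) *\<^sub>R g)
      (\<alpha> * c powr (\<alpha> - 1) * \<tau> + \<alpha> * (\<alpha> - 1) / 2 * c powr (\<alpha> - 2) * (g \<bullet> g))"
proof -
  obtain E where E: "0 \<le> E" "\<And>c u. c0 \<le> c \<Longrightarrow> c \<le> C \<Longrightarrow> \<bar>u\<bar> \<le> c0 / 2 \<Longrightarrow>
    \<bar>(c + u) powr \<alpha> - (c powr \<alpha> + \<alpha> * c powr (\<alpha> - 1) * u + \<alpha> * (\<alpha> - 1) / 2 * c powr (\<alpha> - 2) * u\<^sup>2)\<bar> \<le> E * \<bar>u\<bar> ^ 3"
    using powr_taylor[OF assms, of \<alpha>] by metis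
  \<comment> \<open>A bound for the three Taylor coefficients that is uniform in \<open>c\<close>; a
    power of either sign of exponent is bounded by the sum of its values at the two ends.\<close>
  define A where "A = (c0 powr \<alpha> + C powr \<alpha>) + \<bar>\<alpha>\<bar> * (c0 powr (\<alpha> - 1) + C powr (\<alpha> - 1))
      + \<bar>\<alpha> * (\<alpha> - 1) / 2\<bar> * (c0 powr (\<alpha> - 2) + C powr (\<alpha> - 2))"
  define D where "D = A + A * C + 8 * A * C\<^sup>2 + 27 * E * C ^ 3"
  have C: "C > 0" using assms by simp
  have A0: "A \<ge> 0" unfolding A_def by (intro add_nonneg_nonneg mult_nonneg_nonneg) auto
  show ?thesis
  proof (rule that[of D])
    fix \<rho> and F :: "'a \<Rightarrow> real" and c g \<tau>
    assume jet: "jet \<rho> C F c g \<tau>" and c: "c0 \<le> c" and \<rho>: "\<rho> \<le> 1" "3 * C * \<rho> \<le> c0 / 2"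
    from jet obtain q where q: "\<bar>c\<bar> \<le> C" "norm g \<le> C" "\<And>z. \<bar>q z\<bar> \<le> C * (norm z)\<^sup>2"
      "\<And>a z. q (a *\<^sub>R z) = a\<^sup>2 * q z"
      "\<And>\<sigma>. \<sigma> > 0 \<Longrightarrow> has_bochner_integral (gauss \<sigma>) q (\<sigma>\<^sup>2 * \<tau>)"
      "\<And>z. norm z \<le> \<rho> \<Longrightarrow> \<bar>F z - (c + g \<bullet> z + q z)\<bar> \<le> C * norm z ^ 3"
      by (rule jetE) blast
    have cC: "c \<le> C" using q(1) by simp
    define a0 where "a0 = c powr \<alpha>"
    define a1 where "a1 = \<alpha> * c powr (\<alpha> - 1)"
    define a2 where "a2 = \<alpha> * (\<alpha> - 1) / 2 * c powr (\<alpha> - 2)"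
    have m: "\<bar>\<alpha>\<bar> * c powr (\<alpha> - 1) \<le> \<bar>\<alpha>\<bar> * (c0 powr (\<alpha> - 1) + C powr (\<alpha> - 1))"
      "\<bar>\<alpha> * (\<alpha> - 1) / 2\<bar> * c powr (\<alpha> - 2) \<le> \<bar>\<alpha> * (\<alpha> - 1) / 2\<bar> * (c0 powr (\<alpha> - 2) + C powr (\<alpha> - 2))"
      by (intro mult_left_mono powr_bound_interval[OF assms(1) c cC] abs_ge_zero)+
    have nn: "0 \<le> \<bar>\<alpha>\<bar> * (c0 powr (\<alpha> - 1) + C powr (\<alpha> - 1))"
      "0 \<le> \<bar>\<alpha> * (\<alpha> - 1) / 2\<bar> * (c0 powr (\<alpha> - 2) + C powr (\<alpha> - 2))"
      by (intro mult_nonneg_nonneg add_nonneg_nonneg abs_ge_zero powr_ge_zero)+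
    have a: "\<bar>a0\<bar> \<le> A" "\<bar>a1\<bar> \<le> A" "\<bar>a2\<bar> \<le> A"
    proof -
      have "\<bar>a0\<bar> \<le> c0 powr \<alpha> + C powr \<alpha>"
        using powr_bound_interval[OF assms(1) c cC, of \<alpha>] by (simp add: a0_def)
      moreover have "\<bar>a1\<bar> \<le> \<bar>\<alpha>\<bar> * (c0 powr (\<alpha> - 1) + C powr (\<alpha> - 1))"
        using m(1) by (simp add: a1_def abs_mult)
      moreover have "\<bar>a2\<bar> \<le> \<bar>\<alpha> * (\<alpha> - 1) / 2\<bar> * (c0 powr (\<alpha> - 2) + C powr (\<alpha> - 2))"
        using m(2) by (simp only: a2_def abs_mult powr_ge_zero abs_of_nonneg)
      ultimately show "\<bar>a0\<bar> \<le> A" "\<bar>a1\<bar> \<le> A" "\<bar>a2\<bar> \<le> A"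
        using nn powr_ge_zero[of c0 \<alpha>] powr_ge_zero[of C \<alpha>] unfolding A_def by linarith+
    qed
    have l: "\<bar>g \<bullet> z\<bar> \<le> C * norm z" for z
      using Cauchy_Schwarz_ineq2[of g z] q(2) by (meson mult_right_mono norm_ge_zero order_trans)
    have nnD: "0 \<le> A * C" "0 \<le> 8 * A * C\<^sup>2" "0 \<le> 27 * E * C ^ 3"
      using A0 C E(1) by (intro mult_nonneg_nonneg zero_le_power; simp)+
    have "jet \<rho> D (\<lambda>z. F z powr \<alpha>) a0 (a1 *\<^sub>R g) (a1 * \<tau> + a2 * (g \<bullet> g))"
    proof (rule jetI[where q="\<lambda>z. a1 * q z + a2 * ((g \<bullet> z) * (g \<bullet> z))"])
      show "\<bar>a0\<bar> \<le> D" using a nnD unfolding D_def by linarith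
      have "norm (a1 *\<^sub>R g) \<le> A * C" using a(2) q(2) A0 by (simp add: mult_mono)
      then show "norm (a1 *\<^sub>R g) \<le> D" using nnD A0 unfolding D_def by linarith
      show "\<bar>a1 * q z + a2 * ((g \<bullet> z) * (g \<bullet> z))\<bar> \<le> D * (norm z)\<^sup>2" for z
      proof -
        have "\<bar>a1 * q z + a2 * ((g \<bullet> z) * (g \<bullet> z))\<bar> \<le> A * (C * (norm z)\<^sup>2) + A * ((C * norm z) * (C * norm z))"
          using abs_mult_le[OF a(2) q(3)[of z]] abs_mult_le[OF a(3) abs_mult_le[OF l l]] by (smt (verit))
        also have "\<dots> = (A * C + A * C\<^sup>2) * (norm z)\<^sup>2" by (simp add: power2_eq_square algebra_simps)
        also have "\<dots> \<le> D * (norm z)\<^sup>2"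
          using nnD A0 by (intro mult_right_mono) (auto simp: D_def)
        finally show ?thesis .
      qed
      show "a1 * q (b *\<^sub>R z) + a2 * ((g \<bullet> (b *\<^sub>R z)) * (g \<bullet> (b *\<^sub>R z)))
        = b\<^sup>2 * (a1 * q z + a2 * ((g \<bullet> z) * (g \<bullet> z)))" for b z
        by (simp add: q(4) algebra_simps power2_eq_square)
      show "has_bochner_integral (gauss \<sigma>) (\<lambda>z. a1 * q z + a2 * ((g \<bullet> z) * (g \<bullet> z)))
        (\<sigma>\<^sup>2 * (a1 * \<tau> + a2 * (g \<bullet> g)))" if "\<sigma> > 0" for \<sigma>
      proof -
        have "has_bochner_integral (gauss \<sigma>) (\<lambda>z. a1 * q z + a2 * ((g \<bullet> z) * (g \<bullet> z)))
          (a1 * (\<sigma>\<^sup>2 * \<tau>) + a2 * (\<sigma>\<^sup>2 * (g \<bullet> g)))"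
          by (intro has_bochner_integral_add has_bochner_integral_mult_right q(5)
                has_bochner_integral_gauss_inner_mult that)
        then show ?thesis by (simp add: algebra_simps)
      qed
      show "\<bar>F z powr \<alpha> - (a0 + (a1 *\<^sub>R g) \<bullet> z + (a1 * q z + a2 * ((g \<bullet> z) * (g \<bullet> z))))\<bar> \<le> D * norm z ^ 3"
        if z: "norm z \<le> \<rho>" for z
      proof -
        define n where "n = norm z"
        define e where "e = F z - (c + g \<bullet> z + q z)"
        define u where "u = g \<bullet> z + q z + e"
        have n: "0 \<le> n" "n \<le> 1" "n \<le> \<rho>" using z \<rho> by (auto simp: n_def)
        have n2: "n ^ 2 \<le> n" "n ^ 3 \<le> n" "n ^ 3 \<le> n ^ 2"
          using n power_decreasing[of 1 2 n] power_decreasing[of 1 3 n] power_decreasing[of 2 3 n] by auto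
        have Cn: "C * n ^ 2 \<le> C * n" "C * n ^ 3 \<le> C * n" "C * n ^ 3 \<le> C * n ^ 2"
          using n2 C by (auto intro: mult_left_mono)
        have e: "\<bar>e\<bar> \<le> C * n ^ 3"
          using q(6)[OF z] by (auto simp: e_def n_def)
        have F: "F z = c + u" by (auto simp: e_def u_def)
        have u: "\<bar>u\<bar> \<le> 3 * C * n" "\<bar>u - g \<bullet> z\<bar> \<le> 2 * C * n ^ 2" "\<bar>u + g \<bullet> z\<bar> \<le> 4 * C * n"
          using e l[of z] q(3)[of z] Cn unfolding u_def n_def[symmetric] by linarith+
        have "3 * C * n \<le> 3 * C * \<rho>" using n C by (intro mult_left_mono) auto
        then have uc: "\<bar>u\<bar> \<le> c0 / 2" using u(1) \<rho>(2) by linarith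
        define R where "R = (c + u) powr \<alpha> - (a0 + a1 * u + a2 * u\<^sup>2)"
        have "\<bar>R\<bar> \<le> E * \<bar>u\<bar> ^ 3"
          using E(2)[OF c cC uc] by (simp add: R_def a0_def a1_def a2_def)
        also have "\<dots> \<le> E * (3 * C * n) ^ 3"
          using u(1) E(1) by (intro mult_left_mono power_mono) auto
        also have "\<dots> = 27 * E * C ^ 3 * n ^ 3" by (simp add: power_mult_distrib)
        finally have R: "\<bar>R\<bar> \<le> 27 * E * C ^ 3 * n ^ 3" .
        \<comment> \<open>Taylor's formula produces \<open>u\<^sup>2\<close> where the jet has
          \<open>(g \<bullet> z)\<^sup>2\<close>. The difference factors into one term of order
          \<open>n\<^sup>2\<close> and one of order \<open>n\<close>, hence is cubic.\<close>
        have "F z powr \<alpha> - (a0 + (a1 *\<^sub>R g) \<bullet> z + (a1 * q z + a2 * ((g \<bullet> z) * (g \<bullet> z))))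
          = R + a1 * e + a2 * ((u - g \<bullet> z) * (u + g \<bullet> z))"
          unfolding F R_def by (simp add: u_def algebra_simps power2_eq_square)
        also have "\<bar>\<dots>\<bar> \<le> 27 * E * C ^ 3 * n ^ 3 + A * (C * n ^ 3) + A * ((2 * C * n ^ 2) * (4 * C * n))"
          using R abs_mult_le[OF a(2) e] abs_mult_le[OF a(3) abs_mult_le[OF u(2) u(3)]] by (smt (verit))
        also have "\<dots> = (A * C + 8 * A * C\<^sup>2 + 27 * E * C ^ 3) * n ^ 3"
          by (simp add: power2_eq_square power3_eq_cube algebra_simps)
        also have "\<dots> \<le> D * n ^ 3"
          using n A0 by (intro mult_right_mono) (auto simp: D_def)
        finally show ?thesis by (simp add: n_def)
      qed
    qed
    then show "jet \<rho> D (\<lambda>z. F z powr \<alpha>) (c powr \<alpha>) ((\<alpha> * c powr (\<alpha> - 1)) *\<^sub>R g)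
      (\<alpha> * c powr (\<alpha> - 1) * \<tau> + \<alpha> * (\<alpha> - 1) / 2 * c powr (\<alpha> - 2) * (g \<bullet> g))"
      by (simp add: a0_def a1_def a2_def)
  qed
qed

section \<open>A homogeneous superharmonic function on a cone\<close>

definition axis_dist2 :: "'a::euclidean_space \<Rightarrow> 'a \<Rightarrow> real" where
  "axis_dist2 e v = (norm v)\<^sup>2 - (e \<bullet> v)\<^sup>2"

text \<open>With \<open>x = m \<bullet> v\<close>, \<open>y = e \<bullet> v\<close>, \<open>m \<bottom> e\<close> and \<open>\<varrho>\<^sup>2 = |v|\<^sup>2 - y\<^sup>2\<close> this is
  \<open>\<varrho>\<^sup>\<eta> (x + \<eta> \<psi>)\<close>, \<open>\<psi> = 2 \<varrho> - |v|\<^sup>2\<^sup>k \<varrho>\<^sup>1\<^sup>-\<^sup>2\<^sup>k\<close>, \<open>k = 2 d\<close>: to first order in \<open>\<eta>\<close> the factor \<open>\<varrho>\<^sup>\<eta>\<close> adds a positive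
  multiple of \<open>\<eta> x / \<varrho>\<^sup>2\<close> to the Laplacian of the harmonic function \<open>x\<close>, and the exponent \<open>k\<close> is chosen
  so large that \<open>\<Delta>\<psi>\<close> outweighs it.\<close>

definition lyap :: "'a::euclidean_space \<Rightarrow> 'a \<Rightarrow> real \<Rightarrow> 'a \<Rightarrow> real" where
  "lyap m e \<eta> v =
     (m \<bullet> v) * axis_dist2 e v powr (\<eta> / 2)
     + 2 * \<eta> * axis_dist2 e v powr ((1 + \<eta>) / 2)
     - \<eta> * ((norm v)\<^sup>2 powr (2 * DIM('a)) * axis_dist2 e v powr ((1 + \<eta>) / 2 - 2 * DIM('a)))"

section \<open>Homogeneity and expansion of the superharmonic function\<close>

lemma axis_dist2_eq:
  assumes "norm e = 1"
  shows "axis_dist2 e v = (norm (v - (e \<bullet> v) *\<^sub>R e))\<^sup>2"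
proof -
  have "e \<bullet> e = 1" using assms by (simp add: dot_square_norm)
  then show ?thesis
    unfolding axis_dist2_def power2_norm_eq_inner
    by (simp add: inner_diff_left inner_diff_right inner_commute power2_eq_square)
qed

lemma axis_dist2_nonneg: "norm e = 1 \<Longrightarrow> 0 \<le> axis_dist2 e v"
  by (simp add: axis_dist2_eq)

text \<open>All three summands have degree \<open>1 + \<eta>\<close>; in the last one the exponents
  of \<open>norm v\<close> and \<open>axis_dist2\<close> are matched for this. Bounds and expansions
  are therefore needed on the unit sphere only.\<close>

lemma lyap_scale:
  fixes v :: "'a::euclidean_space"
  assumes "norm e = 1" "r > 0" "0 < \<eta>"
  shows "lyap m e \<eta> (r *\<^sub>R v) = r powr (1 + \<eta>) * lyap m e \<eta> v"
proof -
  have t: "axis_dist2 e (r *\<^sub>R v) = r\<^sup>2 * axis_dist2 e v"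
    by (simp add: axis_dist2_def power_mult_distrib right_diff_distrib)
  have r2: "(r\<^sup>2) powr a = r powr (2 * a)" for a
    using assms(2) by (simp add: powr_powr flip: powr_numeral)
  have *: "axis_dist2 e (r *\<^sub>R v) powr a = r powr (2 * a) * axis_dist2 e v powr a" for a
    unfolding t using axis_dist2_nonneg[OF assms(1), of v] by (simp add: powr_mult r2)
  have s: "(norm (r *\<^sub>R v))\<^sup>2 powr a = r powr (2 * a) * (norm v)\<^sup>2 powr a" for a
    using assms(2) by (simp add: power_mult_distrib powr_mult r2)
  have "r * r powr \<eta> = r powr (1 + \<eta>)" using assms(2) by (simp add: powr_add)
  moreover have "r powr (2 * real (2 * DIM('a))) * r powr (2 * ((1 + \<eta>) / 2 - 2 * DIM('a))) = r powr (1 + \<eta>)"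
    unfolding powr_add[symmetric] by (rule arg_cong[where f="\<lambda>a. r powr a"]) (simp add: field_simps)
  moreover have "r powr (2 * ((1 + \<eta>) / 2)) = r powr (1 + \<eta>)" by (rule arg_cong[where f="\<lambda>a. r powr a"]) simp
  moreover have "r powr (2 * (\<eta> / 2)) = r powr \<eta>" by simp
  moreover have "lyap m e \<eta> (r *\<^sub>R v) = (r * r powr (2 * (\<eta> / 2))) * ((m \<bullet> v) * axis_dist2 e v powr (\<eta> / 2))
     + r powr (2 * ((1 + \<eta>) / 2)) * (2 * \<eta> * axis_dist2 e v powr ((1 + \<eta>) / 2))
     - (r powr (2 * real (2 * DIM('a))) * r powr (2 * ((1 + \<eta>) / 2 - 2 * DIM('a)))) *
     (\<eta> * ((norm v)\<^sup>2 powr (2 * DIM('a)) * axis_dist2 e v powr ((1 + \<eta>) / 2 - 2 * DIM('a))))"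
    unfolding lyap_def * s by (simp only: inner_scaleR_right mult_ac)
  ultimately show ?thesis
    unfolding lyap_def by (simp only: distrib_left right_diff_distrib)
qed

lemma borel_measurable_lyap [measurable]: "lyap m e \<eta> \<in> borel_measurable borel"
  unfolding lyap_def axis_dist2_def by measurable

text \<open>Half the Laplacian of a power of the radius in the \<open>DIM('a) - 1\<close> directions
  orthogonal to \<open>e\<close>, which explains the 3 in the trace. The radius
  \<open>c0 / 72\<close> is what \<open>jet_powr\<close> asks for when the jet constant of
  \<open>axis_dist2\<close> is 12, namely 2 from \<open>jet_norm_square\<close> and 10 from
  \<open>jet_mult\<close>.\<close>

lemma jet_axis_dist2_powr:
  fixes e :: "'a::euclidean_space" and \<alpha> :: real
  assumes e: "norm e = 1" and c0: "0 < c0" "c0 \<le> 1"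
  obtains D where "\<And>v. norm v = 1 \<Longrightarrow> (e \<bullet> v)\<^sup>2 \<le> 1 - c0 \<Longrightarrow>
    jet (c0 / 72) D (\<lambda>z. axis_dist2 e (v + z) powr \<alpha>) (axis_dist2 e v powr \<alpha>)
      ((2 * \<alpha> * axis_dist2 e v powr (\<alpha> - 1)) *\<^sub>R (v - (e \<bullet> v) *\<^sub>R e))
      (\<alpha> * (real DIM('a) - 3 + 2 * \<alpha>) * axis_dist2 e v powr (\<alpha> - 1))"
proof -
  obtain D where D: "\<And>\<rho> (F :: 'a \<Rightarrow> real) c g \<tau>. jet \<rho> 12 F c g \<tau> \<Longrightarrow> c0 \<le> c \<Longrightarrow> \<rho> \<le> 1 \<Longrightarrow> 3 * 12 * \<rho> \<le> c0 / 2 \<Longrightarrow>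
    jet \<rho> D (\<lambda>z. F z powr \<alpha>) (c powr \<alpha>) ((\<alpha> * c powr (\<alpha> - 1)) *\<^sub>R g)
      (\<alpha> * c powr (\<alpha> - 1) * \<tau> + \<alpha> * (\<alpha> - 1) / 2 * c powr (\<alpha> - 2) * (g \<bullet> g))"
    by (rule jet_powr[of c0 12 \<alpha>, where 'a='a]) (use c0 in simp, use c0 in simp, erule that)
  show ?thesis
  proof (rule that)
    fix v :: 'a assume v: "norm v = 1" and y: "(e \<bullet> v)\<^sup>2 \<le> 1 - c0"
    let ?\<rho> = "c0 / 72" and ?y = "e \<bullet> v"
    have \<rho>: "?\<rho> \<le> 1" "3 * 12 * ?\<rho> \<le> c0 / 2" using c0 by auto
    have ey: "\<bar>?y\<bar> \<le> 1" using Cauchy_Schwarz_ineq2[of e v] e v by simp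
    have jy: "jet ?\<rho> 1 (\<lambda>z. ?y + e \<bullet> z) ?y e 0"
      by (rule jet_linear) (use ey e in auto)
    have "jet ?\<rho> (2 + \<bar>-1\<bar> * (10 * 1 * 1))
      (\<lambda>z. (norm (v + z))\<^sup>2 + (-1) * ((?y + e \<bullet> z) * (?y + e \<bullet> z)))
      (1 + (-1) * (?y * ?y)) (2 *\<^sub>R v + (-1) *\<^sub>R (?y *\<^sub>R e + ?y *\<^sub>R e))
      (real DIM('a) + (-1) * (?y * 0 + ?y * 0 + e \<bullet> e))"
      by (intro jet_add jet_cmult jet_mult jet_norm_square jy v \<rho>)
    moreover have "(norm (v + z))\<^sup>2 + (-1) * ((?y + e \<bullet> z) * (?y + e \<bullet> z)) = axis_dist2 e (v + z)" for z
      by (simp add: axis_dist2_def inner_add_right power2_eq_square)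
    moreover have T: "1 + (-1) * (?y * ?y) = axis_dist2 e v"
      using v by (simp add: axis_dist2_def power2_eq_square)
    moreover have "2 *\<^sub>R v + (-1) *\<^sub>R (?y *\<^sub>R e + ?y *\<^sub>R e) = 2 *\<^sub>R (v - ?y *\<^sub>R e)"
      by (simp only: scaleR_2 scaleR_minus1_left) (simp only: diff_conv_add_uminus minus_add_distrib add_ac)
    moreover have "real DIM('a) + (-1) * (?y * 0 + ?y * 0 + e \<bullet> e) = real DIM('a) - 1"
      using e by (simp add: dot_square_norm)
    ultimately have "jet ?\<rho> 12 (\<lambda>z. axis_dist2 e (v + z)) (axis_dist2 e v) (2 *\<^sub>R (v - ?y *\<^sub>R e)) (real DIM('a) - 1)"
      by simp
    moreover have c: "c0 \<le> axis_dist2 e v" using y v by (simp add: axis_dist2_def)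
    ultimately have J: "jet ?\<rho> D (\<lambda>z. axis_dist2 e (v + z) powr \<alpha>) (axis_dist2 e v powr \<alpha>)
       ((\<alpha> * axis_dist2 e v powr (\<alpha> - 1)) *\<^sub>R 2 *\<^sub>R (v - ?y *\<^sub>R e))
      (\<alpha> * axis_dist2 e v powr (\<alpha> - 1) * (real DIM('a) - 1)
       + \<alpha> * (\<alpha> - 1) / 2 * axis_dist2 e v powr (\<alpha> - 2) * (2 *\<^sub>R (v - ?y *\<^sub>R e) \<bullet> 2 *\<^sub>R (v - ?y *\<^sub>R e)))"
      using \<rho> by (rule D)
    have "(v - ?y *\<^sub>R e) \<bullet> (v - ?y *\<^sub>R e) = axis_dist2 e v"
      by (simp only: axis_dist2_eq[OF e] power2_norm_eq_inner)
    then have "2 *\<^sub>R (v - ?y *\<^sub>R e) \<bullet> 2 *\<^sub>R (v - ?y *\<^sub>R e) = 4 * axis_dist2 e v"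
      by simp
    moreover have "axis_dist2 e v powr (\<alpha> - 2) * axis_dist2 e v = axis_dist2 e v powr (\<alpha> - 1)"
      using c c0 powr_add[of "axis_dist2 e v" "\<alpha> - 2" 1] by simp
    moreover have "\<alpha> * P * (D' - 1) + \<alpha> * (\<alpha> - 1) / 2 * R * (4 * t) = \<alpha> * (D' - 3 + 2 * \<alpha>) * P"
      if "R * t = P" for P R t D' :: real
    proof -
      have "\<alpha> * (\<alpha> - 1) / 2 * R * (4 * t) = \<alpha> * (\<alpha> - 1) * 2 * (R * t)" by simp
      then show ?thesis unfolding that by (simp add: algebra_simps)
    qed
    ultimately have eq: "\<alpha> * axis_dist2 e v powr (\<alpha> - 1) * (real DIM('a) - 1)
       + \<alpha> * (\<alpha> - 1) / 2 * axis_dist2 e v powr (\<alpha> - 2) * (2 *\<^sub>R (v - ?y *\<^sub>R e) \<bullet> 2 *\<^sub>R (v - ?y *\<^sub>R e))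
       = \<alpha> * (real DIM('a) - 3 + 2 * \<alpha>) * axis_dist2 e v powr (\<alpha> - 1)"
      by (simp only:)
    have eq2: "(\<alpha> * axis_dist2 e v powr (\<alpha> - 1)) *\<^sub>R 2 *\<^sub>R (v - ?y *\<^sub>R e) =
      (2 * \<alpha> * axis_dist2 e v powr (\<alpha> - 1)) *\<^sub>R (v - (e \<bullet> v) *\<^sub>R e)"
      by (simp only: scaleR_scaleR mult_ac)
    show "jet (c0 / 72) D (\<lambda>z. axis_dist2 e (v + z) powr \<alpha>) (axis_dist2 e v powr \<alpha>)
      ((2 * \<alpha> * axis_dist2 e v powr (\<alpha> - 1)) *\<^sub>R (v - (e \<bullet> v) *\<^sub>R e))
      (\<alpha> * (real DIM('a) - 3 + 2 * \<alpha>) * axis_dist2 e v powr (\<alpha> - 1))"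
      using J unfolding eq eq2 .
  qed
qed

lemma jet_norm_square_powr:
  fixes \<alpha> :: real
  assumes c0: "0 < c0" "c0 \<le> 1"
  obtains D where "\<And>v::'a::euclidean_space. norm v = 1 \<Longrightarrow>
    jet (c0 / 72) D (\<lambda>z. (norm (v + z))\<^sup>2 powr \<alpha>) 1 ((2 * \<alpha>) *\<^sub>R v) (\<alpha> * (real DIM('a) - 2 + 2 * \<alpha>))"
proof -
  obtain D where D: "\<And>\<rho> (F :: 'a \<Rightarrow> real) c g \<tau>. jet \<rho> 2 F c g \<tau> \<Longrightarrow> c0 \<le> c \<Longrightarrow> \<rho> \<le> 1 \<Longrightarrow> 3 * 2 * \<rho> \<le> c0 / 2 \<Longrightarrow>
    jet \<rho> D (\<lambda>z. F z powr \<alpha>) (c powr \<alpha>) ((\<alpha> * c powr (\<alpha> - 1)) *\<^sub>R g)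
      (\<alpha> * c powr (\<alpha> - 1) * \<tau> + \<alpha> * (\<alpha> - 1) / 2 * c powr (\<alpha> - 2) * (g \<bullet> g))"
    by (rule jet_powr[of c0 2 \<alpha>, where 'a='a]) (use c0 in simp, use c0 in simp, erule that)
  show ?thesis
  proof (rule that)
    fix v :: 'a assume v: "norm v = 1"
    have J: "jet (c0 / 72) D (\<lambda>z. (norm (v + z))\<^sup>2 powr \<alpha>) (1 powr \<alpha>) ((\<alpha> * 1 powr (\<alpha> - 1)) *\<^sub>R (2 *\<^sub>R v))
      (\<alpha> * 1 powr (\<alpha> - 1) * real DIM('a) + \<alpha> * (\<alpha> - 1) / 2 * 1 powr (\<alpha> - 2) * (2 *\<^sub>R v \<bullet> 2 *\<^sub>R v))"
      by (rule D[OF jet_norm_square[OF v]]) (use c0 in auto)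
    have "v \<bullet> v = 1" using v by (simp add: dot_square_norm)
    then have eq: "\<alpha> * 1 powr (\<alpha> - 1) * real DIM('a) + \<alpha> * (\<alpha> - 1) / 2 * 1 powr (\<alpha> - 2) * (2 *\<^sub>R v \<bullet> 2 *\<^sub>R v)
      = \<alpha> * (real DIM('a) - 2 + 2 * \<alpha>)"
      by (simp add: field_simps)
    have eq2: "(\<alpha> * 1 powr (\<alpha> - 1)) *\<^sub>R (2 *\<^sub>R v) = (2 * \<alpha>) *\<^sub>R v" by simp
    show "jet (c0 / 72) D (\<lambda>z. (norm (v + z))\<^sup>2 powr \<alpha>) 1 ((2 * \<alpha>) *\<^sub>R v) (\<alpha> * (real DIM('a) - 2 + 2 * \<alpha>))"
      using J unfolding eq eq2 unfolding powr_one_eq_one .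
  qed
qed

text \<open>Uniformity is the point: one error constant \<open>D\<close> and one bound
  \<open>- \<eta>\<close> for half the Laplacian serve every unit vector away from the axis. After
  rescaling, the negative second order term then beats the cubic error beyond a fixed multiple of
  the step size.\<close>

lemma jet_lyap:
  fixes m e :: "'a::euclidean_space" and c0 \<eta> :: real
  assumes d: "DIM('a) \<ge> 2" and e: "norm e = 1" and m: "norm m \<le> 2" "m \<bullet> e = 0"
    and c0: "0 < c0" "c0 \<le> 1" and \<eta>: "0 < \<eta>" "\<eta> * DIM('a) \<le> 1"
  obtains D where "\<And>v. norm v = 1 \<Longrightarrow> (e \<bullet> v)\<^sup>2 \<le> 1 - c0 \<Longrightarrow>
    \<exists>g \<tau>. jet (c0 / 72) D (\<lambda>z. lyap m e \<eta> (v + z)) (lyap m e \<eta> v) g \<tau> \<and> \<tau> \<le> - \<eta>"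
proof -
  define d where "d = real DIM('a)"
  define p where "p = 1 + \<eta>"
  \<comment> \<open>The exponent of \<open>axis_dist2\<close> in the last summand of
    \<open>lyap\<close>: the squared norm to the power \<open>2 * d\<close> contributes degree
    \<open>4 * d\<close>, and \<open>4 * d + 2 * \<beta> = p\<close>.\<close>
  define \<beta> where "\<beta> = p / 2 - 2 * d"
  have d2: "d \<ge> 2" using d by (simp add: d_def)
  have \<eta>d: "\<eta> * d \<le> 1" using \<eta> by (simp add: d_def)
  have "\<eta> * 2 \<le> \<eta> * d" using d2 \<eta>(1) by (intro mult_left_mono) auto
  then have \<eta>1: "\<eta> \<le> 1 / 2" using \<eta>d by linarith
  obtain D1 where D1: "\<And>v. norm v = 1 \<Longrightarrow> (e \<bullet> v)\<^sup>2 \<le> 1 - c0 \<Longrightarrow>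
    jet (c0 / 72) D1 (\<lambda>z. axis_dist2 e (v + z) powr (\<eta> / 2)) (axis_dist2 e v powr (\<eta> / 2))
      ((2 * (\<eta> / 2) * axis_dist2 e v powr ((\<eta> / 2) - 1)) *\<^sub>R (v - (e \<bullet> v) *\<^sub>R e))
      ((\<eta> / 2) * (real DIM('a) - 3 + 2 * (\<eta> / 2)) * axis_dist2 e v powr ((\<eta> / 2) - 1))"
    by (rule jet_axis_dist2_powr[OF e c0, of "\<eta> / 2"]) (erule that)
  obtain D2 where D2: "\<And>v. norm v = 1 \<Longrightarrow> (e \<bullet> v)\<^sup>2 \<le> 1 - c0 \<Longrightarrow>
    jet (c0 / 72) D2 (\<lambda>z. axis_dist2 e (v + z) powr (p / 2)) (axis_dist2 e v powr (p / 2))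
      ((2 * (p / 2) * axis_dist2 e v powr ((p / 2) - 1)) *\<^sub>R (v - (e \<bullet> v) *\<^sub>R e))
      ((p / 2) * (real DIM('a) - 3 + 2 * (p / 2)) * axis_dist2 e v powr ((p / 2) - 1))"
    by (rule jet_axis_dist2_powr[OF e c0, of "p / 2"]) (erule that)
  obtain D3 where D3: "\<And>v. norm v = 1 \<Longrightarrow> (e \<bullet> v)\<^sup>2 \<le> 1 - c0 \<Longrightarrow>
    jet (c0 / 72) D3 (\<lambda>z. axis_dist2 e (v + z) powr \<beta>) (axis_dist2 e v powr \<beta>)
      ((2 * \<beta> * axis_dist2 e v powr (\<beta> - 1)) *\<^sub>R (v - (e \<bullet> v) *\<^sub>R e))
      (\<beta> * (real DIM('a) - 3 + 2 * \<beta>) * axis_dist2 e v powr (\<beta> - 1))"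
    by (rule jet_axis_dist2_powr[OF e c0, of \<beta>]) (erule that)
  obtain D4 where D4: "\<And>v::'a. norm v = 1 \<Longrightarrow>
    jet (c0 / 72) D4 (\<lambda>z. (norm (v + z))\<^sup>2 powr (2 * d)) 1 ((2 * (2 * d)) *\<^sub>R v) ((2 * d) * (real DIM('a) - 2 + 2 * (2 * d)))"
    by (rule jet_norm_square_powr[OF c0, of "2 * d", where 'a='a]) (erule that)
  show ?thesis
  proof (rule that)
    fix v assume v: "norm v = 1" and y: "(e \<bullet> v)\<^sup>2 \<le> 1 - c0"
    define t where "t = axis_dist2 e v"
    define w where "w = v - (e \<bullet> v) *\<^sub>R e"
    define x where "x = m \<bullet> v"
    define Q where "Q = t powr (p / 2 - 1)"
    have t: "c0 \<le> t" "t \<le> 1" using y v by (auto simp: t_def axis_dist2_def)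
    then have t0: "0 < t" using c0 by simp
    have tw: "t = (norm w)\<^sup>2" unfolding t_def w_def by (rule axis_dist2_eq[OF e])
    have xw: "x = m \<bullet> w" using m(2) by (simp add: x_def w_def inner_diff_right)
    have x2: "\<bar>x\<bar> \<le> 2" using Cauchy_Schwarz_ineq2[of m v] m v by (simp add: x_def)
    have "m \<bullet> w \<le> 2 * norm w"
      using Cauchy_Schwarz_ineq2[of m w] m(1) mult_right_mono[OF m(1), of "norm w"] by simp
    also have "norm w = t powr (1/2)" using t0 by (simp add: tw powr_half_sqrt)
    finally have xt: "x \<le> 2 * t powr (1/2)" by (simp add: xw)
    have vw: "v \<bullet> w = t"
      using v by (simp add: w_def t_def axis_dist2_def inner_diff_right dot_square_norm power2_eq_square inner_commute)
    have \<rho>1: "c0 / 72 \<le> 1" using c0 by simp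
    have jx: "jet (c0 / 72) 2 (\<lambda>z. x + m \<bullet> z) x m 0"
      by (rule jet_linear) (use x2 m in auto)
    have J: "jet (c0 / 72) (10 * 2 * D1 + \<bar>2 * \<eta>\<bar> * D2 + \<bar>- \<eta>\<bar> * (10 * D4 * D3))
      (\<lambda>z. (x + m \<bullet> z) * axis_dist2 e (v + z) powr (\<eta> / 2) + (2 * \<eta>) * axis_dist2 e (v + z) powr (p / 2)
        + (- \<eta>) * ((norm (v + z))\<^sup>2 powr (2 * d) * axis_dist2 e (v + z) powr \<beta>))
      (x * axis_dist2 e v powr (\<eta> / 2) + (2 * \<eta>) * axis_dist2 e v powr (p / 2) + (- \<eta>) * (1 * axis_dist2 e v powr \<beta>))
      (x *\<^sub>R ((2 * (\<eta> / 2) * axis_dist2 e v powr ((\<eta> / 2) - 1)) *\<^sub>R w) + axis_dist2 e v powr (\<eta> / 2) *\<^sub>R m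
        + (2 * \<eta>) *\<^sub>R ((2 * (p / 2) * axis_dist2 e v powr ((p / 2) - 1)) *\<^sub>R w)
        + (- \<eta>) *\<^sub>R (1 *\<^sub>R ((2 * \<beta> * axis_dist2 e v powr (\<beta> - 1)) *\<^sub>R w) + axis_dist2 e v powr \<beta> *\<^sub>R ((2 * (2 * d)) *\<^sub>R v)))
      (x * ((\<eta> / 2) * (real DIM('a) - 3 + 2 * (\<eta> / 2)) * axis_dist2 e v powr ((\<eta> / 2) - 1)) + axis_dist2 e v powr (\<eta> / 2) * 0
          + m \<bullet> ((2 * (\<eta> / 2) * axis_dist2 e v powr ((\<eta> / 2) - 1)) *\<^sub>R w)
        + (2 * \<eta>) * ((p / 2) * (real DIM('a) - 3 + 2 * (p / 2)) * axis_dist2 e v powr ((p / 2) - 1))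
        + (- \<eta>) * (1 * (\<beta> * (real DIM('a) - 3 + 2 * \<beta>) * axis_dist2 e v powr (\<beta> - 1))
          + axis_dist2 e v powr \<beta> * ((2 * d) * (real DIM('a) - 2 + 2 * (2 * d)))
          + ((2 * (2 * d)) *\<^sub>R v) \<bullet> ((2 * \<beta> * axis_dist2 e v powr (\<beta> - 1)) *\<^sub>R w)))"
      (is "jet _ ?C ?F ?c ?g ?\<tau>")
      unfolding w_def
      by (intro jet_add jet_cmult jet_mult jx D1[OF v y] D2[OF v y] D3[OF v y] D4[OF v] \<rho>1)
    have F: "?F = (\<lambda>z. lyap m e \<eta> (v + z))"
      by (simp add: fun_eq_iff lyap_def x_def p_def \<beta>_def d_def inner_add_right)
    have c: "?c = lyap m e \<eta> v"
      using v by (simp add: lyap_def x_def p_def \<beta>_def d_def)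
    have tt: "t powr (\<beta> - 1) * t = t powr \<beta>"
      using t0 powr_add[of t "\<beta> - 1" 1] by simp
    \<comment> \<open>The gradient term of the first summand is \<open>m \<bullet> w\<close>, which
      is \<open>x\<close> again because \<open>m \<bullet> e = 0\<close>. All terms are compared
      with the common size \<open>Q\<close>.\<close>
    have "?\<tau> = \<eta> / 2 * (d - 1 + \<eta>) * (x * t powr (\<eta> / 2 - 1)) + \<eta> * p * (d - 3 + p) * Q
      - \<eta> * (\<beta> * (d - 3 + 2 * \<beta>) * t powr (\<beta> - 1) + 2 * d * (5 * d - 2) * t powr \<beta> + 8 * d * \<beta> * (t powr (\<beta> - 1) * t))"
      by (simp add: t_def[symmetric] vw xw[symmetric] d_def[symmetric] Q_def field_simps)
    also have "\<dots> \<le> \<eta> * (d - 1 + \<eta>) * Q + \<eta> * p * (d - 3 + p) * Q - \<eta> * (2 * d * Q)"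
    proof -
      have "x * t powr (\<eta> / 2 - 1) \<le> 2 * t powr (1/2) * t powr (\<eta> / 2 - 1)"
        using xt by (intro mult_right_mono) auto
      also have "\<dots> = 2 * Q" unfolding Q_def p_def using t0
        by (simp add: powr_add[symmetric] field_simps)
      finally have 1: "\<eta> / 2 * (d - 1 + \<eta>) * (x * t powr (\<eta> / 2 - 1)) \<le> \<eta> / 2 * (d - 1 + \<eta>) * (2 * Q)"
        using \<eta> d2 by (intro mult_left_mono) auto
      have b: "\<beta> \<le> 0" "d - 3 + 2 * \<beta> \<le> 0" using \<eta>1 d2 by (auto simp: \<beta>_def p_def field_simps)
      have "t powr \<beta> \<le> t powr (\<beta> - 1)" using t t0 by (intro powr_mono') auto
      then have "\<beta> * (d - 3 + 2 * \<beta>) * t powr \<beta> \<le> \<beta> * (d - 3 + 2 * \<beta>) * t powr (\<beta> - 1)"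
        using b by (intro mult_left_mono mult_nonpos_nonpos) auto
      then have fA: "(\<beta> * (d - 3 + 2 * \<beta>) + 2 * d * (5 * d - 2) + 8 * d * \<beta>) * t powr \<beta>
        \<le> \<beta> * (d - 3 + 2 * \<beta>) * t powr (\<beta> - 1) + 2 * d * (5 * d - 2) * t powr \<beta> + 8 * d * \<beta> * (t powr (\<beta> - 1) * t)"
        unfolding tt by (simp add: algebra_simps)
      \<comment> \<open>With exponent \<open>2 * d\<close> on the squared norm the terms of order
        \<open>d\<^sup>2\<close> cancel and at least \<open>2 * d\<close> remains. The positive
        contributions of the other two summands of \<open>lyap\<close> add up to
        \<open>2 * d - 3\<close> plus terms that vanish with \<open>\<eta>\<close>, so the balance
        is negative.\<close>
      have fE: "\<beta> * (d - 3 + 2 * \<beta>) + 2 * d * (5 * d - 2) + 8 * d * \<beta> = 2 * d + p * (d - 3 + p) / 2"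
        by (simp add: \<beta>_def field_simps)
      have "p * (d - 3 + p) \<ge> 0" using \<eta> d2 by (intro mult_nonneg_nonneg) (auto simp: p_def)
      then have fB: "2 * d * t powr \<beta> \<le> (2 * d + p * (d - 3 + p) / 2) * t powr \<beta>"
        by (intro mult_right_mono) auto
      have "Q \<le> t powr \<beta>" unfolding Q_def using t t0 d2 by (intro powr_mono') (auto simp: \<beta>_def)
      then have fC: "2 * d * Q \<le> 2 * d * t powr \<beta>" using d2 by (intro mult_left_mono) auto
      have "2 * d * Q \<le> \<beta> * (d - 3 + 2 * \<beta>) * t powr (\<beta> - 1) + 2 * d * (5 * d - 2) * t powr \<beta> + 8 * d * \<beta> * (t powr (\<beta> - 1) * t)"
        by (rule order_trans[OF order_trans[OF fC fB] fA[unfolded fE]])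
      then have 2: "\<eta> * (2 * d * Q) \<le> \<eta> * (\<beta> * (d - 3 + 2 * \<beta>) * t powr (\<beta> - 1) + 2 * d * (5 * d - 2) * t powr \<beta> + 8 * d * \<beta> * (t powr (\<beta> - 1) * t))"
        using \<eta>(1) by (intro mult_left_mono) auto
      have 3: "\<eta> / 2 * (d - 1 + \<eta>) * (2 * Q) = \<eta> * (d - 1 + \<eta>) * Q" by simp
      show ?thesis using 1 2 3 by linarith
    qed
    also have "\<dots> = \<eta> * Q * (- 3 + \<eta> * d + \<eta> * \<eta>)"
      by (simp add: p_def algebra_simps)
    also have "\<dots> \<le> \<eta> * Q * (- 1)"
    proof (rule mult_left_mono)
      have "\<eta> * \<eta> \<le> 1 * 1" using \<eta>1 \<eta>(1) by (intro mult_mono) auto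
      then show "- 3 + \<eta> * d + \<eta> * \<eta> \<le> -1" using \<eta>d by linarith
    qed (use \<eta> in \<open>auto simp: Q_def\<close>)
    also have "\<dots> \<le> - \<eta>"
    proof -
      have "1 powr (p / 2 - 1) \<le> Q" unfolding Q_def using t t0 \<eta>1 by (intro powr_mono2') (auto simp: p_def)
      then show ?thesis using \<eta> mult_left_mono[of 1 Q \<eta>] by simp
    qed
    finally have "?\<tau> \<le> - \<eta>" .
    then show "\<exists>g \<tau>. jet (c0 / 72) ?C (\<lambda>z. lyap m e \<eta> (v + z)) (lyap m e \<eta> v) g \<tau> \<and> \<tau> \<le> - \<eta>"
      using J unfolding F c by blast
  qed
qed

text \<open>For \<open>\<epsilon> = 0\<close> this is the intersection of the half spaces with inner
  normals \<open>a\<close> and \<open>b\<close>. The slack \<open>\<epsilon>\<close> later absorbs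
  the curvature of the boundary, the replacement of a time by a dyadic one, and the approximation of
  the normals by countably many pairs.\<close>

definition wide_cone :: "'a::euclidean_space \<Rightarrow> 'a \<Rightarrow> real \<Rightarrow> 'a set" where
  "wide_cone a b \<epsilon> = {v. - \<epsilon> * norm v \<le> a \<bullet> v \<and> - \<epsilon> * norm v \<le> b \<bullet> v}"

lemma wide_cone_borel [measurable]: "wide_cone a b \<epsilon> \<in> sets borel"
  unfolding wide_cone_def by measurable

lemma wide_cone_scaleR:
  assumes "r > 0"
  shows "r *\<^sub>R v \<in> wide_cone a b \<epsilon> \<longleftrightarrow> v \<in> wide_cone a b \<epsilon>"
proof -
  have "- \<epsilon> * norm (r *\<^sub>R v) \<le> c \<bullet> (r *\<^sub>R v) \<longleftrightarrow> - \<epsilon> * norm v \<le> c \<bullet> v" for c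
  proof -
    have "- \<epsilon> * norm (r *\<^sub>R v) \<le> c \<bullet> (r *\<^sub>R v) \<longleftrightarrow> r * (- \<epsilon> * norm v) \<le> r * (c \<bullet> v)"
      using assms by (simp add: mult_ac)
    also have "\<dots> \<longleftrightarrow> - \<epsilon> * norm v \<le> c \<bullet> v"
      using assms by (rule mult_le_cancel_left_pos)
    finally show ?thesis .
  qed
  then show ?thesis by (simp only: wide_cone_def mem_Collect_eq)
qed

lemma wide_cone_perturb:
  assumes "norm a \<le> 1" "norm b \<le> 1" "v \<in> wide_cone a b (\<epsilon> / 2)" "norm v = 1" "0 < \<epsilon>" "\<epsilon> \<le> 1" "norm z \<le> \<epsilon> / 4"
  shows "v + z \<in> wide_cone a b \<epsilon>"
proof -
  have n: "norm (v + z) \<ge> 1 - norm z" using norm_triangle_ineq2[of v "-z"] assms by simp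
  have e: "\<epsilon> * norm z \<le> norm z" using assms by (simp add: mult_left_le_one_le)
  have "\<epsilon> * (1 - norm z) \<le> \<epsilon> * norm (v + z)" using n assms by (intro mult_left_mono) auto
  then have le: "- \<epsilon> * norm (v + z) \<le> - (\<epsilon> / 2) - norm z"
    using e assms by (simp add: right_diff_distrib)
  have "- norm z \<le> c \<bullet> z" if "norm c \<le> 1" for c
    using Cauchy_Schwarz_ineq2[of c z] that mult_right_mono[OF that, of "norm z"] by simp
  from this[OF assms(1)] this[OF assms(2)] show ?thesis
    using assms(3,4) le unfolding wide_cone_def by (auto simp: inner_add_right)
qed

text \<open>Take \<open>e\<close> along \<open>a - b\<close> and \<open>m = a + b\<close>; they are
  orthogonal because \<open>a\<close> and \<open>b\<close> have the same length. On the cone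
  \<open>m \<bullet> v\<close> is at least \<open>t * \<bar>e \<bullet> v\<bar>\<close> up to the
  slack, so it dominates away from the hyperplane \<open>e \<bullet> v = 0\<close>; near that
  hyperplane the terms with factor \<open>\<eta>\<close> make the function positive.\<close>

lemma lyap_bounds:
  fixes a b :: "'a::euclidean_space"
  assumes ab: "norm a = 1" "norm b = 1" "a \<noteq> b"
  obtains m e :: 'a and \<eta> c0 \<epsilon> c1 :: real where
    "norm e = 1" "norm m \<le> 2" "m \<bullet> e = 0" "0 < c0" "c0 \<le> 1" "0 < \<eta>" "\<eta> * DIM('a) \<le> 1"
    "0 < \<epsilon>" "\<epsilon> \<le> 1" "0 < c1"
    "\<And>v. norm v = 1 \<Longrightarrow> v \<in> wide_cone a b \<epsilon> \<Longrightarrow> (e \<bullet> v)\<^sup>2 \<le> 1 - c0"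
    "\<And>v. norm v = 1 \<Longrightarrow> v \<in> wide_cone a b \<epsilon> \<Longrightarrow> c1 \<le> lyap m e \<eta> v"
    "\<And>v. norm v = 1 \<Longrightarrow> v \<in> wide_cone a b \<epsilon> \<Longrightarrow> lyap m e \<eta> v \<le> 4"
proof -
  define d where "d = real DIM('a)"
  define t where "t = norm (a - b)"
  define e where "e = (a - b) /\<^sub>R t"
  define m where "m = a + b"
  \<comment> \<open>Chosen so that \<open>2 * c0 = (t / 4)\<^sup>2\<close>: a unit vector with
    \<open>\<bar>e \<bullet> v\<bar> > 1 - c0\<close> is within \<open>t / 4\<close> of
    \<open>e\<close> or \<open>- e\<close>. At these two points \<open>b\<close> respectively
    \<open>a\<close> has inner product \<open>- t / 2\<close>, so the cone avoids them.\<close>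
  define c0 where "c0 = t\<^sup>2 / 32"
  define k where "k = 2 * DIM('a)"
  \<comment> \<open>The first bound is what \<open>jet_lyap\<close> requires; the second keeps the
    negative summand below \<open>t / (24 * d)\<close> even where \<open>axis_dist2\<close> is as
    small as \<open>c0\<close>.\<close>
  define \<eta> where "\<eta> = min (1 / d) (t * c0 ^ k / (24 * d))"
  \<comment> \<open>The loss \<open>2 * \<epsilon>\<close> in \<open>m \<bullet> v\<close> is then
    half of the gain \<open>\<eta> * c0 / 2\<close> that is available near the hyperplane.\<close>
  define \<epsilon> where "\<epsilon> = \<eta> * c0 / 8"
  define c1 where "c1 = c0 * (\<eta> * c0 / 4)"
  have d: "d \<ge> 1" "d > 0" using DIM_positive[where 'a='a] by (auto simp: d_def Suc_le_eq)
  have t: "0 < t" "t \<le> 2" using ab norm_triangle_ineq4[of a b] by (auto simp: t_def)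
  have aa: "a \<bullet> a = 1" "b \<bullet> b = 1" using ab by (auto simp: dot_square_norm)
  have t2: "t\<^sup>2 = 2 - 2 * (a \<bullet> b)"
    unfolding t_def power2_norm_eq_inner by (simp add: inner_diff_left inner_diff_right aa inner_commute)
  have e: "norm e = 1" using t by (simp add: e_def t_def)
  have m: "norm m \<le> 2" using norm_triangle_ineq[of a b] ab by (simp add: m_def)
  have me: "m \<bullet> e = 0" by (simp add: m_def e_def inner_add_left inner_add_right inner_diff_left inner_diff_right aa inner_commute)
  have ae: "a \<bullet> e = t / 2"
  proof -
    have "a \<bullet> e = (1 - a \<bullet> b) / t" by (simp add: e_def inner_diff_right aa divide_inverse mult.commute)
    also have "\<dots> = t / 2" using t t2 by (simp add: field_simps power2_eq_square)
    finally show ?thesis .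
  qed
  have be: "b \<bullet> e = - t / 2"
  proof -
    have "b \<bullet> e = (a \<bullet> b - 1) / t" by (simp add: e_def inner_diff_right aa divide_inverse mult.commute inner_commute)
    also have "\<dots> = - t / 2" using t t2 by (simp add: field_simps power2_eq_square)
    finally show ?thesis .
  qed
  have "t\<^sup>2 \<le> 2 * t" using t by (simp add: power2_eq_square)
  then have c0: "0 < c0" "c0 \<le> 1 / 8" "c0 \<le> t / 16" using t by (auto simp: c0_def)
  have c0k: "0 < c0 ^ k" "c0 ^ k \<le> 1" using c0 by (auto intro: power_le_one)
  have \<eta>: "0 < \<eta>" "\<eta> \<le> 1 / d" "\<eta> \<le> t * c0 ^ k / (24 * d)"
    using d t c0k by (auto simp: \<eta>_def)
  have "1 / d \<le> 1" using d by simp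
  then have \<eta>1: "\<eta> \<le> 1" using \<eta>(2) by linarith
  have \<eta>d: "\<eta> * DIM('a) \<le> 1" using \<eta>(2) d by (simp add: field_simps d_def)
  have \<eta>c0: "\<eta> * c0 \<le> c0" "\<eta> * c0 \<le> \<eta> / 8" "0 < \<eta> * c0"
    using \<eta>1 \<eta>(1) c0 by (auto intro: mult_left_le_one_le)
  have \<eta>t: "\<eta> \<le> t / (24 * d)"
  proof -
    have "t * c0 ^ k / (24 * d) \<le> t * 1 / (24 * d)"
      using c0k t d by (intro divide_right_mono mult_left_mono) auto
    then show ?thesis using \<eta>(3) by simp
  qed
  have \<epsilon>: "0 < \<epsilon>" "\<epsilon> \<le> 1" "\<epsilon> < t / 4"
    using \<eta>c0 c0 t unfolding \<epsilon>_def by linarith+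
  have y: "\<bar>e \<bullet> v\<bar> \<le> 1 - c0" if v: "norm v = 1" "v \<in> wide_cone a b \<epsilon>" for v
  proof (rule ccontr)
    have vv: "v \<bullet> v = 1" and ee: "e \<bullet> e = 1" using v(1) e by (simp_all add: dot_square_norm)
    assume "\<not> \<bar>e \<bullet> v\<bar> \<le> 1 - c0"
    then consider "e \<bullet> v > 1 - c0" | "e \<bullet> v < - (1 - c0)" by linarith
    then show False
    proof cases
      case 1
      have "(norm (v - e))\<^sup>2 = 2 - 2 * (e \<bullet> v)"
        unfolding power2_norm_eq_inner
        by (simp add: inner_diff_left inner_diff_right inner_commute vv ee)
      also have "\<dots> < (t / 4)\<^sup>2" using 1 by (simp add: c0_def power_divide)
      finally have lt: "norm (v - e) < t / 4" by (rule power2_less_imp_less) (use t in simp)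
      have "b \<bullet> v = b \<bullet> e + b \<bullet> (v - e)" by (simp add: inner_diff_right)
      also have "\<dots> \<le> - t / 2 + norm (v - e)"
        using be norm_cauchy_schwarz[of b "v - e"] ab by simp
      finally show False using lt \<epsilon> v unfolding wide_cone_def by auto
    next
      case 2
      have "(norm (v + e))\<^sup>2 = 2 + 2 * (e \<bullet> v)"
        unfolding power2_norm_eq_inner
        by (simp add: inner_add_left inner_add_right inner_commute vv ee)
      also have "\<dots> < (t / 4)\<^sup>2" using 2 by (simp add: c0_def power_divide)
      finally have lt: "norm (v + e) < t / 4" by (rule power2_less_imp_less) (use t in simp)
      have "a \<bullet> v = - (a \<bullet> e) + a \<bullet> (v + e)" by (simp add: inner_add_right)
      also have "\<dots> \<le> - t / 2 + norm (v + e)"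
        using ae norm_cauchy_schwarz[of a "v + e"] ab by simp
      finally show False using lt \<epsilon> v unfolding wide_cone_def by auto
    qed
  qed
  have y2: "(e \<bullet> v)\<^sup>2 \<le> 1 - c0" if v: "norm v = 1" "v \<in> wide_cone a b \<epsilon>" for v
  proof -
    have "(e \<bullet> v)\<^sup>2 = \<bar>e \<bullet> v\<bar> * \<bar>e \<bullet> v\<bar>" by (simp add: power2_eq_square)
    also have "\<dots> \<le> (1 - c0) * 1" using y[OF v] c0 by (intro mult_mono) auto
    finally show ?thesis by simp
  qed
  have x: "m \<bullet> v \<ge> t * \<bar>e \<bullet> v\<bar> - 2 * \<epsilon>" if v: "norm v = 1" "v \<in> wide_cone a b \<epsilon>" for v
  proof -
    have "t *\<^sub>R e = a - b" using t by (simp add: e_def)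
    then have "t * (e \<bullet> v) = a \<bullet> v - b \<bullet> v" by (metis inner_diff_left inner_scaleR_left)
    moreover have "m \<bullet> v = a \<bullet> v + b \<bullet> v" by (simp add: m_def inner_add_left)
    moreover have "t * \<bar>e \<bullet> v\<bar> = \<bar>t * (e \<bullet> v)\<bar>" using t by (simp add: abs_mult)
    ultimately show ?thesis using v unfolding wide_cone_def by auto
  qed
  have rep: "lyap m e \<eta> v = T powr (\<eta> / 2) * (m \<bullet> v + 2 * \<eta> * T powr (1/2) - \<eta> * (T powr (1/2) * inverse (T ^ k)))"
    if v: "norm v = 1" and T: "T = axis_dist2 e v" "T > 0" for v T
  proof -
    have p1: "T powr ((1 + \<eta>) / 2) = T powr (\<eta> / 2) * T powr (1/2)"
      unfolding powr_add[symmetric] by (rule arg_cong[where f="\<lambda>a. T powr a"]) (simp add: field_simps)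
    have p2: "T powr ((1 + \<eta>) / 2 - 2 * DIM('a)) = T powr (\<eta> / 2) * (T powr (1/2) * inverse (T ^ k))"
    proof -
      have "T powr real (2 * DIM('a)) = T ^ k" using T(2) unfolding k_def by (rule powr_realpow)
      then show ?thesis unfolding powr_diff p1 by (simp only: divide_inverse mult.assoc)
    qed
    show ?thesis
      unfolding lyap_def T(1)[symmetric] p1 p2 using v by (simp add: algebra_simps)
  qed
  have T01: "c0 \<le> T" "T \<le> 1" "T > 0" "c0 \<le> T powr (\<eta> / 2)" "T powr (\<eta> / 2) \<le> 1" "c0 \<le> T powr (1/2)" "T powr (1/2) \<le> 1"
    if v: "norm v = 1" "v \<in> wide_cone a b \<epsilon>" and T: "T = axis_dist2 e v" for v T
  proof -
    show 1: "c0 \<le> T" "T \<le> 1" "T > 0" using y2[OF v] v(1) c0 by (auto simp: T axis_dist2_def)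
    have "T powr 1 \<le> T powr (\<eta> / 2)" "T powr 1 \<le> T powr (1/2)" by (rule powr_mono'; use 1 \<eta>1 in simp)+
    then show "c0 \<le> T powr (\<eta> / 2)" "c0 \<le> T powr (1/2)" using 1 by auto
    show "T powr (\<eta> / 2) \<le> 1" "T powr (1/2) \<le> 1" using 1 \<eta>(1) by (auto intro!: powr_le1)
  qed
  have up: "lyap m e \<eta> v \<le> 4" if v: "norm v = 1" "v \<in> wide_cone a b \<epsilon>" for v
  proof -
    define T where "T = axis_dist2 e v"
    note TT = T01[OF v T_def]
    have "m \<bullet> v \<le> 2" using norm_cauchy_schwarz[of m v] m v(1) by simp
    moreover have "\<eta> * T powr (1/2) \<le> 1 * 1" using TT \<eta>1 \<eta>(1) by (intro mult_mono) auto
    moreover have "0 \<le> \<eta> * (T powr (1/2) * inverse (T ^ k))" using TT \<eta>(1) by simp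
    ultimately have "m \<bullet> v + 2 * \<eta> * T powr (1/2) - \<eta> * (T powr (1/2) * inverse (T ^ k)) \<le> 4" by linarith
    then have "T powr (\<eta> / 2) * (m \<bullet> v + 2 * \<eta> * T powr (1/2) - \<eta> * (T powr (1/2) * inverse (T ^ k))) \<le> T powr (\<eta> / 2) * 4"
      by (intro mult_left_mono) auto
    also have "\<dots> \<le> 4" using TT by simp
    finally show ?thesis unfolding rep[OF v(1) T_def TT(3)] .
  qed
  have lo: "c1 \<le> lyap m e \<eta> v" if v: "norm v = 1" "v \<in> wide_cone a b \<epsilon>" for v
  proof -
    define T where "T = axis_dist2 e v"
    note TT = T01[OF v T_def]
    \<comment> \<open>If \<open>T ^ k \<ge> 2 / 3\<close>, the terms with factor
      \<open>\<eta>\<close> sum to at least \<open>\<eta> * T powr (1/2) / 2\<close>. Otherwise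
      Bernoulli's inequality forces \<open>\<bar>e \<bullet> v\<bar> \<ge> 1 / (6 * d)\<close>, and
      \<open>m \<bullet> v\<close> alone outweighs what is negative.\<close>
    have "\<eta> * c0 / 4 \<le> m \<bullet> v + 2 * \<eta> * T powr (1/2) - \<eta> * (T powr (1/2) * inverse (T ^ k))"
    proof (cases "T ^ k \<ge> 2 / 3")
      case True
      have "inverse (T ^ k) \<le> inverse (2 / 3)" using True by (intro le_imp_inverse_le) auto
      then have "\<eta> * (T powr (1/2) * inverse (T ^ k)) \<le> \<eta> * (T powr (1/2) * (3 / 2))"
        using \<eta> by (intro mult_left_mono) auto
      moreover have "\<eta> * c0 \<le> \<eta> * T powr (1/2)" using TT \<eta> by (intro mult_left_mono) auto
      moreover have "0 \<le> t * \<bar>e \<bullet> v\<bar>" using t by simp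
      then have "m \<bullet> v \<ge> - (\<eta> * c0 / 4)" using x[OF v] unfolding \<epsilon>_def by linarith
      ultimately show ?thesis by linarith
    next
      case False
      have "1 + real k * (T - 1) \<le> T ^ k" using Bernoulli_inequality[of "T - 1" k] TT by simp
      then have "real k * (1 - T) \<ge> 1 / 3" using False by (simp add: algebra_simps)
      then have "d * (1 - T) \<ge> 1 / 6" by (simp add: k_def d_def)
      then have "1 - T \<ge> 1 / (6 * d)" using d by (simp add: field_simps)
      moreover have "1 - T = \<bar>e \<bullet> v\<bar> * \<bar>e \<bullet> v\<bar>" using v(1) by (simp add: T_def axis_dist2_def power2_eq_square)
      moreover have "\<bar>e \<bullet> v\<bar> * \<bar>e \<bullet> v\<bar> \<le> \<bar>e \<bullet> v\<bar> * 1" using y[OF v] c0 by (intro mult_left_mono) auto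
      ultimately have "1 / (6 * d) \<le> \<bar>e \<bullet> v\<bar>" by linarith
      then have "t * (1 / (6 * d)) \<le> t * \<bar>e \<bullet> v\<bar>" using t by (intro mult_left_mono) auto
      then have mv: "m \<bullet> v \<ge> t / (6 * d) - 2 * \<epsilon>" using x[OF v] by simp
      have "inverse (T ^ k) \<le> inverse (c0 ^ k)"
        using TT c0 by (intro le_imp_inverse_le power_mono) auto
      then have "T powr (1/2) * inverse (T ^ k) \<le> 1 * inverse (c0 ^ k)"
        using TT c0 by (intro mult_mono) auto
      then have "\<eta> * (T powr (1/2) * inverse (T ^ k)) \<le> (t * c0 ^ k / (24 * d)) * inverse (c0 ^ k)"
        using \<eta> c0 t d TT(3) by (intro mult_mono) auto
      also have "\<dots> = t / (24 * d) * (c0 ^ k * inverse (c0 ^ k))" by (simp only: divide_inverse mult_ac)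
      also have "c0 ^ k * inverse (c0 ^ k) = 1" by (rule right_inverse) (use c0k in linarith)
      also have "t / (24 * d) * 1 = t / (24 * d)" by (rule mult_1_right)
      finally have 1: "\<eta> * (T powr (1/2) * inverse (T ^ k)) \<le> t / (24 * d)" .
      have 2: "0 \<le> 2 * \<eta> * T powr (1/2)" using \<eta> by simp
      have 3: "t / (6 * d) = 4 * (t / (24 * d))" by simp
      have 4: "0 < t / (24 * d)" using t d by simp
      show ?thesis using mv 1 2 3 4 \<eta>t \<eta>c0 \<epsilon>_def by linarith
    qed
    then have "c0 * (\<eta> * c0 / 4) \<le> T powr (\<eta> / 2) * (m \<bullet> v + 2 * \<eta> * T powr (1/2) - \<eta> * (T powr (1/2) * inverse (T ^ k)))"
      using TT \<eta>c0 by (intro mult_mono) auto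
    then show ?thesis unfolding rep[OF v(1) T_def TT(3)] c1_def .
  qed
  show ?thesis
    by (rule that[OF e m me c0(1) _ \<eta>(1) \<eta>d \<epsilon>(1,2) _ y2 lo up]) (use c0 \<eta>c0 in \<open>auto simp: c1_def\<close>)
qed

text \<open>The expansion of \<open>h\<close> is extended to all increments \<open>z\<close> as an upper bound for \<open>h\<close> cut off to the cone:
  small \<open>z\<close> stay in a wider cone where \<open>h\<close> is still positive, and for large \<open>z\<close> the cubic error
  dominates. By homogeneity the negative Laplacian then beats the error far from the apex.\<close>

lemma lyapunov_function:
  fixes a b :: "'a::euclidean_space"
  assumes dim: "DIM('a) \<ge> 2" and ab: "norm a = 1" "norm b = 1" "a \<noteq> b"
  obtains \<epsilon> p c1 C1 R0 :: real and h :: "'a \<Rightarrow> real" where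
    "0 < \<epsilon>" "\<epsilon> \<le> 1" "4 / \<epsilon> \<le> R0" "1 < p" "p \<le> 3 / 2" "0 < c1" "0 < C1" "0 < R0" "h \<in> borel_measurable borel"
    "\<And>v. v \<in> wide_cone a b \<epsilon> \<Longrightarrow> v \<noteq> 0 \<Longrightarrow> c1 * norm v powr p \<le> h v"
    "\<And>v. v \<in> wide_cone a b \<epsilon> \<Longrightarrow> v \<noteq> 0 \<Longrightarrow> h v \<le> C1 * norm v powr p"
    "\<And>\<sigma> v. 0 < \<sigma> \<Longrightarrow> v \<in> wide_cone a b \<epsilon> \<Longrightarrow> R0 * \<sigma> \<le> norm v \<Longrightarrow>
      (\<integral>\<^sup>+z. ennreal (h (v + z)) * indicator (wide_cone a b \<epsilon> - {0}) (v + z) \<partial>gauss \<sigma>) \<le> ennreal (h v)"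
proof -
  obtain m e :: 'a and \<eta> c0 \<epsilon>0 c1 :: real where
    e: "norm e = 1" and m: "norm m \<le> 2" "m \<bullet> e = 0" and c0: "0 < c0" "c0 \<le> 1" and \<eta>: "0 < \<eta>" "\<eta> * DIM('a) \<le> 1"
    and \<epsilon>0: "0 < \<epsilon>0" "\<epsilon>0 \<le> 1" and c1: "0 < c1"
    and y2: "\<And>v. norm v = 1 \<Longrightarrow> v \<in> wide_cone a b \<epsilon>0 \<Longrightarrow> (e \<bullet> v)\<^sup>2 \<le> 1 - c0"
    and lo: "\<And>v. norm v = 1 \<Longrightarrow> v \<in> wide_cone a b \<epsilon>0 \<Longrightarrow> c1 \<le> lyap m e \<eta> v"
    and up: "\<And>v. norm v = 1 \<Longrightarrow> v \<in> wide_cone a b \<epsilon>0 \<Longrightarrow> lyap m e \<eta> v \<le> 4"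
    by (rule lyap_bounds[OF ab]) blast
  define h where "h = lyap m e \<eta>"
  define p where "p = 1 + \<eta>"
  define \<epsilon> where "\<epsilon> = \<epsilon>0 / 2"
  let ?K = "wide_cone a b \<epsilon>"
  have K0: "v \<in> wide_cone a b \<epsilon>0" if "v \<in> ?K" for v
  proof -
    have "- \<epsilon>0 * norm v \<le> - \<epsilon> * norm v" using \<epsilon>0 by (intro mult_right_mono) (auto simp: \<epsilon>_def)
    then show ?thesis using that unfolding wide_cone_def by auto
  qed
  obtain D where D: "\<And>v. norm v = 1 \<Longrightarrow> (e \<bullet> v)\<^sup>2 \<le> 1 - c0 \<Longrightarrow>
    \<exists>g \<tau>. jet (c0 / 72) D (\<lambda>z. lyap m e \<eta> (v + z)) (lyap m e \<eta> v) g \<tau> \<and> \<tau> \<le> - \<eta>"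
    by (rule jet_lyap[OF dim e m c0 \<eta>]) (erule that)
  have p: "1 < p" "p \<le> 3 / 2"
  proof -
    have "\<eta> * 2 \<le> \<eta> * DIM('a)" using dim \<eta>(1) by (intro mult_left_mono) auto
    then show "p \<le> 3 / 2" using \<eta>(2) by (simp add: p_def)
  qed (use \<eta> in \<open>simp add: p_def\<close>)
  have hom: "h (r *\<^sub>R v) = r powr p * h v" if "r > 0" for r v
    unfolding h_def p_def using lyap_scale[OF e that \<eta>(1)] .
  have bounds: "c1 * norm v powr p \<le> h v" "h v \<le> 4 * norm v powr p" if v: "v \<in> wide_cone a b \<epsilon>0" "v \<noteq> 0" for v
  proof -
    define u where "u = v /\<^sub>R norm v"
    have vu: "v = norm v *\<^sub>R u" and u1: "norm u = 1" using v by (auto simp: u_def)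
    have "u \<in> wide_cone a b \<epsilon>0" using wide_cone_scaleR[of "norm v" u] v vu by simp
    then have "c1 \<le> h u" "h u \<le> 4" using lo[of u] up[of u] u1 by (auto simp: h_def)
    moreover have "h v = norm v powr p * h u" using hom[of "norm v" u] v vu by simp
    ultimately show "c1 * norm v powr p \<le> h v" "h v \<le> 4 * norm v powr p"
      by (simp_all add: mult.commute[of "norm v powr p"] mult_right_mono)
  qed
  define \<rho> where "\<rho> = min (c0 / 72) (\<epsilon>0 / 4)"
  have \<rho>: "0 < \<rho>" "\<rho> \<le> c0 / 72" "\<rho> \<le> \<epsilon>0 / 4" "\<rho> \<le> 1" using c0 \<epsilon>0 by (auto simp: \<rho>_def)
  \<comment> \<open>The four added terms bound, for \<open>norm z > \<rho>\<close> and relative to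
    \<open>norm z ^ 3\<close>, the growth of \<open>h\<close> and the constant, linear and quadratic
    part of the expansion, in this order.\<close>
  define C where "C = D + (4 * (1 / \<rho> + 1)\<^sup>2 / \<rho> + \<bar>D\<bar> / \<rho> ^ 3 + \<bar>D\<bar> / \<rho> ^ 2 + \<bar>D\<bar> / \<rho>)"
  have unit: "\<exists>g \<tau> q. \<tau> \<le> - \<eta> \<and> (\<forall>a z. q (a *\<^sub>R z) = a\<^sup>2 * q z) \<and>
      (\<forall>\<sigma>>0. has_bochner_integral (gauss \<sigma>) q (\<sigma>\<^sup>2 * \<tau>)) \<and>
      (\<forall>z. h (v + z) * indicator (?K - {0}) (v + z) \<le> h v + g \<bullet> z + q z + C * norm z ^ 3)"
    if v: "norm v = 1" "v \<in> ?K" for v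
  proof -
    obtain g \<tau> where J: "jet (c0 / 72) D (\<lambda>z. h (v + z)) (h v) g \<tau>" and \<tau>: "\<tau> \<le> - \<eta>"
      using D[OF v(1) y2[OF v(1) K0[OF v(2)]]] unfolding h_def by blast
    obtain q where q: "\<bar>h v\<bar> \<le> D" "norm g \<le> D" "\<And>z. \<bar>q z\<bar> \<le> D * (norm z)\<^sup>2"
      "\<And>a z. q (a *\<^sub>R z) = a\<^sup>2 * q z"
      "\<And>\<sigma>. \<sigma> > 0 \<Longrightarrow> has_bochner_integral (gauss \<sigma>) q (\<sigma>\<^sup>2 * \<tau>)"
      "\<And>z. norm z \<le> c0 / 72 \<Longrightarrow> \<bar>h (v + z) - (h v + g \<bullet> z + q z)\<bar> \<le> D * norm z ^ 3"
      using J by (rule jetE) blast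
    have D0: "0 \<le> D" using q(1) by simp
    have "h (v + z) * indicator (?K - {0}) (v + z) \<le> h v + g \<bullet> z + q z + C * norm z ^ 3" for z
    proof (cases "norm z \<le> \<rho>")
      case True
      have "0 \<le> (4 * (1 / \<rho> + 1)\<^sup>2 / \<rho> + \<bar>D\<bar> / \<rho> ^ 3 + \<bar>D\<bar> / \<rho> ^ 2 + \<bar>D\<bar> / \<rho>)" using \<rho> by simp
      then have "D * norm z ^ 3 \<le> C * norm z ^ 3" by (intro mult_right_mono) (auto simp: C_def)
      then have 1: "h (v + z) \<le> h v + g \<bullet> z + q z + C * norm z ^ 3"
        using q(6)[of z] True \<rho> by simp
      have nz: "v + z \<noteq> 0"
      proof
        assume "v + z = 0"
        then have "norm z = 1" using v(1) by (metis add_eq_0_iff norm_minus_cancel)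
        then show False using True \<rho> c0 by simp
      qed
      have "v + z \<in> wide_cone a b \<epsilon>0"
        by (rule wide_cone_perturb) (use ab v \<epsilon>0 True \<rho> in \<open>auto simp: \<epsilon>_def\<close>)
      then have "0 \<le> h (v + z)" using bounds(1)[OF _ nz] c1 by (meson less_imp_le mult_nonneg_nonneg order_trans powr_ge_zero)
      then show ?thesis using 1 by (auto simp: indicator_def)
    next
      case False
      define n where "n = norm z"
      have n: "n > 0" "n > \<rho>" using False \<rho> by (auto simp: n_def)
      have nr: "1 \<le> n / \<rho>" using n \<rho> by simp
      have p3: "1 \<le> (n / \<rho>) ^ 3" "n / \<rho> \<le> (n / \<rho>) ^ 3" "(n / \<rho>) ^ 2 \<le> (n / \<rho>) ^ 3"
        using power_increasing[of 0 3 "n / \<rho>"] power_increasing[of 1 3 "n / \<rho>"] power_increasing[of 2 3 "n / \<rho>"] nr by auto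
      have b1: "h (v + z) * indicator (?K - {0}) (v + z) \<le> 4 * (1 + n)\<^sup>2"
      proof (cases "v + z \<in> ?K - {0}")
        case True
        then have "h (v + z) \<le> 4 * norm (v + z) powr p" using bounds(2)[of "v + z"] K0 by auto
        also have "norm (v + z) powr p \<le> (1 + n) powr p"
          using norm_triangle_ineq[of v z] v(1) p by (intro powr_mono2) (auto simp: n_def)
        also have "\<dots> \<le> (1 + n) powr 2" using n p by (intro powr_mono) auto
        also have "\<dots> = (1 + n)\<^sup>2" using n by simp
        finally show ?thesis using True by simp
      qed simp
      have "1 + n = n * (1 / n + 1)" using n by (simp add: field_simps)
      also have "\<dots> \<le> n * (1 / \<rho> + 1)" using n \<rho> by (intro mult_left_mono add_right_mono divide_left_mono) auto
      finally have "(1 + n)\<^sup>2 \<le> (n * (1 / \<rho> + 1))\<^sup>2" using n by (intro power_mono) auto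
      also have "\<dots> = (1 / \<rho> + 1)\<^sup>2 * n\<^sup>2 * 1" by (simp add: power_mult_distrib)
      also have "\<dots> \<le> (1 / \<rho> + 1)\<^sup>2 * n\<^sup>2 * (n / \<rho>)" using nr by (intro mult_left_mono) auto
      also have "\<dots> = (1 / \<rho> + 1)\<^sup>2 / \<rho> * n ^ 3" by (simp add: power2_eq_square power3_eq_cube)
      finally have b2: "4 * (1 + n)\<^sup>2 \<le> 4 * (1 / \<rho> + 1)\<^sup>2 / \<rho> * n ^ 3" by simp
      have t1: "- h v \<le> D / \<rho> ^ 3 * n ^ 3"
      proof -
        have "- h v \<le> D * 1" using q(1) by simp
        also have "\<dots> \<le> D * (n / \<rho>) ^ 3" using D0 p3 by (intro mult_left_mono) auto
        finally show ?thesis by (simp add: power_divide)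
      qed
      have t2: "- (g \<bullet> z) \<le> D / \<rho> ^ 2 * n ^ 3"
      proof -
        have "- (g \<bullet> z) \<le> norm g * n" using Cauchy_Schwarz_ineq2[of g z] by (simp add: n_def)
        also have "\<dots> \<le> D * n * 1" using q(2) n by (simp add: mult_right_mono)
        also have "\<dots> \<le> D * n * (n / \<rho>) ^ 2" using D0 n nr by (intro mult_left_mono) (auto intro: one_le_power)
        also have "\<dots> = D / \<rho> ^ 2 * n ^ 3" by (simp add: power2_eq_square power3_eq_cube)
        finally show ?thesis .
      qed
      have t3: "- q z \<le> D / \<rho> * n ^ 3"
      proof -
        have "- q z \<le> D * n ^ 2 * 1" using q(3)[of z] by (simp add: n_def)
        also have "\<dots> \<le> D * n ^ 2 * (n / \<rho>)" using D0 n nr by (intro mult_left_mono) auto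
        also have "\<dots> = D / \<rho> * n ^ 3" by (simp add: power2_eq_square power3_eq_cube)
        finally show ?thesis .
      qed
      have "C * n ^ 3 = D * n ^ 3 + (4 * (1 / \<rho> + 1)\<^sup>2 / \<rho> * n ^ 3 + D / \<rho> ^ 3 * n ^ 3 + D / \<rho> ^ 2 * n ^ 3 + D / \<rho> * n ^ 3)"
        unfolding C_def using D0 by (simp only: distrib_right abs_of_nonneg)
      moreover have "0 \<le> D * n ^ 3" using D0 n by simp
      ultimately show ?thesis using b1 b2 t1 t2 t3 unfolding n_def[symmetric] by linarith
    qed
    then show ?thesis using \<tau> q(4,5) by blast
  qed
  obtain C4 where C4: "C4 > 0" "\<And>\<sigma>. \<sigma> > 0 \<Longrightarrow>
     integrable (gauss \<sigma>) (\<lambda>z::'a. norm z ^ (2*2)) \<and>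
     (\<integral>z. norm z ^ (2*2) \<partial>(gauss \<sigma> :: 'a measure)) \<le> C4 * \<sigma> ^ (2*2)"
    by (rule gauss_norm_moment[where k=2 and 'a='a]) (rule that, assumption, blast)
  define C3 where "C3 = 1 + C4"
  have cube: "integrable (gauss \<sigma>) (\<lambda>z::'a. norm z ^ 3)"
    "(\<integral>z. norm z ^ 3 \<partial>(gauss \<sigma> :: 'a measure)) \<le> C3 * \<sigma> ^ 3" if \<sigma>: "\<sigma> > 0" for \<sigma>
  proof -
    interpret prob_space "gauss \<sigma> :: 'a measure" by (rule prob_space_gauss[OF \<sigma>])
    \<comment> \<open>The moment bounds at hand are for even exponents; splitting at
      \<open>norm z = \<sigma>\<close> reduces the third moment to the fourth.\<close>
    have le: "norm z ^ 3 \<le> \<sigma> ^ 3 + norm z ^ (2*2) / \<sigma>" for z :: 'a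
    proof (cases "norm z \<le> \<sigma>")
      case True
      then have "norm z ^ 3 \<le> \<sigma> ^ 3" by (intro power_mono) auto
      then show ?thesis using \<sigma> by (simp add: add_increasing2)
    next
      case False
      then have "norm z ^ 3 * \<sigma> \<le> norm z ^ 3 * norm z" by (intro mult_left_mono) auto
      then have "norm z ^ 3 \<le> norm z ^ (2*2) / \<sigma>" using \<sigma> by (simp add: field_simps power4_eq_xxxx power3_eq_cube)
      then show ?thesis using \<sigma> by (simp add: add_increasing)
    qed
    have i4: "integrable (gauss \<sigma>) (\<lambda>z::'a. norm z ^ (2*2))" using C4(2)[OF \<sigma>] by blast
    then have i: "integrable (gauss \<sigma>) (\<lambda>z::'a. \<sigma> ^ 3 + norm z ^ (2*2) / \<sigma>)" by simp
    show i3: "integrable (gauss \<sigma>) (\<lambda>z::'a. norm z ^ 3)"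
      using le \<sigma> by (intro Bochner_Integration.integrable_bound[OF i] AE_I2) auto
    have "(\<integral>z. norm z ^ 3 \<partial>(gauss \<sigma> :: 'a measure)) \<le> (\<integral>z. \<sigma> ^ 3 + norm z ^ (2*2) / \<sigma> \<partial>(gauss \<sigma> :: 'a measure))"
      by (rule integral_mono[OF i3 i le])
    also have "\<dots> = \<sigma> ^ 3 + (\<integral>z. norm z ^ (2*2) \<partial>(gauss \<sigma> :: 'a measure)) / \<sigma>"
      using i4 prob_space by (subst Bochner_Integration.integral_add) auto
    also have "\<dots> \<le> \<sigma> ^ 3 + (C4 * \<sigma> ^ (2*2)) / \<sigma>"
      using C4(2)[OF \<sigma>] \<sigma> by (intro add_left_mono divide_right_mono) auto
    also have "\<dots> = C3 * \<sigma> ^ 3" using \<sigma> by (simp add: C3_def power4_eq_xxxx power3_eq_cube field_simps)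
    finally show "(\<integral>z. norm z ^ 3 \<partial>(gauss \<sigma> :: 'a measure)) \<le> C3 * \<sigma> ^ 3" .
  qed
  \<comment> \<open>The first term makes the cubic error smaller than the gain from the Laplacian at
    distance \<open>R0 * \<sigma>\<close>; the second is needed when the starting point of the walk
    is moved, in \<open>wide_cone_perturb_far\<close>.\<close>
  define R0 where "R0 = \<bar>C\<bar> * C3 / \<eta> + 4 / \<epsilon>"
  have \<epsilon>: "0 < \<epsilon>" "\<epsilon> \<le> 1" using \<epsilon>0 by (auto simp: \<epsilon>_def)
  have "0 \<le> \<bar>C\<bar> * C3 / \<eta>" using C4(1) \<eta>(1) unfolding C3_def by (intro divide_nonneg_pos mult_nonneg_nonneg) auto
  moreover have "0 < 4 / \<epsilon>" using \<epsilon> by simp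
  ultimately have R0: "4 / \<epsilon> \<le> R0" "0 < R0" unfolding R0_def by linarith+
  show ?thesis
  proof (rule that)
    show "0 < \<epsilon>" "\<epsilon> \<le> 1" "4 / \<epsilon> \<le> R0" using \<epsilon> R0 by auto
    show "1 < p" "p \<le> 3/2" "0 < c1" "0 < (4::real)" "0 < R0" using p c1 R0 by auto
    show "h \<in> borel_measurable borel" by (simp add: h_def)
    show "c1 * norm v powr p \<le> h v" "h v \<le> 4 * norm v powr p" if "v \<in> ?K" "v \<noteq> 0" for v
      using bounds[OF K0[OF that(1)] that(2)] by auto
    fix \<sigma> :: real and v assume \<sigma>: "0 < \<sigma>" and v: "v \<in> ?K" "R0 * \<sigma> \<le> norm v"
    define r where "r = norm v"
    have r: "r > 0" "R0 * \<sigma> \<le> r" using v R0(2) \<sigma> unfolding r_def by (smt (verit) mult_pos_pos)+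
    define u where "u = v /\<^sub>R r"
    have u: "norm u = 1" "v = r *\<^sub>R u" using r by (auto simp: u_def r_def)
    have uK: "u \<in> ?K" using v(1) wide_cone_scaleR[OF r(1), of u] u(2) by simp
    obtain g \<tau> q where \<tau>: "\<tau> \<le> - \<eta>" and q: "\<And>a z. q (a *\<^sub>R z) = a\<^sup>2 * q z"
      "\<And>\<sigma>. \<sigma>>0 \<Longrightarrow> has_bochner_integral (gauss \<sigma>) q (\<sigma>\<^sup>2 * \<tau>)"
      "\<And>z. h (u + z) * indicator (?K - {0}) (u + z) \<le> h u + g \<bullet> z + q z + C * norm z ^ 3"
      using unit[OF u(1) uK] by blast
    \<comment> \<open>The expansion on the unit sphere, rescaled by \<open>r\<close>. The mean of
      its quadratic part is of order \<open>(\<sigma> / r)\<^sup>2\<close> and that of the error of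
      order \<open>(\<sigma> / r) ^ 3\<close>, so a large ratio \<open>r / \<sigma>\<close> decides
      in favour of the former.\<close>
    define f where "f = (\<lambda>z. h u + (1 / r) * (g \<bullet> z) + (1 / r)\<^sup>2 * q z + (C / r ^ 3) * norm z ^ 3)"
    have pt: "h (v + z) * indicator (?K - {0}) (v + z) \<le> r powr p * f z" for z
    proof -
      define w where "w = u + (1 / r) *\<^sub>R z"
      have vz: "v + z = r *\<^sub>R w" using r u(2) by (simp add: w_def scaleR_add_right)
      have "r *\<^sub>R w \<in> ?K - {0} \<longleftrightarrow> w \<in> ?K - {0}" using r(1) wide_cone_scaleR[OF r(1), of w a b \<epsilon>] by auto
      then have "indicator (?K - {0}) (r *\<^sub>R w) = (indicator (?K - {0}) w :: real)" by (simp only: indicator_def)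
      then have "h (v + z) * indicator (?K - {0}) (v + z)
          = r powr p * (h (u + (1 / r) *\<^sub>R z) * indicator (?K - {0}) (u + (1 / r) *\<^sub>R z))"
        unfolding vz hom[OF r(1)] w_def[symmetric] by (simp only: mult.assoc)
      also have "\<dots> \<le> r powr p * (h u + g \<bullet> ((1 / r) *\<^sub>R z) + q ((1 / r) *\<^sub>R z) + C * norm ((1 / r) *\<^sub>R z) ^ 3)"
        by (intro mult_left_mono q(3)) auto
      also have "h u + g \<bullet> ((1 / r) *\<^sub>R z) + q ((1 / r) *\<^sub>R z) + C * norm ((1 / r) *\<^sub>R z) ^ 3 = f z"
        using r unfolding q(1) f_def by (simp add: power_divide divide_inverse power_mult_distrib power_inverse)
      finally show ?thesis .
    qed
    interpret prob_space "gauss \<sigma> :: 'a measure" by (rule prob_space_gauss[OF \<sigma>])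
    have hc: "has_bochner_integral (gauss \<sigma>) (\<lambda>z::'a. h u) (h u)"
      using prob_space by (simp add: has_bochner_integral_iff)
    have h3: "has_bochner_integral (gauss \<sigma>) (\<lambda>z::'a. norm z ^ 3) (\<integral>z. norm z ^ 3 \<partial>(gauss \<sigma> :: 'a measure))"
      using cube(1)[OF \<sigma>] by (simp add: has_bochner_integral_iff)
    have f: "has_bochner_integral (gauss \<sigma>) f (h u + (1 / r) * 0 + (1 / r)\<^sup>2 * (\<sigma>\<^sup>2 * \<tau>) + (C / r ^ 3) * (\<integral>z. norm z ^ 3 \<partial>(gauss \<sigma> :: 'a measure)))"
      unfolding f_def
      by (intro has_bochner_integral_add has_bochner_integral_mult_right hc h3 q(2) \<sigma> has_bochner_integral_gauss_inner)
    have rf: "has_bochner_integral (gauss \<sigma>) (\<lambda>z. r powr p * f z) (r powr p * (h u + (1 / r) * 0 + (1 / r)\<^sup>2 * (\<sigma>\<^sup>2 * \<tau>) + (C / r ^ 3) * (\<integral>z. norm z ^ 3 \<partial>(gauss \<sigma> :: 'a measure))))"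
      using f by (rule has_bochner_integral_mult_right)
    have nonneg: "0 \<le> h (v + z) * indicator (?K - {0}) (v + z)" for z
    proof (cases "v + z \<in> ?K - {0}")
      case True
      then have "0 \<le> c1 * norm (v + z) powr p" using c1 by simp
      then show ?thesis using True bounds(1)[OF K0, of "v + z"] by auto
    qed simp
    have "(\<integral>\<^sup>+z. ennreal (h (v + z)) * indicator (?K - {0}) (v + z) \<partial>gauss \<sigma>)
      \<le> (\<integral>\<^sup>+z. ennreal (r powr p * f z) \<partial>gauss \<sigma>)"
    proof (intro nn_integral_mono)
      fix z
      have "ennreal (h (v + z)) * indicator (?K - {0}) (v + z) = ennreal (h (v + z) * indicator (?K - {0}) (v + z))"
        by (simp add: indicator_def)
      also have "\<dots> \<le> ennreal (r powr p * f z)" by (intro ennreal_leI pt)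
      finally show "ennreal (h (v + z)) * indicator (?K - {0}) (v + z) \<le> ennreal (r powr p * f z)" .
    qed
    also have "\<dots> = ennreal (r powr p * (h u + (1 / r) * 0 + (1 / r)\<^sup>2 * (\<sigma>\<^sup>2 * \<tau>) + (C / r ^ 3) * (\<integral>z. norm z ^ 3 \<partial>(gauss \<sigma> :: 'a measure))))"
    proof -
      have "0 \<le> r powr p * f z" for z using pt[of z] nonneg[of z] by linarith
      then show ?thesis
        using rf unfolding has_bochner_integral_iff by (subst nn_integral_eq_integral) auto
    qed
    also have "\<dots> \<le> ennreal (r powr p * h u)"
    proof (intro ennreal_leI mult_left_mono)
      have "(C / r ^ 3) * (\<integral>z. norm z ^ 3 \<partial>(gauss \<sigma> :: 'a measure)) \<le> (\<bar>C\<bar> / r ^ 3) * (\<integral>z. norm z ^ 3 \<partial>(gauss \<sigma> :: 'a measure))"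
        using r by (intro mult_right_mono divide_right_mono) auto
      also have "\<dots> \<le> (\<bar>C\<bar> / r ^ 3) * (C3 * \<sigma> ^ 3)"
        using r by (intro mult_left_mono cube(2) \<sigma>) auto
      also have "\<dots> = (\<sigma> / r)\<^sup>2 * (\<bar>C\<bar> * C3 * \<sigma> / r)" by (simp add: power2_eq_square power3_eq_cube)
      also have "\<dots> \<le> (\<sigma> / r)\<^sup>2 * \<eta>"
      proof (rule mult_left_mono)
        have "\<bar>C\<bar> * C3 / \<eta> * \<sigma> \<le> R0 * \<sigma>" using \<sigma> \<epsilon> by (intro mult_right_mono) (auto simp: R0_def)
        then have "\<bar>C\<bar> * C3 / \<eta> * \<sigma> \<le> r" using r(2) by linarith
        then show "\<bar>C\<bar> * C3 * \<sigma> / r \<le> \<eta>" using r \<eta> by (simp add: field_simps)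
      qed auto
      finally have A: "(C / r ^ 3) * (\<integral>z. norm z ^ 3 \<partial>(gauss \<sigma> :: 'a measure)) \<le> (\<sigma> / r)\<^sup>2 * \<eta>" .
      have "(\<sigma> / r)\<^sup>2 * \<tau> \<le> (\<sigma> / r)\<^sup>2 * (- \<eta>)" using \<tau> by (intro mult_left_mono) auto
      moreover have "(1 / r)\<^sup>2 * (\<sigma>\<^sup>2 * \<tau>) = (\<sigma> / r)\<^sup>2 * \<tau>" by (simp add: power_divide)
      ultimately have "(1 / r)\<^sup>2 * (\<sigma>\<^sup>2 * \<tau>) + C / r ^ 3 * (\<integral>z. norm z ^ 3 \<partial>(gauss \<sigma> :: 'a measure)) \<le> 0"
        using A by linarith
      then show "h u + 1 / r * 0 + (1 / r)\<^sup>2 * (\<sigma>\<^sup>2 * \<tau>) + C / r ^ 3 * (\<integral>z. norm z ^ 3 \<partial>(gauss \<sigma> :: 'a measure)) \<le> h u"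
        by simp
    qed simp
    also have "r powr p * h u = h v" using hom[OF r(1), of u] u(2) by simp
    finally show "(\<integral>\<^sup>+z. ennreal (h (v + z)) * indicator (?K - {0}) (v + z) \<partial>gauss \<sigma>) \<le> ennreal (h v)" .
  qed
qed

section \<open>Survival of a Gaussian walk in a cone\<close>

lemma (in prob_space) nn_integral_indep_var:
  assumes ind: "indep_var S X T Y" and f [measurable]: "f \<in> borel_measurable (S \<Otimes>\<^sub>M T)"
  shows "(\<integral>\<^sup>+\<omega>. f (X \<omega>, Y \<omega>) \<partial>M) = (\<integral>\<^sup>+\<omega>. (\<integral>\<^sup>+y. f (X \<omega>, y) \<partial>distr M T Y) \<partial>M)"
proof -
  have [measurable]: "X \<in> measurable M S" "Y \<in> measurable M T"
    using ind by (auto dest: indep_var_rv1 indep_var_rv2)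
  interpret Y: prob_space "distr M T Y" by (rule prob_space_distr) simp
  have "(\<integral>\<^sup>+\<omega>. f (X \<omega>, Y \<omega>) \<partial>M) = (\<integral>\<^sup>+z. f z \<partial>distr M (S \<Otimes>\<^sub>M T) (\<lambda>\<omega>. (X \<omega>, Y \<omega>)))"
    by (subst nn_integral_distr) auto
  also have "distr M (S \<Otimes>\<^sub>M T) (\<lambda>\<omega>. (X \<omega>, Y \<omega>)) = distr M S X \<Otimes>\<^sub>M distr M T Y"
    using ind unfolding indep_var_distribution_eq by simp
  also have "(\<integral>\<^sup>+z. f z \<partial>(distr M S X \<Otimes>\<^sub>M distr M T Y)) = (\<integral>\<^sup>+x. \<integral>\<^sup>+y. f (x, y) \<partial>distr M T Y \<partial>distr M S X)"
    by (subst Y.nn_integral_fst) simp_all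
  also have "\<dots> = (\<integral>\<^sup>+\<omega>. (\<integral>\<^sup>+y. f (X \<omega>, y) \<partial>distr M T Y) \<partial>M)"
    by (subst nn_integral_distr) simp_all
  finally show ?thesis .
qed

text \<open>The Markov property: the newest step \<open>Z (J - Suc j)\<close> is independent of the
  earlier part of the walk and can be integrated out. The partial sums collect the last
  \<open>i\<close> increments because the walk runs back in time while the increments are numbered
  forwards.\<close>

lemma (in prob_space) walk_step:
  fixes Z :: "nat \<Rightarrow> 'a \<Rightarrow> 'b::euclidean_space"
  assumes ind: "indep_vars (\<lambda>_. borel) Z {..<J}" and j: "j < J"
    and N: "distr M borel (Z (J - Suc j)) = N"
    and G [measurable]: "G \<in> sets borel" and g [measurable]: "g \<in> borel_measurable borel"
  defines "S \<equiv> \<lambda>i \<omega>. \<Sum>k\<in>{J - i..<J}. Z k \<omega>"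
  shows "(\<integral>\<^sup>+\<omega>. (if \<forall>i\<in>{1..j}. S i \<omega> \<in> G then g (S (Suc j) \<omega>) else 0) \<partial>M)
    = (\<integral>\<^sup>+\<omega>. (if \<forall>i\<in>{1..j}. S i \<omega> \<in> G then (\<integral>\<^sup>+z. g (S j \<omega> + z) \<partial>N) else 0) \<partial>M)"
proof -
  define A where "A = {J - j..<J}"
  define B where "B = {J - Suc j}"
  define X where "X = (\<lambda>\<omega>. restrict (\<lambda>i. Z i \<omega>) A)"
  let ?P = "Pi\<^sub>M A (\<lambda>_. borel :: 'b measure)"
  let ?Q = "Pi\<^sub>M B (\<lambda>_. borel :: 'b measure)"
  define Y where "Y = (\<lambda>\<omega>. restrict (\<lambda>i. Z i \<omega>) B)"
  have iv: "indep_var ?P X ?Q Y"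
    unfolding X_def Y_def using j by (intro indep_var_restrict[OF ind]) (auto simp: A_def B_def)
  have YZ: "Y \<omega> (J - Suc j) = Z (J - Suc j) \<omega>" for \<omega> by (simp add: Y_def B_def)
  have [measurable]: "Y \<in> measurable M ?Q" using iv by (rule indep_var_rv2)
  have [measurable]: "(\<lambda>y. y (J - Suc j)) \<in> borel_measurable ?Q"
    by (rule measurable_component_singleton) (simp add: B_def)
  have [measurable]: "Z (J - Suc j) \<in> borel_measurable M"
    using ind j by (auto simp: indep_vars_def)
  define s where "s = (\<lambda>i x. \<Sum>k\<in>{J - i..<J}. x k :: 'b)"
  have s_meas: "s i \<in> measurable ?P borel" if "i \<le> j" for i
    unfolding s_def
  proof (intro borel_measurable_sum)
    fix k assume "k \<in> {J - i..<J}"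
    then have "k \<in> A" using that by (auto simp: A_def)
    then show "(\<lambda>x. x k) \<in> borel_measurable ?P" by (rule measurable_component_singleton)
  qed
  have sX: "s i (X \<omega>) = S i \<omega>" if "i \<le> j" for i \<omega>
    unfolding s_def S_def X_def using that by (intro sum.cong) (auto simp: A_def)
  have S_Suc: "S (Suc j) \<omega> = S j \<omega> + Z (J - Suc j) \<omega>" for \<omega>
  proof -
    have "{J - Suc j..<J} = insert (J - Suc j) {J - j..<J}" using j by auto
    moreover have "J - Suc j \<notin> {J - j..<J}" using j by auto
    ultimately show ?thesis unfolding S_def by (simp add: add.commute)
  qed
  define f where "f = (\<lambda>(x, y). if \<forall>i\<in>{1..j}. s i x \<in> G then g (s j x + y (J - Suc j)) else 0)"
  have [measurable]: "Measurable.pred (?P \<Otimes>\<^sub>M ?Q) (\<lambda>p. s i (fst p) \<in> G)" if "i \<in> {1..j}" for i :: nat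
  proof -
    have [measurable]: "s i \<in> measurable ?P borel" using that by (intro s_meas) simp
    show ?thesis by measurable
  qed
  have [measurable]: "s j \<in> measurable ?P borel" by (rule s_meas) simp
  have [measurable]: "f \<in> borel_measurable (?P \<Otimes>\<^sub>M ?Q)"
    unfolding f_def split_beta by measurable
  have "(\<integral>\<^sup>+\<omega>. f (X \<omega>, Y \<omega>) \<partial>M) = (\<integral>\<^sup>+\<omega>. (\<integral>\<^sup>+y. f (X \<omega>, y) \<partial>distr M ?Q Y) \<partial>M)"
    by (rule nn_integral_indep_var[OF iv]) simp
  moreover have "f (X \<omega>, y) = (if \<forall>i\<in>{1..j}. S i \<omega> \<in> G then g (S j \<omega> + y (J - Suc j)) else 0)" for \<omega> y
    by (auto simp: f_def sX)
  moreover have "(\<integral>\<^sup>+y. (if \<forall>i\<in>{1..j}. S i \<omega> \<in> G then g (S j \<omega> + y (J - Suc j)) else 0) \<partial>distr M ?Q Y)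
    = (\<integral>\<^sup>+y. (if \<forall>i\<in>{1..j}. S i \<omega> \<in> G then g (S j \<omega> + y) else 0) \<partial>N)" for \<omega>
    unfolding N[symmetric] by (subst (1 2) nn_integral_distr) (simp_all add: YZ cong: if_cong)
  moreover have "(\<integral>\<^sup>+y. (if \<forall>i\<in>{1..j}. S i \<omega> \<in> G then g (S j \<omega> + y) else 0) \<partial>N)
     = (if \<forall>i\<in>{1..j}. S i \<omega> \<in> G then (\<integral>\<^sup>+z. g (S j \<omega> + z) \<partial>N) else 0)" for \<omega>
  proof (cases "\<forall>i\<in>{1..j}. S i \<omega> \<in> G")
    case True
    show ?thesis unfolding if_P[OF True] ..
  next
    case False
    show ?thesis unfolding if_not_P[OF False] by simp
  qed
  ultimately show ?thesis by (simp add: S_Suc YZ cong: if_cong)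
qed

section \<open>The Brownian path read backwards as a Gaussian walk\<close>

context brownian_motion
begin

lemma distr_increment:
  assumes "0 \<le> s" "s < t"
  shows "distr M borel (\<lambda>\<omega>. B t \<omega> - B s \<omega>) = gauss (sqrt (t - s))"
proof -
  have "distr M lborel (\<lambda>\<omega>. B t \<omega> - B s \<omega>) = gauss (sqrt (t - s))"
    using gaussian_increments[OF assms] unfolding distributed_def gauss_def by simp
  moreover have "distr M borel (\<lambda>\<omega>. B t \<omega> - B s \<omega>) = distr M lborel (\<lambda>\<omega>. B t \<omega> - B s \<omega>)"
    by (rule distr_cong) simp_all
  ultimately show ?thesis by simp
qed

definition back_walk :: "real \<Rightarrow> real \<Rightarrow> nat \<Rightarrow> 'w \<Rightarrow> 'a" where
  "back_walk t u j \<omega> = B t \<omega> - B (t - real j * u) \<omega>"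

lemma back_walk_measurable:
  assumes "real j * u \<le> t" "0 \<le> u"
  shows "back_walk t u j \<in> borel_measurable M"
proof -
  have [measurable]: "B t \<in> borel_measurable M" "B (t - real j * u) \<in> borel_measurable M"
    using assms by (auto intro!: measurable_B) (meson dual_order.trans mult_nonneg_nonneg of_nat_0_le_iff)
  show ?thesis unfolding back_walk_def by measurable
qed

lemma back_walk_indep:
  assumes u: "0 < u" and J: "real J * u \<le> t"
  defines "Z \<equiv> \<lambda>i \<omega>. B (t - real (J - Suc i) * u) \<omega> - B (t - real (J - i) * u) \<omega>"
  shows "indep_vars (\<lambda>_. borel) Z {..<J}"
    and "j < J \<Longrightarrow> distr M borel (Z (J - Suc j)) = gauss (sqrt u)"
    and "j \<le> J \<Longrightarrow> back_walk t u j \<omega> = (\<Sum>k\<in>{J - j..<J}. Z k \<omega>)"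
proof -
  have le: "real i * u \<le> t" if "i \<le> J" for i
    using that u J by (meson less_imp_le mult_right_mono of_nat_mono order_trans)
  show "indep_vars (\<lambda>_. borel) Z {..<J}"
    unfolding Z_def
  proof (rule indep_increments[where \<tau>="\<lambda>i. t - real (J - i) * u"])
    show "0 \<le> t - real (J - 0) * u" using J by simp
    show "t - real (J - i) * u < t - real (J - Suc i) * u" if "i < J" for i
      using that u by simp
  qed
  show "distr M borel (Z (J - Suc j)) = gauss (sqrt u)" if "j < J"
  proof -
    have e: "J - Suc (J - Suc j) = j" "J - (J - Suc j) = Suc j" using that by auto
    have "distr M borel (\<lambda>\<omega>. B (t - real j * u) \<omega> - B (t - real (Suc j) * u) \<omega>)
        = gauss (sqrt ((t - real j * u) - (t - real (Suc j) * u)))"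
      by (rule distr_increment) (use le[of "Suc j"] that u in auto)
    then show ?thesis unfolding Z_def e by (simp add: algebra_simps)
  qed
  show "back_walk t u j \<omega> = (\<Sum>k\<in>{J - j..<J}. Z k \<omega>)" if "j \<le> J"
    using that
  proof (induction j)
    case 0
    then show ?case by (simp add: back_walk_def)
  next
    case (Suc j)
    have "{J - Suc j..<J} = insert (J - Suc j) {J - j..<J}" "J - Suc j \<notin> {J - j..<J}" using Suc.prems by auto
    moreover have e: "J - Suc (J - Suc j) = j" "J - (J - Suc j) = Suc j" using Suc.prems by auto
    ultimately have "(\<Sum>k\<in>{J - Suc j..<J}. Z k \<omega>) = Z (J - Suc j) \<omega> + back_walk t u j \<omega>"
      using Suc by simp
    also have "\<dots> = back_walk t u (Suc j) \<omega>"
      unfolding Z_def e back_walk_def by simp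
    finally show ?case ..
  qed
qed

lemma back_walk_distr:
  assumes "0 < u" "real j * u \<le> t" "0 < j"
  shows "distr M borel (back_walk t u j) = gauss (sqrt (real j * u))"
proof -
  have "distr M borel (\<lambda>\<omega>. B t \<omega> - B (t - real j * u) \<omega>) = gauss (sqrt (t - (t - real j * u)))"
    by (rule distr_increment) (use assms in auto)
  then show ?thesis by (simp add: back_walk_def[abs_def])
qed

end

section \<open>Elementary estimates for the visits near the apex\<close>

lemma inverse_le_2_ln_diff:
  assumes "1 \<le> j"
  shows "1 / real j \<le> 2 * (ln (real (Suc j)) - ln (real j))"
proof -
  have "ln (real j / real (Suc j)) \<le> real j / real (Suc j) - 1"
    using assms by (intro ln_le_minus_one) auto
  also have "\<dots> = - (1 / real (Suc j))" by (simp add: field_simps)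
  finally have "1 / real (Suc j) \<le> ln (real (Suc j)) - ln (real j)"
    using assms by (simp add: ln_div del: of_nat_Suc)
  then have "2 * (1 / real (Suc j)) \<le> 2 * (ln (real (Suc j)) - ln (real j))"
    by (rule mult_left_mono) simp
  moreover have "1 / real j \<le> 2 * (1 / real (Suc j))" using assms by (simp add: field_simps)
  ultimately show ?thesis by (rule order_trans[rotated])
qed

lemma powr_le_one_plus_square:
  fixes x \<sigma> p :: real
  assumes "0 < \<sigma>" "0 \<le> x" "0 < p" "p \<le> 2"
  shows "x powr p \<le> \<sigma> powr p * (1 + (x / \<sigma>)\<^sup>2)"
proof -
  define y where "y = x / \<sigma>"
  have y: "0 \<le> y" and x: "x = \<sigma> * y" using assms by (auto simp: y_def)
  have "y powr p \<le> 1 + y\<^sup>2"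
  proof (cases "y \<le> 1")
    case True
    then have "y powr p \<le> 1" using y assms by (intro powr_le1) auto
    then show ?thesis by (simp add: add_increasing2)
  next
    case False
    then have "y powr p \<le> y powr 2" using assms by (intro powr_mono) auto
    then show ?thesis using False by simp
  qed
  then have "\<sigma> powr p * y powr p \<le> \<sigma> powr p * (1 + y\<^sup>2)"
    by (intro mult_left_mono) auto
  moreover have "x powr p = \<sigma> powr p * y powr p"
    unfolding x using assms y by (simp add: powr_mult)
  ultimately show ?thesis unfolding y_def by linarith
qed

text \<open>The price of a visit near the apex: one step later the walk is still at a distance
  comparable with \<open>\<sigma>\<close>, so the mean of the \<open>p\<close>-th power is a
  constant times \<open>\<sigma> powr p\<close>. Because \<open>p \<le> 2\<close>, second moments
  control it.\<close>

lemma nn_integral_gauss_powr_le: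
  fixes v :: "'a::euclidean_space"
  assumes \<sigma>: "0 < \<sigma>" and p: "0 < p" "p \<le> 2" and v: "norm v \<le> R * \<sigma>"
  shows "(\<integral>\<^sup>+z. ennreal (norm (v + z) powr p) \<partial>gauss \<sigma>) \<le> ennreal (\<sigma> powr p * (1 + 2 * R\<^sup>2 + 2 * DIM('a)))"
proof -
  interpret prob_space "gauss \<sigma> :: 'a measure" by (rule prob_space_gauss[OF \<sigma>])
  let ?f = "\<lambda>z::'a. \<sigma> powr p * (1 + 2 * R\<^sup>2) + (\<sigma> powr p * 2 / \<sigma>\<^sup>2) * (norm z)\<^sup>2"
  have le: "norm (v + z) powr p \<le> ?f z" for z
  proof -
    have "norm (v + z) powr p \<le> \<sigma> powr p * (1 + (norm (v + z) / \<sigma>)\<^sup>2)"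
      by (rule powr_le_one_plus_square) (use assms in auto)
    also have "\<dots> \<le> \<sigma> powr p * (1 + (2 * R\<^sup>2 + 2 * (norm z / \<sigma>)\<^sup>2))"
    proof (intro mult_left_mono add_left_mono)
      have "norm (v + z) / \<sigma> \<le> R + norm z / \<sigma>"
        using norm_triangle_ineq[of v z] v \<sigma> by (simp add: field_simps)
      then have "(norm (v + z) / \<sigma>)\<^sup>2 \<le> (R + norm z / \<sigma>)\<^sup>2" using \<sigma> by (intro power_mono) auto
      also have "\<dots> \<le> 2 * R\<^sup>2 + 2 * (norm z / \<sigma>)\<^sup>2"
        using sum_squares_bound[of R "norm z / \<sigma>"] by (simp add: power2_sum)
      finally show "(norm (v + z) / \<sigma>)\<^sup>2 \<le> 2 * R\<^sup>2 + 2 * (norm z / \<sigma>)\<^sup>2" .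
    qed auto
    also have "\<dots> = ?f z" by (simp add: power_divide algebra_simps)
    finally show ?thesis .
  qed
  have hc: "has_bochner_integral (gauss \<sigma>) (\<lambda>z::'a. \<sigma> powr p * (1 + 2 * R\<^sup>2)) (\<sigma> powr p * (1 + 2 * R\<^sup>2))"
    using prob_space by (simp add: has_bochner_integral_iff)
  have f: "has_bochner_integral (gauss \<sigma>) ?f (\<sigma> powr p * (1 + 2 * R\<^sup>2) + (\<sigma> powr p * 2 / \<sigma>\<^sup>2) * (\<sigma>\<^sup>2 * DIM('a)))"
    by (intro has_bochner_integral_add hc has_bochner_integral_mult_right has_bochner_integral_gauss_norm_square \<sigma>)
  have "(\<integral>\<^sup>+z. ennreal (norm (v + z) powr p) \<partial>gauss \<sigma>) \<le> (\<integral>\<^sup>+z. ennreal (?f z) \<partial>gauss \<sigma>)"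
    by (intro nn_integral_mono ennreal_leI le)
  also have "\<dots> = ennreal (\<sigma> powr p * (1 + 2 * R\<^sup>2) + (\<sigma> powr p * 2 / \<sigma>\<^sup>2) * (\<sigma>\<^sup>2 * DIM('a)))"
  proof -
    have "0 \<le> ?f z" for z using le[of z] powr_ge_zero[of "norm (v + z)" p] by linarith
    then show ?thesis
      using f unfolding has_bochner_integral_iff by (subst nn_integral_eq_integral) auto
  qed
  also have "\<sigma> powr p * (1 + 2 * R\<^sup>2) + (\<sigma> powr p * 2 / \<sigma>\<^sup>2) * (\<sigma>\<^sup>2 * DIM('a)) = \<sigma> powr p * (1 + 2 * R\<^sup>2 + 2 * DIM('a))"
    using \<sigma> by (simp add: field_simps)
  finally show ?thesis .
qed

context brownian_motion
begin

text \<open>Near the apex \<open>h\<close> is not superharmonic, so each visit of \<open>ball 0 (R0 * \<sigma>)\<close> adds \<open>O(\<sigma>\<^sup>p)\<close> to the mean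
  of \<open>h\<close>; in dimension at least \<open>2\<close> the expected number of visits in \<open>J\<close> steps is \<open>O(ln J)\<close>. The walk is
  far from the apex at the end of one of \<open>m\<close> blocks of \<open>k\<close> steps, outside an event of probability
  \<open>2\<^sup>-\<^sup>m\<close>.\<close>

lemma cone_survival:
  fixes a b :: 'a
  assumes dim: "DIM('a) \<ge> 2" and ab: "norm a = 1" "norm b = 1" "a \<noteq> b"
  obtains \<epsilon> p R0 C :: real and k0 :: nat where
    "\<And>m k \<sigma> t. k0 \<le> k \<Longrightarrow> 1 \<le> m \<Longrightarrow> 0 < \<sigma> \<Longrightarrow> real (m * k) * \<sigma>\<^sup>2 \<le> t \<Longrightarrow>
      emeasure M {\<omega>\<in>space M. \<forall>j\<in>{1..m * k}. back_walk t (\<sigma>\<^sup>2) j \<omega> \<in> ball 0 (R0 * \<sigma>) \<union> wide_cone a b \<epsilon>}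
        \<le> ennreal ((1 / 2) ^ m + C * m * (1 + ln (m * k)) * real k powr (- p / 2))"
    "0 < \<epsilon>" "\<epsilon> \<le> 1" "4 / \<epsilon> \<le> R0" "1 < p" "p \<le> 3 / 2" "0 < C"
proof -
  obtain \<epsilon> p c1 C1 R0 :: real and h :: "'a \<Rightarrow> real" where
    \<epsilon>: "0 < \<epsilon>" "\<epsilon> \<le> 1" "4 / \<epsilon> \<le> R0" and p: "1 < p" "p \<le> 3 / 2" and c1: "0 < c1" and C1: "0 < C1" and R0: "0 < R0"
    and h_meas [measurable]: "h \<in> borel_measurable borel"
    and h_lo: "\<And>v. v \<in> wide_cone a b \<epsilon> \<Longrightarrow> v \<noteq> 0 \<Longrightarrow> c1 * norm v powr p \<le> h v"
    and h_up: "\<And>v. v \<in> wide_cone a b \<epsilon> \<Longrightarrow> v \<noteq> 0 \<Longrightarrow> h v \<le> C1 * norm v powr p"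
    and h_super: "\<And>\<sigma> v. 0 < \<sigma> \<Longrightarrow> v \<in> wide_cone a b \<epsilon> \<Longrightarrow> R0 * \<sigma> \<le> norm v \<Longrightarrow>
      (\<integral>\<^sup>+z. ennreal (h (v + z)) * indicator (wide_cone a b \<epsilon> - {0}) (v + z) \<partial>gauss \<sigma>) \<le> ennreal (h v)"
    by (rule lyapunov_function[OF dim ab]) blast
  obtain Cb where Cb: "0 < Cb" "\<And>\<sigma> r. \<sigma> > 0 \<Longrightarrow> r \<ge> 0 \<Longrightarrow>
     emeasure (gauss \<sigma>) (ball (0::'a) r) \<le> ennreal (Cb * (r / \<sigma>) ^ DIM('a))"
    by (rule emeasure_gauss_ball_le[where 'a='a]) blast
  define K where "K = wide_cone a b \<epsilon>"
  have [measurable]: "K \<in> sets borel" by (simp add: K_def)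
  define C2 where "C2 = C1 * (1 + 2 * R0\<^sup>2 + 2 * DIM('a))"
  have C2: "0 < C2" using C1 unfolding C2_def by (intro mult_pos_pos add_pos_nonneg) auto
  \<comment> \<open>The maximum with 1 makes \<open>C5 / j\<close> at least 1, hence a trivial
    bound, for the early steps with \<open>j < R0\<^sup>2\<close>.\<close>
  define C5 where "C5 = max Cb 1 * R0\<^sup>2"
  have C5: "0 < C5" using R0 unfolding C5_def by (intro mult_pos_pos) auto
  \<comment> \<open>A block of \<open>k\<close> steps has increments of scale
    \<open>sqrt k * \<sigma>\<close>. This choice bounds by 1/2 the probability that such an
    increment is shorter than \<open>2 * r\<close>, where
    \<open>r = c4 * \<sigma> * sqrt k\<close>.\<close>
  define c4 where "c4 = min (1 / 2) (1 / (4 * Cb))"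
  have c4: "0 < c4" "c4 \<le> 1 / 2" "c4 \<le> 1 / (4 * Cb)" using Cb(1) by (auto simp: c4_def)
  define C where "C = C2 * (1 + 2 * C5) / (c1 * c4 powr p)"
  have C: "0 < C" using C2 C5 c1 c4 by (simp add: C_def)
  \<comment> \<open>Blocks must be long enough for \<open>R0 * \<sigma> \<le> r\<close>: a permitted
    position at distance at least \<open>r\<close> from the apex then lies in the cone.\<close>
  define k0 where "k0 = nat \<lceil>(R0 / c4)\<^sup>2\<rceil> + 1"
  have main: "emeasure M {\<omega>\<in>space M. \<forall>j\<in>{1..m * k}. back_walk t (\<sigma>\<^sup>2) j \<omega> \<in> ball 0 (R0 * \<sigma>) \<union> K}
        \<le> ennreal ((1 / 2) ^ m + C * m * (1 + ln (m * k)) * real k powr (- p / 2))"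
    if k: "k0 \<le> k" and m: "1 \<le> m" and \<sigma>: "0 < \<sigma>" and t: "real (m * k) * \<sigma>\<^sup>2 \<le> t" for m k \<sigma> t
  proof -
    define J where "J = m * k"
    define G where "G = ball 0 (R0 * \<sigma>) \<union> K"
    have [measurable]: "G \<in> sets borel" by (simp add: G_def)
    define S where "S = back_walk t (\<sigma>\<^sup>2)"
    have k1: "1 \<le> k" "(R0 / c4)\<^sup>2 \<le> k" using k unfolding k0_def by linarith+
    have le: "real j * \<sigma>\<^sup>2 \<le> t" if "j \<le> J" for j
    proof -
      have "real j * \<sigma>\<^sup>2 \<le> real J * \<sigma>\<^sup>2" using that by (intro mult_right_mono) auto
      then show ?thesis using t by (simp add: J_def)
    qed
    have S_meas [measurable]: "S j \<in> borel_measurable M" if "j \<le> J" for j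
      unfolding S_def by (rule back_walk_measurable[OF le[OF that]]) simp
    have S0: "S 0 \<omega> = 0" for \<omega> by (simp add: S_def back_walk_def)
    define A where "A = (\<lambda>j \<omega>. \<forall>i\<in>{1..j}. S i \<omega> \<in> G)"
    have A_meas: "Measurable.pred M (A j)" if "j \<le> J" for j
    proof -
      have [measurable]: "Measurable.pred M (\<lambda>\<omega>. S i \<omega> \<in> G)" if "i \<in> {1..j}" for i
      proof -
        have [measurable]: "S i \<in> borel_measurable M" using that \<open>j \<le> J\<close> by (intro S_meas) auto
        show ?thesis by measurable
      qed
      show ?thesis unfolding A_def by measurable
    qed
    define H' where "H' = (\<lambda>v. ennreal (h v) * indicator (K - {0}) v)"
    \<comment> \<open>Besides the complement of the cone, \<open>H\<close> discards the ball: a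
      visit of the ball erases the value accumulated so far, and the next step pays for the
      restart.\<close>
    define H where "H = (\<lambda>v. if R0 * \<sigma> \<le> norm v then H' v else 0)"
    have [measurable]: "H' \<in> borel_measurable borel" "H \<in> borel_measurable borel"
      unfolding H'_def H_def by measurable
    define mm where "mm = (\<lambda>j. \<integral>\<^sup>+\<omega>. (if A j \<omega> then H (S j \<omega>) else 0) \<partial>M)"
    have R\<sigma>: "0 < R0 * \<sigma>" using R0 \<sigma> by simp
    have ball_prob: "emeasure M {\<omega>\<in>space M. norm (S j \<omega>) < R0 * \<sigma>} \<le> ennreal (C5 / j)" if j: "1 \<le> j" "j \<le> J" for j
    proof -
      have [measurable]: "S j \<in> borel_measurable M" using j by (intro S_meas)
      have d: "distr M borel (S j) = gauss (sqrt (real j * \<sigma>\<^sup>2))"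
        unfolding S_def by (rule back_walk_distr) (use \<sigma> le j in auto)
      have sq: "sqrt (real j * \<sigma>\<^sup>2) = sqrt j * \<sigma>" using \<sigma> by (simp add: real_sqrt_mult)
      have e: "emeasure M {\<omega>\<in>space M. norm (S j \<omega>) < R0 * \<sigma>} = emeasure (distr M borel (S j)) (ball 0 (R0 * \<sigma>))"
        by (subst emeasure_distr) (auto intro!: arg_cong[where f="emeasure M"])
      show ?thesis
      proof (cases "R0\<^sup>2 \<le> j")
        case True
        have "R0 \<le> sqrt j" using True by (simp add: real_le_rsqrt)
        then have r1: "R0 / sqrt j \<le> 1" using j by (simp add: field_simps)
        have "emeasure M {\<omega>\<in>space M. norm (S j \<omega>) < R0 * \<sigma>} \<le> ennreal (Cb * ((R0 * \<sigma>) / (sqrt j * \<sigma>)) ^ DIM('a))"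
          unfolding e d sq by (rule Cb(2)) (use j \<sigma> R\<sigma> in auto)
        also have "\<dots> \<le> ennreal (C5 / j)"
        proof (rule ennreal_leI)
          have "((R0 * \<sigma>) / (sqrt j * \<sigma>)) ^ DIM('a) = (R0 / sqrt j) ^ DIM('a)" using \<sigma> by simp
          \<comment> \<open>Here the dimension enters: an exponent of at least 2 gives a bound by a
            multiple of \<open>1 / j\<close>, whose sums grow only logarithmically.\<close>
          also have "\<dots> \<le> (R0 / sqrt j) ^ 2"
            using r1 R0 dim by (intro power_decreasing) auto
          also have "\<dots> = R0\<^sup>2 / j" by (simp add: power_divide)
          finally have "Cb * ((R0 * \<sigma>) / (sqrt j * \<sigma>)) ^ DIM('a) \<le> max Cb 1 * (R0\<^sup>2 / j)"
            using R0 \<sigma> Cb(1) by (intro mult_mono) auto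
          then show "Cb * ((R0 * \<sigma>) / (sqrt j * \<sigma>)) ^ DIM('a) \<le> C5 / j" by (simp add: C5_def)
        qed
        finally show ?thesis .
      next
        case False
        have "real j \<le> 1 * R0\<^sup>2" using False by simp
        also have "\<dots> \<le> C5" unfolding C5_def by (intro mult_right_mono) auto
        finally have "1 \<le> C5 / j" using j by simp
        then have "ennreal 1 \<le> ennreal (C5 / j)" by (rule ennreal_leI)
        moreover have "emeasure M {\<omega>\<in>space M. norm (S j \<omega>) < R0 * \<sigma>} \<le> 1" by (rule emeasure_le_1)
        ultimately show ?thesis unfolding ennreal_1 by (rule order_trans[rotated])
      qed
    qed
    have small: "(\<integral>\<^sup>+z. H' (v + z) \<partial>gauss \<sigma>) \<le> ennreal (C2 * \<sigma> powr p)" if v: "norm v < R0 * \<sigma>" for v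
    proof -
      have "(\<integral>\<^sup>+z. H' (v + z) \<partial>gauss \<sigma>) \<le> (\<integral>\<^sup>+z. ennreal C1 * ennreal (norm (v + z) powr p) \<partial>gauss \<sigma>)"
        using h_up C1 by (intro nn_integral_mono)
          (auto simp: H'_def K_def indicator_def ennreal_mult[symmetric] intro!: ennreal_leI)
      also have "\<dots> = ennreal C1 * (\<integral>\<^sup>+z. ennreal (norm (v + z) powr p) \<partial>gauss \<sigma>)"
        by (rule nn_integral_cmult) measurable
      also have "\<dots> \<le> ennreal C1 * ennreal (\<sigma> powr p * (1 + 2 * R0\<^sup>2 + 2 * DIM('a)))"
        using nn_integral_gauss_powr_le[OF \<sigma>, of p v R0] p v by (intro mult_left_mono) auto
      also have "\<dots> = ennreal (C2 * \<sigma> powr p)"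
        using C1 by (simp add: ennreal_mult[symmetric] C2_def mult_ac)
      finally show ?thesis .
    qed
    have ind: "indep_vars (\<lambda>_. borel) (\<lambda>i \<omega>. B (t - real (J - Suc i) * \<sigma>\<^sup>2) \<omega> - B (t - real (J - i) * \<sigma>\<^sup>2) \<omega>) {..<J}"
      by (rule back_walk_indep(1)) (use \<sigma> le in auto)
    have distZ: "distr M borel (\<lambda>\<omega>. B (t - real (J - Suc (J - Suc j)) * \<sigma>\<^sup>2) \<omega> - B (t - real (J - (J - Suc j)) * \<sigma>\<^sup>2) \<omega>) = gauss \<sigma>"
      if "j < J" for j
      using back_walk_indep(2)[of "\<sigma>\<^sup>2" J t j] that \<sigma> le by simp
    have Ssum: "S j \<omega> = (\<Sum>k\<in>{J - j..<J}. B (t - real (J - Suc k) * \<sigma>\<^sup>2) \<omega> - B (t - real (J - k) * \<sigma>\<^sup>2) \<omega>)" if "j \<le> J" for j \<omega>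
      unfolding S_def by (rule back_walk_indep(3)) (use \<sigma> le that in auto)
    have step: "mm (Suc j) \<le> mm j + ennreal (C2 * \<sigma> powr p) * emeasure M {\<omega>\<in>space M. norm (S j \<omega>) < R0 * \<sigma>}"
      if j: "j < J" for j
    proof -
      have [measurable]: "S j \<in> borel_measurable M" "S (Suc j) \<in> borel_measurable M" using j by (auto intro!: S_meas)
      have [measurable]: "Measurable.pred M (A j)" using j by (intro A_meas) simp
      have AS: "A (Suc j) \<omega> \<Longrightarrow> A j \<omega>" for \<omega> by (auto simp: A_def)
      \<comment> \<open>The constraint on step \<open>Suc j\<close> is given up; what remains of it
        is the cut-off inside \<open>H'\<close>.\<close>
      have "mm (Suc j) \<le> (\<integral>\<^sup>+\<omega>. (if A j \<omega> then H' (S (Suc j) \<omega>) else 0) \<partial>M)"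
        unfolding mm_def using AS by (intro nn_integral_mono) (auto simp: H_def)
      also have "\<dots> = (\<integral>\<^sup>+\<omega>. (if A j \<omega> then (\<integral>\<^sup>+z. H' (S j \<omega> + z) \<partial>gauss \<sigma>) else 0) \<partial>M)"
      proof -
        have Sj: "S j \<omega> = (\<Sum>k\<in>{J - j..<J}. B (t - real (J - Suc k) * \<sigma>\<^sup>2) \<omega> - B (t - real (J - k) * \<sigma>\<^sup>2) \<omega>)"
          "S (Suc j) \<omega> = (\<Sum>k\<in>{J - Suc j..<J}. B (t - real (J - Suc k) * \<sigma>\<^sup>2) \<omega> - B (t - real (J - k) * \<sigma>\<^sup>2) \<omega>)"
          "A j \<omega> \<longleftrightarrow> (\<forall>i\<in>{1..j}. (\<Sum>k\<in>{J - i..<J}. B (t - real (J - Suc k) * \<sigma>\<^sup>2) \<omega> - B (t - real (J - k) * \<sigma>\<^sup>2) \<omega>) \<in> G)" for \<omega>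
          using j by (auto simp only: A_def atLeastAtMost_iff intro!: Ssum ball_cong arg_cong[where f="\<lambda>x. x \<in> G"])
        show ?thesis unfolding Sj by (rule walk_step[OF ind j distZ[OF j]]) measurable
      qed
      also have "\<dots> \<le> (\<integral>\<^sup>+\<omega>. (if A j \<omega> then H (S j \<omega>) else 0)
          + ennreal (C2 * \<sigma> powr p) * indicator {\<omega>\<in>space M. norm (S j \<omega>) < R0 * \<sigma>} \<omega> \<partial>M)"
      proof (intro nn_integral_mono)
        fix \<omega> assume \<omega>: "\<omega> \<in> space M"
        show "(if A j \<omega> then (\<integral>\<^sup>+z. H' (S j \<omega> + z) \<partial>gauss \<sigma>) else 0) \<le> (if A j \<omega> then H (S j \<omega>) else 0)
          + ennreal (C2 * \<sigma> powr p) * indicator {\<omega>\<in>space M. norm (S j \<omega>) < R0 * \<sigma>} \<omega>"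
        proof (cases "A j \<omega>")
          case True
          show ?thesis
          proof (cases "norm (S j \<omega>) < R0 * \<sigma>")
            case small_S: True
            then show ?thesis using small[OF small_S] True \<omega> by (simp add: add_increasing)
          next
            case False
            then have "j \<noteq> 0" using S0 R\<sigma> by (cases j) auto
            then have "S j \<omega> \<in> G" using True by (auto simp: A_def)
            then have K: "S j \<omega> \<in> K" using False by (auto simp: G_def)
            have nz: "S j \<omega> \<noteq> 0" using False R\<sigma> by auto
            have "(\<integral>\<^sup>+z. H' (S j \<omega> + z) \<partial>gauss \<sigma>) \<le> ennreal (h (S j \<omega>))"
              using h_super[OF \<sigma>, of "S j \<omega>"] K False by (simp add: H'_def K_def)
            also have "\<dots> = H (S j \<omega>)" using False K nz by (simp add: H_def H'_def)
            finally show ?thesis using True False by simp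
          qed
        qed simp
      qed
      also have "\<dots> = mm j + ennreal (C2 * \<sigma> powr p) * emeasure M {\<omega>\<in>space M. norm (S j \<omega>) < R0 * \<sigma>}"
        unfolding mm_def by (subst nn_integral_add) (auto simp: nn_integral_cmult_indicator)
      finally show ?thesis .
    qed
    \<comment> \<open>The walk starts in the ball, so \<open>mm 0 = 0\<close>. Adding up the
      visiting probabilities \<open>C5 / j\<close> gives the logarithm through
      \<open>inverse_le_2_ln_diff\<close>.\<close>
    have mm_bound: "mm (Suc j) \<le> ennreal (C2 * \<sigma> powr p * (1 + 2 * C5 * ln (Suc j)))" if "j < J" for j
      using that
    proof (induction j)
      case 0
      have "(if A 0 \<omega> then H (S 0 \<omega>) else 0) = 0" for \<omega> using R\<sigma> by (auto simp: H_def S0)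
      then have "mm 0 = 0" by (simp add: mm_def)
      then have "mm (Suc 0) \<le> ennreal (C2 * \<sigma> powr p) * emeasure M {\<omega>\<in>space M. norm (S 0 \<omega>) < R0 * \<sigma>}"
        using step[OF 0] by simp
      also have "\<dots> \<le> ennreal (C2 * \<sigma> powr p) * 1" by (intro mult_left_mono emeasure_le_1) auto
      finally show ?case by simp
    next
      case (Suc j)
      have nn: "0 \<le> C2 * \<sigma> powr p" using C2 by simp
      have "mm (Suc (Suc j)) \<le> mm (Suc j) + ennreal (C2 * \<sigma> powr p) * emeasure M {\<omega>\<in>space M. norm (S (Suc j) \<omega>) < R0 * \<sigma>}"
        by (rule step) (use Suc in auto)
      also have "\<dots> \<le> ennreal (C2 * \<sigma> powr p * (1 + 2 * C5 * ln (Suc j))) + ennreal (C2 * \<sigma> powr p) * ennreal (C5 / Suc j)"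
        using Suc by (intro add_mono mult_left_mono ball_prob) auto
      also have "\<dots> = ennreal (C2 * \<sigma> powr p * (1 + 2 * C5 * ln (Suc j)) + C2 * \<sigma> powr p * (C5 / Suc j))"
        using C2 C5 by (simp add: ennreal_mult[symmetric] ennreal_plus[symmetric] del: ennreal_plus)
      also have "\<dots> \<le> ennreal (C2 * \<sigma> powr p * (1 + 2 * C5 * ln (Suc (Suc j))))"
      proof (rule ennreal_leI)
        have "C5 * (1 / Suc j) \<le> C5 * (2 * (ln (real (Suc (Suc j))) - ln (real (Suc j))))"
          using C5 inverse_le_2_ln_diff[of "Suc j"] by (intro mult_left_mono) auto
        then have "1 + 2 * C5 * ln (Suc j) + C5 / Suc j \<le> 1 + 2 * C5 * ln (Suc (Suc j))"
          by (simp add: algebra_simps)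
        from mult_left_mono[OF this nn]
        show "C2 * \<sigma> powr p * (1 + 2 * C5 * ln (Suc j)) + C2 * \<sigma> powr p * (C5 / Suc j) \<le> C2 * \<sigma> powr p * (1 + 2 * C5 * ln (Suc (Suc j)))"
          by (simp add: distrib_left)
      qed
      finally show ?case .
    qed
    define r where "r = c4 * \<sigma> * sqrt k"
    have r: "R0 * \<sigma> \<le> r" "0 < r"
    proof -
      have "R0 / c4 \<le> sqrt k" using k1(2) by (simp add: real_le_rsqrt)
      then have "R0 \<le> c4 * sqrt k" using c4 by (simp add: field_simps)
      then show "R0 * \<sigma> \<le> r" using \<sigma> unfolding r_def by (simp add: mult_right_mono mult_ac)
      then show "0 < r" using R\<sigma> by linarith
    qed
    \<comment> \<open>Markov's inequality: in the cone, at distance at least \<open>r\<close>, the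
      value of \<open>h\<close> is at least \<open>c1 * r powr p\<close>, and
      \<open>(\<sigma> / r) powr p\<close> is a constant times
      \<open>k powr (- p / 2)\<close>.\<close>
    have far: "emeasure M {\<omega>\<in>space M. A j \<omega> \<and> r \<le> norm (S j \<omega>)} \<le> ennreal (C * (1 + ln J) * real k powr (- p / 2))"
      if j: "1 \<le> j" "j \<le> J" for j
    proof -
      have [measurable]: "S j \<in> borel_measurable M" using j by (auto intro!: S_meas)
      have [measurable]: "Measurable.pred M (A j)" using j by (intro A_meas) simp
      have pos: "0 < c1 * r powr p" using c1 r by simp
      have "ennreal (c1 * r powr p) * emeasure M {\<omega>\<in>space M. A j \<omega> \<and> r \<le> norm (S j \<omega>)}
        = (\<integral>\<^sup>+\<omega>. ennreal (c1 * r powr p) * indicator {\<omega>\<in>space M. A j \<omega> \<and> r \<le> norm (S j \<omega>)} \<omega> \<partial>M)"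
        by (rule nn_integral_cmult_indicator[symmetric]) measurable
      also have "\<dots> \<le> mm j"
        unfolding mm_def
      proof (intro nn_integral_mono)
        fix \<omega> assume \<omega>: "\<omega> \<in> space M"
        show "ennreal (c1 * r powr p) * indicator {\<omega>\<in>space M. A j \<omega> \<and> r \<le> norm (S j \<omega>)} \<omega> \<le> (if A j \<omega> then H (S j \<omega>) else 0)"
        proof (cases "A j \<omega> \<and> r \<le> norm (S j \<omega>)")
          case True
          then have "S j \<omega> \<in> G" using j by (auto simp: A_def)
          then have K: "S j \<omega> \<in> K" using True r by (auto simp: G_def)
          have nz: "S j \<omega> \<noteq> 0" using True r by auto
          have "c1 * r powr p \<le> c1 * norm (S j \<omega>) powr p"
            using c1 r p True by (intro mult_left_mono powr_mono2) auto
          also have "\<dots> \<le> h (S j \<omega>)" using h_lo K nz by (simp add: K_def)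
          finally have "ennreal (c1 * r powr p) \<le> H (S j \<omega>)"
            using K nz True r by (simp add: H_def H'_def ennreal_leI)
          then show ?thesis using True \<omega> by simp
        qed auto
      qed
      also have "\<dots> \<le> ennreal (C2 * \<sigma> powr p * (1 + 2 * C5 * ln j))"
        using mm_bound[of "j - 1"] j by simp
      also have "\<dots> \<le> ennreal ((c1 * r powr p) * (C * (1 + ln J) * real k powr (- p / 2)))"
      proof (rule ennreal_leI)
        have ln: "0 \<le> ln (real j)" "ln (real j) \<le> ln (real J)" using j by auto
        have "1 + 2 * C5 * ln j \<le> (1 + 2 * C5) * (1 + ln J)"
        proof -
          have "2 * C5 * ln j \<le> 2 * C5 * ln J" using C5 ln by (intro mult_left_mono) auto
          moreover have "0 \<le> ln J" using ln by linarith
          moreover have "(1 + 2 * C5) * (1 + ln J) = 1 + ln J + 2 * C5 + 2 * C5 * ln J" by (simp add: algebra_simps)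
          ultimately show ?thesis using C5 by linarith
        qed
        then have "C2 * \<sigma> powr p * (1 + 2 * C5 * ln j) \<le> C2 * \<sigma> powr p * ((1 + 2 * C5) * (1 + ln J))"
          using C2 by (intro mult_left_mono) auto
        also have "\<dots> = (c1 * r powr p) * (C * (1 + ln J) * real k powr (- p / 2))"
        proof -
          have "sqrt k = real k powr (1/2)" using k1 by (simp add: powr_half_sqrt)
          then have "r powr p = c4 powr p * \<sigma> powr p * real k powr (p / 2)"
            using c4 \<sigma> k1 by (simp add: r_def powr_mult powr_powr)
          moreover have "real k powr (p / 2) * real k powr (- p / 2) = 1"
            using k1 by (simp add: powr_add[symmetric])
          ultimately have "r powr p * real k powr (- p / 2) = c4 powr p * \<sigma> powr p" by simp
          moreover have "(c1 * r powr p) * (C * (1 + ln J) * real k powr (- p / 2)) = c1 * C * (1 + ln J) * (r powr p * real k powr (- p / 2))"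
            by (simp only: mult_ac)
          moreover have "c1 * C * c4 powr p = C2 * (1 + 2 * C5)" using c1 c4 by (simp add: C_def)
          ultimately show ?thesis by (simp add: mult_ac)
        qed
        finally show "C2 * \<sigma> powr p * (1 + 2 * C5 * ln j) \<le> (c1 * r powr p) * (C * (1 + ln J) * real k powr (- p / 2))" .
      qed
      also have "\<dots> = ennreal (c1 * r powr p) * ennreal (C * (1 + ln J) * real k powr (- p / 2))"
        using pos by (subst ennreal_mult') auto
      finally show ?thesis using pos by (subst (asm) ennreal_mult_le_mult_iff) (auto simp: ennreal_eq_0_iff)
    qed
    \<comment> \<open>Increments over whole blocks. If the walk is closer than \<open>r\<close> to
      the apex at the end of each block, all of them are shorter than \<open>2 * r\<close>, which by
      independence has probability at most \<open>(1 / 2) ^ m\<close>.\<close>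
    define Z where "Z = (\<lambda>i \<omega>. B (t - real (m - Suc i) * (real k * \<sigma>\<^sup>2)) \<omega> - B (t - real (m - i) * (real k * \<sigma>\<^sup>2)) \<omega>)"
    have ks: "0 < real k * \<sigma>\<^sup>2" using k1 \<sigma> by simp
    have mk: "real m * (real k * \<sigma>\<^sup>2) \<le> t" using t by (simp add: mult.assoc)
    have Zind: "indep_vars (\<lambda>_. borel) Z {..<m}" unfolding Z_def by (rule back_walk_indep(1)[OF ks mk])
    have Zdist: "distr M borel (Z i) = gauss (sqrt k * \<sigma>)" if "i < m" for i
    proof -
      have "m - Suc (m - Suc i) = i" using that by simp
      then show ?thesis
        using back_walk_indep(2)[OF ks mk, of "m - Suc i"] that \<sigma> by (simp add: Z_def real_sqrt_mult)
    qed
    have Zrv: "Z i \<in> borel_measurable M" if "i < m" for i using Zind that by (auto simp: indep_vars_def)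
    have ZS: "Z i \<omega> = S ((m - i) * k) \<omega> - S ((m - Suc i) * k) \<omega>" for i \<omega>
      by (simp add: Z_def S_def back_walk_def mult_ac)
    have Zp: "prob (Z i -` ball 0 (2 * r) \<inter> space M) \<le> 1 / 2" if i: "i < m" for i
    proof -
      have "emeasure M (Z i -` ball 0 (2 * r) \<inter> space M) = emeasure (distr M borel (Z i)) (ball 0 (2 * r))"
        using Zrv[OF i] by (simp add: emeasure_distr)
      also have "\<dots> \<le> ennreal (Cb * (2 * r / (sqrt k * \<sigma>)) ^ DIM('a))"
        unfolding Zdist[OF i] by (rule Cb(2)) (use k1 \<sigma> r in auto)
      also have "\<dots> \<le> ennreal (1 / 2)"
      proof (rule ennreal_leI)
        have "2 * r / (sqrt k * \<sigma>) = 2 * c4" using k1 \<sigma> by (simp add: r_def)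
        then have "(2 * r / (sqrt k * \<sigma>)) ^ DIM('a) \<le> (2 * c4) ^ 1"
          using c4 dim by (simp only:) (intro power_decreasing; simp)
        then have "Cb * (2 * r / (sqrt k * \<sigma>)) ^ DIM('a) \<le> Cb * (2 * c4)" using Cb(1) by simp
        also have "\<dots> \<le> Cb * (2 * (1 / (4 * Cb)))" using c4 Cb(1) by (intro mult_left_mono) auto
        also have "\<dots> = 1 / 2" using Cb(1) by simp
        finally show "Cb * (2 * r / (sqrt k * \<sigma>)) ^ DIM('a) \<le> 1 / 2" .
      qed
      finally show ?thesis unfolding emeasure_eq_measure by (subst (asm) ennreal_le_iff) simp_all
    qed
    define E where "E = (\<Inter>i\<in>{..<m}. Z i -` ball 0 (2 * r) \<inter> space M)"
    have E_sets: "E \<in> sets M" unfolding E_def using m Zrv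
      by (intro sets.finite_INT) (auto intro!: measurable_sets simp: lessThan_empty_iff)
    have "prob E = (\<Prod>i\<in>{..<m}. prob (Z i -` ball 0 (2 * r) \<inter> space M))"
      unfolding E_def using m by (intro indep_varsD_finite[OF Zind]) (auto simp: lessThan_empty_iff)
    also have "\<dots> \<le> (\<Prod>i\<in>{..<m}. 1 / 2)" using Zp by (intro prod_mono) auto
    finally have E: "emeasure M E \<le> ennreal ((1 / 2) ^ m)" by (simp add: emeasure_eq_measure ennreal_leI)
    define F where "F = (\<lambda>i. {\<omega>\<in>space M. A (i * k) \<omega> \<and> r \<le> norm (S (i * k) \<omega>)})"
    have ik: "i * k \<le> J" "1 \<le> i * k" if "i \<in> {1..m}" for i
      using that k1 by (auto simp: J_def Suc_le_eq)
    have F_sets: "F i \<in> sets M" if "i \<in> {1..m}" for i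
    proof -
      have [measurable]: "S (i * k) \<in> borel_measurable M" using ik[OF that] by (auto intro!: S_meas)
      have [measurable]: "Measurable.pred M (A (i * k))" using ik[OF that] by (intro A_meas) simp
      show ?thesis unfolding F_def by measurable
    qed
    have sub: "{\<omega>\<in>space M. A J \<omega>} \<subseteq> E \<union> (\<Union>i\<in>{1..m}. F i)"
    proof
      fix \<omega> assume \<omega>: "\<omega> \<in> {\<omega>\<in>space M. A J \<omega>}"
      show "\<omega> \<in> E \<union> (\<Union>i\<in>{1..m}. F i)"
      proof (rule ccontr)
        assume n: "\<omega> \<notin> E \<union> (\<Union>i\<in>{1..m}. F i)"
        have small_i: "norm (S (i * k) \<omega>) < r" if "i \<le> m" for i
        proof (cases "i = 0")
          case True
          then show ?thesis using r by (simp add: S0)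
        next
          case False
          then have i: "i \<in> {1..m}" using that by auto
          have "A (i * k) \<omega>" using \<omega> ik[OF i] by (auto simp: A_def)
          then show ?thesis using n i \<omega> by (auto simp: F_def not_le)
        qed
        have "norm (Z i \<omega>) < 2 * r" if "i < m" for i
          using norm_triangle_ineq4[of "S ((m - i) * k) \<omega>" "S ((m - Suc i) * k) \<omega>"]
            small_i[of "m - i"] small_i[of "m - Suc i"] by (simp add: ZS)
        then have "\<omega> \<in> E" using \<omega> m by (auto simp: E_def)
        then show False using n by simp
      qed
    qed
    have "emeasure M {\<omega>\<in>space M. A J \<omega>} \<le> emeasure M (E \<union> (\<Union>i\<in>{1..m}. F i))"
      using sub E_sets F_sets by (intro emeasure_mono) auto
    also have "\<dots> \<le> emeasure M E + emeasure M (\<Union>i\<in>{1..m}. F i)"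
      using E_sets F_sets by (intro emeasure_subadditive) auto
    also have "\<dots> \<le> ennreal ((1 / 2) ^ m) + (\<Sum>i\<in>{1..m}. emeasure M (F i))"
      using F_sets by (intro add_mono E emeasure_subadditive_finite) auto
    also have "\<dots> \<le> ennreal ((1 / 2) ^ m) + (\<Sum>i\<in>{1..m}. ennreal (C * (1 + ln J) * real k powr (- p / 2)))"
      unfolding F_def using ik by (intro add_left_mono sum_mono far) auto
    also have "\<dots> = ennreal ((1 / 2) ^ m + C * m * (1 + ln (m * k)) * real k powr (- p / 2))"
    proof -
      have "1 \<le> J" using ik(1)[of m] ik(2)[of m] m by (meson atLeastAtMost_iff order_refl order_trans)
      then have nn: "0 \<le> C * (1 + ln J) * real k powr (- p / 2)" using C by (intro mult_nonneg_nonneg add_nonneg_nonneg) auto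
      have "(\<Sum>i\<in>{1..m}. ennreal (C * (1 + ln J) * real k powr (- p / 2))) = ennreal (\<Sum>i\<in>{1..m}. C * (1 + ln J) * real k powr (- p / 2))"
        using nn by (intro sum_ennreal) auto
      also have "(\<Sum>i\<in>{1..m}. C * (1 + ln J) * real k powr (- p / 2)) = C * m * (1 + ln (m * k)) * real k powr (- p / 2)"
        by (simp add: J_def mult_ac)
      finally have e: "(\<Sum>i\<in>{1..m}. ennreal (C * (1 + ln J) * real k powr (- p / 2))) = ennreal (C * m * (1 + ln (m * k)) * real k powr (- p / 2))" .
      have "0 \<le> real m * (C * (1 + ln J) * real k powr (- p / 2))" by (rule mult_nonneg_nonneg[OF of_nat_0_le_iff nn])
      also have "\<dots> = C * m * (1 + ln (m * k)) * real k powr (- p / 2)" by (simp add: J_def mult_ac)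
      finally show ?thesis unfolding e by (subst ennreal_plus) auto
    qed
    finally show ?thesis unfolding A_def S_def G_def J_def of_nat_mult .
  qed
  show ?thesis
    by (rule that[OF _ \<epsilon> p C]) (use main in \<open>simp add: K_def\<close>)
qed

end

section \<open>Dyadic oscillation of Brownian paths\<close>

lemma square_times_power_tendsto_0:
  fixes r :: real
  assumes "0 < r" "r < 1"
  shows "(\<lambda>m. (real m)\<^sup>2 * r ^ m) \<longlonglongrightarrow> 0"
proof -
  define s where "s = sqrt r"
  have s: "0 < s" "s < 1" "s\<^sup>2 = r" using assms by (auto simp: s_def)
  have "(\<lambda>m. real m * s ^ m) \<longlonglongrightarrow> 0" using powser_times_n_limit_0[of s] s by simp
  from tendsto_power[OF this, of 2] show ?thesis
    by (simp add: power_mult_distrib s(3)[symmetric] power_mult[symmetric] mult.commute)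
qed

lemma floor_dyadic_Suc:
  fixes t :: real
  assumes "0 \<le> t"
  obtains "nat \<lfloor>t * 2 ^ Suc j\<rfloor> = 2 * nat \<lfloor>t * 2 ^ j\<rfloor>" | "nat \<lfloor>t * 2 ^ Suc j\<rfloor> = Suc (2 * nat \<lfloor>t * 2 ^ j\<rfloor>)"
proof -
  have "\<lfloor>t * 2 ^ Suc j\<rfloor> = 2 * \<lfloor>t * 2 ^ j\<rfloor> \<or> \<lfloor>t * 2 ^ Suc j\<rfloor> = 2 * \<lfloor>t * 2 ^ j\<rfloor> + 1"
    by (simp add: floor_eq_iff) linarith
  moreover have "0 \<le> \<lfloor>t * 2 ^ j\<rfloor>" using assms by simp
  ultimately show ?thesis using that by linarith
qed

definition dyadic_floor :: "nat \<Rightarrow> real \<Rightarrow> real" where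
  "dyadic_floor m t = real (nat \<lfloor>t * 2 ^ m\<rfloor>) / 2 ^ m"

lemma dyadic_floor_bounds:
  assumes "0 \<le> t"
  shows "0 \<le> dyadic_floor m t" "dyadic_floor m t \<le> t" "t < dyadic_floor m t + 1 / 2 ^ m"
proof -
  have "0 \<le> t * 2 ^ m" using assms by simp
  then have e: "real (nat \<lfloor>t * 2 ^ m\<rfloor>) = of_int \<lfloor>t * 2 ^ m\<rfloor>" by simp
  show "0 \<le> dyadic_floor m t" by (simp add: dyadic_floor_def)
  show "dyadic_floor m t \<le> t" unfolding dyadic_floor_def e by (simp add: divide_le_eq)
  show "t < dyadic_floor m t + 1 / 2 ^ m"
    unfolding dyadic_floor_def e by (simp add: add_divide_distrib[symmetric] less_divide_eq)
qed

lemma dyadic_floor_tendsto: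
  assumes "0 \<le> t"
  shows "(\<lambda>j. dyadic_floor j t) \<longlonglongrightarrow> t"
proof (rule real_tendsto_sandwich)
  show "\<forall>\<^sub>F j in sequentially. t - (1 / 2) ^ j \<le> dyadic_floor j t"
    using dyadic_floor_bounds(3)[OF assms] by (intro always_eventually allI) (simp add: power_one_over less_imp_le diff_le_eq)
  show "\<forall>\<^sub>F j in sequentially. dyadic_floor j t \<le> t"
    using dyadic_floor_bounds(2)[OF assms] by (intro always_eventually allI)
  have "(\<lambda>j. t - (1 / 2) ^ j) \<longlonglongrightarrow> t - 0" by (intro tendsto_intros LIMSEQ_realpow_zero) auto
  then show "(\<lambda>j. t - (1 / 2) ^ j) \<longlonglongrightarrow> t" by simp
qed simp

context brownian_motion
begin

lemma increment_tail:
  obtains C where "0 < C" "\<And>s t x. 0 \<le> s \<Longrightarrow> s < t \<Longrightarrow> 0 < x \<Longrightarrow>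
    prob {\<omega>\<in>space M. x < norm (B t \<omega> - B s \<omega>)} \<le> C * (t - s) ^ n / x ^ (2 * n)"
proof -
  obtain C where C: "C > 0" "\<And>\<sigma>. \<sigma> > 0 \<Longrightarrow>
     integrable (gauss \<sigma>) (\<lambda>z::'a. norm z ^ (2*n)) \<and>
     (\<integral>z. norm z ^ (2*n) \<partial>(gauss \<sigma> :: 'a measure)) \<le> C * \<sigma> ^ (2*n)"
    by (rule gauss_norm_moment[where k=n and 'a='a]) (rule that, assumption, blast)
  show ?thesis
  proof (rule that[OF C(1)])
    fix s t x :: real assume st: "0 \<le> s" "s < t" and x: "0 < x"
    have [measurable]: "B t \<in> borel_measurable M" "B s \<in> borel_measurable M" using st by (auto intro!: measurable_B)
    define \<sigma> where "\<sigma> = sqrt (t - s)"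
    have \<sigma>: "0 < \<sigma>" "\<sigma> ^ (2 * n) = (t - s) ^ n" using st by (auto simp: \<sigma>_def power_mult)
    have d: "distr M borel (\<lambda>\<omega>. B t \<omega> - B s \<omega>) = gauss \<sigma>" unfolding \<sigma>_def by (rule distr_increment[OF st])
    have i: "integrable M (\<lambda>\<omega>. norm (B t \<omega> - B s \<omega>) ^ (2 * n))"
      using C(2)[OF \<sigma>(1)] integrable_distr_eq[of "\<lambda>\<omega>. B t \<omega> - B s \<omega>" M borel "\<lambda>z. norm z ^ (2 * n)"] by (simp add: d)
    have e: "expectation (\<lambda>\<omega>. norm (B t \<omega> - B s \<omega>) ^ (2 * n)) = (\<integral>z. norm z ^ (2*n) \<partial>(gauss \<sigma> :: 'a measure))"
      using integral_distr[of "\<lambda>\<omega>. B t \<omega> - B s \<omega>" M borel "\<lambda>z. norm z ^ (2 * n)"] by (simp add: d)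
    have "prob {\<omega>\<in>space M. x < norm (B t \<omega> - B s \<omega>)} \<le> prob {\<omega>\<in>space M. x ^ (2 * n) \<le> norm (B t \<omega> - B s \<omega>) ^ (2 * n)}"
      using x by (intro finite_measure_mono) (auto intro!: power_mono)
    also have "\<dots> \<le> expectation (\<lambda>\<omega>. norm (B t \<omega> - B s \<omega>) ^ (2 * n)) / x ^ (2 * n)"
      by (rule integral_Markov_inequality_measure[OF i, of "{}"]) (use x in auto)
    also have "\<dots> \<le> C * (t - s) ^ n / x ^ (2 * n)"
      using C(2)[OF \<sigma>(1)] x unfolding e \<sigma>(2) by (intro divide_right_mono) auto
    finally show "prob {\<omega>\<in>space M. x < norm (B t \<omega> - B s \<omega>)} \<le> C * (t - s) ^ n / x ^ (2 * n)" .
  qed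
qed

text \<open>Chaining: high moments and Borel-Cantelli bound the increments between neighbouring
  dyadic points from some level on, the bounds along the dyadic approximations of \<open>t\<close>
  form a geometric series, and continuity of the path passes to the limit. The exponent
  \<open>\<kappa> / 2\<close> can be taken arbitrarily close to 1/2.\<close>

lemma dyadic_oscillation:
  fixes \<kappa> :: real and N :: nat
  assumes \<kappa>: "0 < \<kappa>" "\<kappa> < 1"
  shows "AE \<omega> in M. \<forall>\<^sub>F m in sequentially. \<forall>t::real. 0 \<le> t \<and> t < real N \<longrightarrow>
    norm (B t \<omega> - B (dyadic_floor m t) \<omega>) \<le> 1 / (1 - 2 powr (- \<kappa> / 2)) * (2 powr (- \<kappa> / 2)) ^ m"
proof -
  define \<rho> :: real where "\<rho> = 2 powr (- \<kappa> / 2)"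
  have \<rho>: "0 < \<rho>" "\<rho> < 1" using \<kappa> powr_less_mono[of "- \<kappa> / 2" 0 2] by (auto simp: \<rho>_def)
  \<comment> \<open>The tail bound for one increment is a constant times
    \<open>2 powr (- (n * (1 - \<kappa>)))\<close> to the power \<open>m\<close>. This
    \<open>n\<close> makes it at most \<open>(1 / 4) ^ m\<close>, still summable after
    multiplication by the \<open>N * 2 ^ m\<close> intervals.\<close>
  define n where "n = nat \<lceil>2 / (1 - \<kappa>)\<rceil>"
  have n: "2 \<le> real n * (1 - \<kappa>)"
  proof -
    have "2 / (1 - \<kappa>) \<le> real n" unfolding n_def by linarith
    then show ?thesis using \<kappa> by (simp add: divide_le_eq)
  qed
  obtain C where C: "0 < C" "\<And>s t x. 0 \<le> s \<Longrightarrow> s < t \<Longrightarrow> 0 < x \<Longrightarrow>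
    prob {\<omega>\<in>space M. x < norm (B t \<omega> - B s \<omega>)} \<le> C * (t - s) ^ n / x ^ (2 * n)"
    by (rule increment_tail[of n]) (rule that, assumption, blast)
  define E where "E = (\<lambda>m i. {\<omega>\<in>space M. \<rho> ^ m < norm (B (real (Suc i) / 2 ^ m) \<omega> - B (real i / 2 ^ m) \<omega>)})"
  define F where "F = (\<lambda>m. \<Union>i\<in>{..<N * 2 ^ m}. E m i)"
  have E_sets [measurable]: "E m i \<in> sets M" for m i
  proof -
    have [measurable]: "B (real (Suc i) / 2 ^ m) \<in> borel_measurable M" "B (real i / 2 ^ m) \<in> borel_measurable M"
      by (auto intro!: measurable_B)
    show ?thesis unfolding E_def by measurable
  qed
  have E_prob: "prob (E m i) \<le> C * (1 / 4) ^ m" for m i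
  proof -
    have "prob (E m i) \<le> C * (real (Suc i) / 2 ^ m - real i / 2 ^ m) ^ n / (\<rho> ^ m) ^ (2 * n)"
      unfolding E_def by (rule C(2)) (use \<rho> in \<open>auto simp: divide_strict_right_mono\<close>)
    also have "real (Suc i) / 2 ^ m - real i / 2 ^ m = 1 / 2 ^ m" by (simp add: add_divide_distrib)
    also have "(1 / 2 ^ m :: real) ^ n = (2 powr (- real n)) ^ m"
      by (simp add: powr_minus powr_realpow power_one_over inverse_eq_divide power_mult[symmetric] mult.commute)
    also have "(\<rho> ^ m) ^ (2 * n) = (2 powr (- \<kappa> * real n)) ^ m"
    proof -
      have "\<rho> ^ (2 * n) = 2 powr (- \<kappa> * real n)" unfolding \<rho>_def by (simp add: powr_power mult.commute)
      then show ?thesis by (metis mult.commute power_mult)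
    qed
    also have "C * (2 powr (- real n)) ^ m / (2 powr (- \<kappa> * real n)) ^ m = C * (2 powr (- real n) / 2 powr (- \<kappa> * real n)) ^ m"
      by (simp add: power_divide)
    also have "2 powr (- real n) / 2 powr (- \<kappa> * real n) = 2 powr (- (real n * (1 - \<kappa>)))"
      by (simp add: powr_diff[symmetric] algebra_simps)
    also have "C * (2 powr (- (real n * (1 - \<kappa>)))) ^ m \<le> C * (1 / 4) ^ m"
    proof (intro mult_left_mono power_mono)
      have "2 powr (- (real n * (1 - \<kappa>))) \<le> (2::real) powr (-2)" using n by (intro powr_mono) auto
      also have "(2::real) powr (-2) = 1 / 4" by (simp add: powr_minus)
      finally show "2 powr (- (real n * (1 - \<kappa>))) \<le> (1 / 4 :: real)" .
    qed (use C in auto)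
    finally show ?thesis .
  qed
  have F_prob: "prob (F m) \<le> N * C * (1 / 2) ^ m" for m
  proof -
    have "prob (F m) \<le> (\<Sum>i\<in>{..<N * 2 ^ m}. prob (E m i))"
      unfolding F_def by (intro finite_measure_subadditive_finite) auto
    also have "\<dots> \<le> (\<Sum>i\<in>{..<N * 2 ^ m}. C * (1 / 4) ^ m)" by (intro sum_mono E_prob)
    also have "\<dots> = N * C * (2 ^ m * (1 / 4) ^ m)" by simp
    also have "(2 ^ m * (1 / 4) ^ m :: real) = (1 / 2) ^ m" by (simp add: power_mult_distrib[symmetric])
    finally show ?thesis .
  qed
  have ev: "AE \<omega> in M. \<forall>\<^sub>F m in sequentially. \<omega> \<in> space M - F m"
  proof (rule borel_cantelli_AE1)
    show "F m \<in> sets M" for m unfolding F_def by auto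
    show "emeasure M (F m) < \<infinity>" for m by (simp add: less_top[symmetric])
    show "summable (\<lambda>m. measure M (F m))"
    proof (rule summable_comparison_test')
      show "summable (\<lambda>m. N * C * (1 / 2) ^ m)" by (intro summable_mult summable_geometric) auto
      show "norm (measure M (F m)) \<le> N * C * (1 / 2) ^ m" for m using F_prob[of m] by simp
    qed
  qed
  show ?thesis using ev continuous_B
  proof eventually_elim
    case (elim \<omega>)
    obtain m0 where m0: "\<And>m. m \<ge> m0 \<Longrightarrow> \<omega> \<in> space M - F m"
      using elim(1) unfolding eventually_sequentially by blast
    have bound: "norm (B t \<omega> - B (dyadic_floor m t) \<omega>) \<le> 1 / (1 - \<rho>) * \<rho> ^ m"
      if m: "m0 \<le> m" and t: "0 \<le> t" "t < real N" for m and t :: real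
    proof -
      have step: "norm (B (dyadic_floor (Suc j) t) \<omega> - B (dyadic_floor j t) \<omega>) \<le> \<rho> ^ j" if "m \<le> j" for j
        using floor_dyadic_Suc[OF t(1), of j]
      proof cases
        case 1
        then have "dyadic_floor (Suc j) t = dyadic_floor j t" unfolding dyadic_floor_def 1 by simp
        then show ?thesis using \<rho> by simp
      next
        case 2
        define i where "i = 2 * nat \<lfloor>t * 2 ^ j\<rfloor>"
        have e: "dyadic_floor (Suc j) t = real (Suc i) / 2 ^ Suc j" "dyadic_floor j t = real i / 2 ^ Suc j"
          unfolding dyadic_floor_def 2 i_def by simp_all
        have "real (Suc i) \<le> t * 2 ^ Suc j"
          using dyadic_floor_bounds(2)[OF t(1), of "Suc j"] unfolding e by (simp add: divide_le_eq del: of_nat_Suc power_Suc)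
        also have "\<dots> < real N * 2 ^ Suc j" using t(2) by (intro mult_strict_right_mono) auto
        finally have "real (Suc i) < real (N * 2 ^ Suc j)" by (simp only: of_nat_mult of_nat_power of_nat_numeral)
        then have "i < N * 2 ^ Suc j" by linarith
        moreover have "\<omega> \<in> space M - F (Suc j)" using m0 m that by simp
        ultimately have "norm (B (real (Suc i) / 2 ^ Suc j) \<omega> - B (real i / 2 ^ Suc j) \<omega>) \<le> \<rho> ^ Suc j"
          by (auto simp: F_def E_def not_less simp del: power_Suc of_nat_Suc)
        also have "\<dots> \<le> \<rho> ^ j" using \<rho> by (intro power_decreasing) auto
        finally show ?thesis unfolding e .
      qed
      have tele: "norm (B (dyadic_floor (m + l) t) \<omega> - B (dyadic_floor m t) \<omega>) \<le> 1 / (1 - \<rho>) * (\<rho> ^ m - \<rho> ^ (m + l))" for l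
      proof (induction l)
        case (Suc l)
        have "norm (B (dyadic_floor (m + Suc l) t) \<omega> - B (dyadic_floor m t) \<omega>)
          \<le> norm (B (dyadic_floor (Suc (m + l)) t) \<omega> - B (dyadic_floor (m + l) t) \<omega>)
            + norm (B (dyadic_floor (m + l) t) \<omega> - B (dyadic_floor m t) \<omega>)"
          using norm_triangle_ineq[of "B (dyadic_floor (Suc (m + l)) t) \<omega> - B (dyadic_floor (m + l) t) \<omega>"
              "B (dyadic_floor (m + l) t) \<omega> - B (dyadic_floor m t) \<omega>"] by simp
        also have "\<dots> \<le> \<rho> ^ (m + l) + 1 / (1 - \<rho>) * (\<rho> ^ m - \<rho> ^ (m + l))"
          by (intro add_mono step Suc) simp
        also have "\<dots> = 1 / (1 - \<rho>) * (\<rho> ^ m - \<rho> ^ (m + Suc l))"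
        proof -
          have "\<rho> ^ (m + l) = 1 / (1 - \<rho>) * (\<rho> ^ (m + l) - \<rho> ^ (m + Suc l))"
            using \<rho> by (simp add: field_simps)
          then show ?thesis by (simp add: right_diff_distrib)
        qed
        finally show ?case .
      qed simp
      have "(\<lambda>l. dyadic_floor (m + l) t) \<longlonglongrightarrow> t"
        using LIMSEQ_ignore_initial_segment[OF dyadic_floor_tendsto[OF t(1)], of m] by (simp add: add.commute)
      then have "(\<lambda>l. B (dyadic_floor (m + l) t) \<omega>) \<longlonglongrightarrow> B t \<omega>"
        using elim(2) t dyadic_floor_bounds(1)[OF t(1)]
        by (intro continuous_on_tendsto_compose[OF elim(2)]) auto
      then have "(\<lambda>l. norm (B (dyadic_floor (m + l) t) \<omega> - B (dyadic_floor m t) \<omega>)) \<longlonglongrightarrow> norm (B t \<omega> - B (dyadic_floor m t) \<omega>)"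
        by (intro tendsto_intros)
      moreover have "norm (B (dyadic_floor (m + l) t) \<omega> - B (dyadic_floor m t) \<omega>) \<le> 1 / (1 - \<rho>) * \<rho> ^ m" for l
      proof -
        have "1 / (1 - \<rho>) * (\<rho> ^ m - \<rho> ^ (m + l)) \<le> 1 / (1 - \<rho>) * \<rho> ^ m"
          using \<rho> by (intro mult_left_mono) auto
        then show ?thesis using tele[of l] by linarith
      qed
      ultimately show ?thesis by (intro LIMSEQ_le_const2) auto
    qed
    then show ?case unfolding \<rho>_def[symmetric] eventually_sequentially by blast
  qed
qed

end

section \<open>Covering the backward cone times\<close>

text \<open>At distance at least \<open>4 * \<sigma> / \<epsilon>\<close> from the apex, a shift by
  \<open>\<sigma>\<close> is small compared with the width gained by doubling the slack. Closer
  points are taken care of by the ball in \<open>cone_survival\<close>.\<close>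

lemma wide_cone_perturb_far:
  fixes v q :: "'a::euclidean_space"
  assumes "norm a = 1" "norm b = 1" "0 < \<epsilon>" "\<epsilon> \<le> 1" "4 / \<epsilon> \<le> R0" "v \<in> wide_cone a b (\<epsilon> / 2)"
    "norm q \<le> \<sigma>" "R0 * \<sigma> \<le> norm (v + q)" "0 < \<sigma>"
  shows "v + q \<in> wide_cone a b \<epsilon>"
proof -
  have "4 / \<epsilon> * \<sigma> \<le> R0 * \<sigma>" using assms by (intro mult_right_mono) auto
  then have "4 / \<epsilon> * \<sigma> \<le> norm (v + q)" using assms(8) by linarith
  then have "\<epsilon> * (4 / \<epsilon> * \<sigma>) \<le> \<epsilon> * norm (v + q)" using assms(3) by (intro mult_left_mono) auto
  then have far: "4 * \<sigma> \<le> \<epsilon> * norm (v + q)" using assms(3) by simp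
  have "norm v \<le> norm (v + q) + \<sigma>" using norm_triangle_ineq4[of "v + q" q] assms(7) by simp
  then have "\<epsilon> / 2 * norm v \<le> \<epsilon> / 2 * (norm (v + q) + \<sigma>)" using assms(3) by (intro mult_left_mono) auto
  also have "\<dots> = \<epsilon> * norm (v + q) / 2 + \<epsilon> * \<sigma> / 2" by (simp add: field_simps)
  also have "\<epsilon> * \<sigma> \<le> 1 * \<sigma>" using assms by (intro mult_right_mono) auto
  finally have v: "\<epsilon> / 2 * norm v \<le> \<epsilon> * norm (v + q) / 2 + \<sigma> / 2" by simp
  have "- \<epsilon> * norm (v + q) \<le> c \<bullet> (v + q)" if "norm c = 1" "- (\<epsilon> / 2) * norm v \<le> c \<bullet> v" for c
  proof -
    have "- \<sigma> \<le> c \<bullet> q" using Cauchy_Schwarz_ineq2[of c q] that(1) assms(7) by simp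
    then show ?thesis using that(2) v far assms(9) unfolding inner_add_right by linarith
  qed
  then show ?thesis using assms(1,2,6) by (simp add: wide_cone_def)
qed

lemma wide_cone_uminus: "- v \<in> wide_cone (- a) (- b) \<epsilon> \<longleftrightarrow> v \<in> wide_cone a b \<epsilon>"
  by (auto simp: wide_cone_def)

lemma nat_floor_ge_half:
  assumes "1 \<le> (x::real)"
  shows "x / 2 \<le> real (nat \<lfloor>x\<rfloor>)" "real (nat \<lfloor>x\<rfloor>) \<le> x" "1 \<le> nat \<lfloor>x\<rfloor>"
proof -
  have 1: "1 \<le> \<lfloor>x\<rfloor>" using assms by simp
  then have e: "real (nat \<lfloor>x\<rfloor>) = of_int \<lfloor>x\<rfloor>" by simp
  have "(1::real) \<le> of_int \<lfloor>x\<rfloor>" using 1 by linarith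
  moreover have "x < of_int \<lfloor>x\<rfloor> + 1" by linarith
  ultimately show "x / 2 \<le> real (nat \<lfloor>x\<rfloor>)" unfolding e by linarith
  show "real (nat \<lfloor>x\<rfloor>) \<le> x" unfolding e by linarith
  show "1 \<le> nat \<lfloor>x\<rfloor>" using 1 by linarith
qed

text \<open>A property of a single path, so that the analysis of local times needs no probability.
  \<open>I\<close> contains the index of every dyadic interval with a cone time,
  \<open>\<sigma>\<close> bounds the displacement since the left end of the interval, and a multiple
  of \<open>\<sigma> * card I\<close> will bound the local time charged. The level \<open>m\<close>
  may depend on \<open>e\<close> and on the path.\<close>

definition cone_times_coverable :: "(real \<Rightarrow> 'a::euclidean_space) \<Rightarrow> 'a \<Rightarrow> 'a \<Rightarrow> real \<Rightarrow> real \<Rightarrow> nat \<Rightarrow> bool" where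
  "cone_times_coverable w a b \<epsilon> \<delta> N \<longleftrightarrow> (\<forall>e>0. \<exists>m \<sigma> I. 0 < \<sigma> \<and> finite I \<and>
    \<sigma> * real (card I) \<le> e \<and> 1 / 2 ^ m \<le> \<delta> \<and>
    (\<forall>t. 2 * \<delta> \<le> t \<longrightarrow> t < real N \<longrightarrow> (\<forall>s\<in>{t - 2 * \<delta>..t}. w s - w t \<in> wide_cone a b \<epsilon>) \<longrightarrow>
      nat \<lfloor>t * 2 ^ m\<rfloor> \<in> I \<and> norm (w t - w (dyadic_floor m t)) \<le> \<sigma>))"

context brownian_motion
begin

text \<open>The mean of \<open>\<sigma> * card I\<close> tends to 0: the \<open>2 ^ m\<close>
  intervals, the scale \<open>2 powr (- \<kappa> * m / 2)\<close> and the survival probability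
  \<open>2 powr (- \<kappa> * m * p / 2)\<close> multiply to
  \<open>2 powr ((1 - \<kappa> * (1 + p) / 2) * m)\<close>, up to constants and powers of
  \<open>m\<close>, and p > 1 makes this decay for some \<kappa> < 1.\<close>

lemma cone_times_cover:
  fixes a b :: 'a
  assumes dim: "DIM('a) \<ge> 2" and ab: "norm a = 1" "norm b = 1" "a \<noteq> b"
  obtains \<epsilon> :: real where "0 < \<epsilon>"
    "\<And>\<delta> N. 0 < \<delta> \<Longrightarrow> AE \<omega> in M. cone_times_coverable (\<lambda>t. B t \<omega>) a b \<epsilon> \<delta> N"
proof -
  \<comment> \<open>\<open>back_walk\<close> records the present minus the past, the opposite of the
    increment in the cone condition; hence the reflected cone.\<close>
  have ab': "norm (- a) = 1" "norm (- b) = 1" "- a \<noteq> - b" using ab by auto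
  obtain \<epsilon> p R0 C :: real and k0 :: nat where
    surv: "\<And>m k \<sigma> t. k0 \<le> k \<Longrightarrow> 1 \<le> m \<Longrightarrow> 0 < \<sigma> \<Longrightarrow> real (m * k) * \<sigma>\<^sup>2 \<le> t \<Longrightarrow>
      emeasure M {\<omega>\<in>space M. \<forall>j\<in>{1..m * k}. back_walk t (\<sigma>\<^sup>2) j \<omega> \<in> ball 0 (R0 * \<sigma>) \<union> wide_cone (- a) (- b) \<epsilon>}
        \<le> ennreal ((1 / 2) ^ m + C * m * (1 + ln (m * k)) * real k powr (- p / 2))"
    and \<epsilon>: "0 < \<epsilon>" "\<epsilon> \<le> 1" "4 / \<epsilon> \<le> R0" and p: "1 < p" "p \<le> 3 / 2" and C: "0 < C"
    by (rule cone_survival[OF dim ab']) (erule that, assumption+)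
  \<comment> \<open>With \<kappa> = 1 the exponent would be \<open>- (p - 1) / 2\<close>. Half of it
    is spent here: \<open>\<zeta> * (1 + p) = (p - 1) / 4\<close>, and \<open>- (p - 1) / 4\<close>
    remains.\<close>
  define \<zeta> where "\<zeta> = (p - 1) / (4 * (1 + p))"
  have \<zeta>: "0 < \<zeta>" "\<zeta> < 1 / 4" using p by (auto simp: \<zeta>_def divide_simps)
  \<comment> \<open>The path oscillates with exponent \<open>(1 - \<zeta>) / 2\<close>, whereas the
    step scale below decays like \<open>2 powr (- \<kappa> * m / 2) / sqrt m\<close>. The gap
    between \<open>1 - \<zeta>\<close> and \<open>\<kappa>\<close> absorbs \<open>sqrt m\<close> and
    the oscillation constant.\<close>
  define \<kappa> where "\<kappa> = 1 - 2 * \<zeta>"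
  have \<kappa>: "0 < \<kappa>" "\<kappa> < 1" using \<zeta> by (auto simp: \<kappa>_def)
  define r where "r = 2 powr (- ((p - 1) / 4))"
  have r: "0 < r" "r < 1" using p powr_less_mono[of "- ((p - 1) / 4)" 0 2] by (auto simp: r_def)
  define q where "q = (\<lambda>m::nat. 2 powr (\<kappa> * m))"
  have q1: "1 \<le> q m" for m using \<kappa> powr_mono[of 0 "\<kappa> * m" 2] by (simp add: q_def)
  define k where "k = (\<lambda>m. nat \<lfloor>q m\<rfloor>)"
  have kq: "q m / 2 \<le> real (k m)" "real (k m) \<le> q m" "1 \<le> k m" for m
    unfolding k_def by (rule nat_floor_ge_half[OF q1])+
  have AE: "AE \<omega> in M. \<forall>e>0. \<exists>m \<sigma> I. 0 < \<sigma> \<and> finite I \<and>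
    \<sigma> * real (card I) \<le> e \<and> 1 / 2 ^ m \<le> \<delta> \<and>
    (\<forall>t. 2 * \<delta> \<le> t \<longrightarrow> t < real N \<longrightarrow> (\<forall>s\<in>{t - 2 * \<delta>..t}. B s \<omega> - B t \<omega> \<in> wide_cone a b (\<epsilon> / 2)) \<longrightarrow>
      nat \<lfloor>t * 2 ^ m\<rfloor> \<in> I \<and> norm (B t \<omega> - B (dyadic_floor m t) \<omega>) \<le> \<sigma>)"
    if \<delta>: "0 < \<delta>" for \<delta> N
  proof -
    \<comment> \<open>The \<open>m * k m\<close> steps of length \<open>(\<sigma> m)\<^sup>2\<close>
      fill a time span of exactly \<open>\<delta>\<close>. Taking \<open>m\<close> blocks makes
      \<open>(1 / 2) ^ m\<close> at most \<open>2 powr (- (\<kappa> * m * p / 2))\<close>, the size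
      of the other term.\<close>
    define \<sigma> where "\<sigma> = (\<lambda>m. sqrt (\<delta> / (real m * real (k m))))"
    have \<sigma>: "0 < \<sigma> m" "real (m * k m) * (\<sigma> m)\<^sup>2 = \<delta>" if "1 \<le> m" for m
    proof -
      have "0 < real m * real (k m)" using that kq(3)[of m] by simp
      then show "0 < \<sigma> m" "real (m * k m) * (\<sigma> m)\<^sup>2 = \<delta>" using \<delta> that kq(3)[of m] by (auto simp: \<sigma>_def)
    qed
    \<comment> \<open>The walk goes back by \<open>\<delta>\<close> from a dyadic time, which must
      therefore be at least \<open>\<delta>\<close>. For \<open>t \<ge> 2 * \<delta>\<close> the
      left end of its dyadic interval qualifies as soon as
      \<open>1 / 2 ^ m \<le> \<delta>\<close>.\<close>
    define I0 where "I0 = (\<lambda>m. {i. i < N * 2 ^ m \<and> \<delta> \<le> real i / 2 ^ m})"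
    have I0: "finite (I0 m)" "card (I0 m) \<le> N * 2 ^ m" for m
    proof -
      have "I0 m \<subseteq> {..<N * 2 ^ m}" by (auto simp: I0_def)
      then show "finite (I0 m)" "card (I0 m) \<le> N * 2 ^ m"
        using finite_subset card_mono[of "{..<N * 2 ^ m}" "I0 m"] by auto
    qed
    define E where "E = (\<lambda>m i. {\<omega>\<in>space M. \<forall>j\<in>{1..m * k m}. back_walk (real i / 2 ^ m) ((\<sigma> m)\<^sup>2) j \<omega> \<in> ball 0 (R0 * \<sigma> m) \<union> wide_cone (- a) (- b) \<epsilon>})"
    have E_sets: "E m i \<in> sets M" if m: "1 \<le> m" and i: "i \<in> I0 m" for m i
    proof -
      have "{\<omega>\<in>space M. back_walk (real i / 2 ^ m) ((\<sigma> m)\<^sup>2) j \<omega> \<in> ball 0 (R0 * \<sigma> m) \<union> wide_cone (- a) (- b) \<epsilon>} \<in> sets M"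
        if j: "j \<in> {1..m * k m}" for j
      proof -
        have "real j * (\<sigma> m)\<^sup>2 \<le> real (m * k m) * (\<sigma> m)\<^sup>2"
          using j by (intro mult_right_mono) (auto simp del: of_nat_mult)
        also have "\<dots> \<le> real i / 2 ^ m" using \<sigma>(2)[OF m] i by (simp add: I0_def)
        finally have "back_walk (real i / 2 ^ m) ((\<sigma> m)\<^sup>2) j \<in> borel_measurable M"
          by (rule back_walk_measurable) simp
        moreover have "ball 0 (R0 * \<sigma> m) \<union> wide_cone (- a) (- b) \<epsilon> \<in> sets borel" by measurable
        ultimately have "back_walk (real i / 2 ^ m) ((\<sigma> m)\<^sup>2) j -` (ball 0 (R0 * \<sigma> m) \<union> wide_cone (- a) (- b) \<epsilon>) \<inter> space M \<in> sets M"
          by (rule measurable_sets)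
        also have "back_walk (real i / 2 ^ m) ((\<sigma> m)\<^sup>2) j -` (ball 0 (R0 * \<sigma> m) \<union> wide_cone (- a) (- b) \<epsilon>) \<inter> space M
          = {\<omega>\<in>space M. back_walk (real i / 2 ^ m) ((\<sigma> m)\<^sup>2) j \<omega> \<in> ball 0 (R0 * \<sigma> m) \<union> wide_cone (- a) (- b) \<epsilon>}"
          by blast
        finally show ?thesis .
      qed
      then show ?thesis unfolding E_def by (rule sets.sets_Collect_finite_All) simp_all
    qed
    define Y where "Y = (\<lambda>m \<omega>. ennreal (\<sigma> m) * (\<Sum>i\<in>I0 m. indicator (E m i) \<omega>))"
    have Y_meas: "Y m \<in> borel_measurable M" if "1 \<le> m" for m
      unfolding Y_def using E_sets[OF that] by measurable
    define D where "D = N * (sqrt (2 * \<delta>) * (1 + 6 * C))"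
    have EY: "(\<integral>\<^sup>+\<omega>. Y m \<omega> \<partial>M) \<le> ennreal (D * ((real m)\<^sup>2 * r ^ m))" if m: "1 \<le> m" and k0: "k0 \<le> k m" for m
    proof -
      define P where "P = (1 / 2) ^ m + C * m * (1 + ln (real m * real (k m))) * real (k m) powr (- p / 2)"
      define Q where "Q = 2 powr (- (\<kappa> * m * p / 2))"
      have Q: "0 < Q" by (simp add: Q_def)
      have ln0: "0 \<le> ln (real m * real (k m))"
        using m kq(3)[of m] mult_mono[of 1 "real m" 1 "real (k m)"] by (intro ln_ge_zero) auto
      have "(\<integral>\<^sup>+\<omega>. Y m \<omega> \<partial>M) = ennreal (\<sigma> m) * (\<integral>\<^sup>+\<omega>. (\<Sum>i\<in>I0 m. indicator (E m i) \<omega>) \<partial>M)"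
        unfolding Y_def using E_sets[OF m] by (intro nn_integral_cmult) auto
      also have "(\<integral>\<^sup>+\<omega>. (\<Sum>i\<in>I0 m. indicator (E m i) \<omega>) \<partial>M) = (\<Sum>i\<in>I0 m. emeasure M (E m i))"
        using E_sets[OF m] by (subst nn_integral_sum) auto
      also have "\<dots> \<le> (\<Sum>i\<in>I0 m. ennreal P)"
      proof (intro sum_mono)
        fix i assume i: "i \<in> I0 m"
        show "emeasure M (E m i) \<le> ennreal P"
          unfolding E_def P_def by (rule surv[OF k0 m \<sigma>(1)[OF m]]) (use \<sigma>(2)[OF m] i in \<open>simp add: I0_def\<close>)
      qed
      also have "\<dots> = of_nat (card (I0 m)) * ennreal P" by simp
      also have "\<dots> \<le> of_nat (N * 2 ^ m) * ennreal P"
        using I0(2)[of m] by (intro mult_right_mono of_nat_mono) auto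
      also have "ennreal P \<le> ennreal ((1 + 6 * C) * (real m)\<^sup>2 * Q)"
      proof (rule ennreal_leI)
        have m1: "1 \<le> real m" "real m \<le> (real m)\<^sup>2" "1 \<le> (real m)\<^sup>2" using m one_le_power[of "real m" 2] by (auto simp: power2_eq_square)
        have "\<kappa> * p / 2 \<le> 1" using \<kappa> p mult_mono[of \<kappa> 1 p 2] by simp
        then have "\<kappa> * p / 2 * m \<le> 1 * real m" by (intro mult_right_mono) auto
        then have "2 powr (- real m) \<le> Q" unfolding Q_def by (intro powr_mono) (auto simp: mult_ac)
        then have 1: "(1 / 2) ^ m \<le> Q" by (simp add: powr_minus powr_realpow power_one_over inverse_eq_divide)
        have "ln (real m * real (k m)) = ln m + ln (k m)" using m kq(3)[of m] by (intro ln_mult_pos) auto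
        also have "ln (real m) \<le> real m" using ln_le_minus_one[of "real m"] m by simp
        also have "ln (real (k m)) \<le> ln (q m)" using kq(2,3)[of m] by (intro ln_mono) auto
        also have "ln (q m) = (\<kappa> * m) * ln 2" by (simp add: q_def ln_powr)
        also have "\<dots> \<le> (1 * real m) * 1" using \<kappa> ln_2_less_1 by (intro mult_mono) auto
        finally have 2: "1 + ln (real m * real (k m)) \<le> 3 * real m" using m1 by simp
        have "real (k m) powr (- p / 2) \<le> (q m / 2) powr (- p / 2)"
          using kq(1)[of m] q1[of m] p by (intro powr_mono2') auto
        also have "\<dots> = Q * 2 powr (p / 2)"
        proof -
          have "q m / 2 = 2 powr (\<kappa> * m - 1)" by (simp add: q_def powr_diff)
          then have "(q m / 2) powr (- p / 2) = 2 powr ((\<kappa> * m - 1) * (- p / 2))" by (simp only: powr_powr)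
          also have "\<dots> = 2 powr (- (\<kappa> * m * p / 2) + p / 2)"
            by (rule arg_cong[where f="\<lambda>a. 2 powr a"]) (simp add: field_simps)
          finally show ?thesis unfolding Q_def powr_add .
        qed
        also have "\<dots> \<le> Q * 2 powr 1" using Q p by (intro mult_left_mono powr_mono) auto
        finally have 3: "real (k m) powr (- p / 2) \<le> 2 * Q" by simp
        have "C * m * (1 + ln (real m * real (k m))) * real (k m) powr (- p / 2) \<le> C * m * (3 * real m) * (2 * Q)"
          using C 2 3 ln0 by (intro mult_mono mult_left_mono) auto
        also have "\<dots> = 6 * C * (real m)\<^sup>2 * Q" by (simp add: power2_eq_square)
        finally have PQ: "P \<le> Q + 6 * C * (real m)\<^sup>2 * Q" using 1 by (simp add: P_def)
        have "Q \<le> (real m)\<^sup>2 * Q" using m1 Q by simp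
        then have "P \<le> (real m)\<^sup>2 * Q + 6 * C * (real m)\<^sup>2 * Q" using PQ by linarith
        then show "P \<le> (1 + 6 * C) * (real m)\<^sup>2 * Q" by (simp add: algebra_simps)
      qed
      also have "ennreal (\<sigma> m) * (of_nat (N * 2 ^ m) * ennreal ((1 + 6 * C) * (real m)\<^sup>2 * Q))
          = ennreal (\<sigma> m * (real (N * 2 ^ m) * ((1 + 6 * C) * (real m)\<^sup>2 * Q)))"
        using C Q \<sigma>(1)[OF m] by (simp add: ennreal_mult[symmetric] ennreal_of_nat_eq_real_of_nat)
      also have "\<dots> \<le> ennreal (D * ((real m)\<^sup>2 * r ^ m))"
      proof (rule ennreal_leI)
        have s: "\<sigma> m \<le> sqrt (2 * \<delta>) * 2 powr (- (\<kappa> * m / 2))"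
        proof -
          have "\<delta> / (real m * real (k m)) \<le> \<delta> / (1 * (q m / 2))"
            using \<delta> m kq(1,3)[of m] q1[of m] by (intro divide_left_mono mult_mono mult_pos_pos) auto
          also have "\<dots> = 2 * \<delta> * 2 powr (- (\<kappa> * m))"
          proof -
            have "2 powr (- (\<kappa> * m)) = 1 / q m" by (simp only: q_def powr_minus_divide)
            then show ?thesis by (simp only:) simp
          qed
          finally have "\<sigma> m \<le> sqrt (2 * \<delta> * 2 powr (- (\<kappa> * m)))" unfolding \<sigma>_def by (rule real_sqrt_le_mono)
          also have "\<dots> = sqrt (2 * \<delta>) * sqrt (2 powr (- (\<kappa> * m)))" by (rule real_sqrt_mult)
          also have "sqrt (2 powr (- (\<kappa> * m))) = 2 powr (- (\<kappa> * m / 2))"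
            by (simp add: powr_half_sqrt[symmetric] powr_powr)
          finally show ?thesis .
        qed
        have "\<sigma> m * (real (N * 2 ^ m) * ((1 + 6 * C) * (real m)\<^sup>2 * Q))
          \<le> (sqrt (2 * \<delta>) * 2 powr (- (\<kappa> * m / 2))) * (real (N * 2 ^ m) * ((1 + 6 * C) * (real m)\<^sup>2 * Q))"
          using C Q by (intro mult_right_mono s) auto
        also have "\<dots> = D * ((real m)\<^sup>2 * (2 powr (- (\<kappa> * m / 2)) * 2 powr (real m) * Q))"
          by (simp add: D_def powr_realpow mult_ac)
        also have "2 powr (- (\<kappa> * m / 2)) * 2 powr (real m) * Q = 2 powr (- (\<kappa> * m / 2) + m + - (\<kappa> * m * p / 2))"
          by (simp only: Q_def powr_add)
        also have "- (\<kappa> * m / 2) + m + - (\<kappa> * m * p / 2) = (1 - \<kappa> * (1 + p) / 2) * m"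
          by (simp add: field_simps)
        also have "1 - \<kappa> * (1 + p) / 2 = - ((p - 1) / 4)"
        proof -
          have "\<zeta> * (1 + p) = (p - 1) / 4" using p by (simp add: \<zeta>_def divide_simps)
          moreover have "1 - \<kappa> * (1 + p) / 2 = 1 - (1 + p) / 2 + \<zeta> * (1 + p)" by (simp add: \<kappa>_def field_simps)
          ultimately show ?thesis by (simp add: field_simps)
        qed
        also have "2 powr (- ((p - 1) / 4) * m) = r ^ m" unfolding r_def by (simp add: powr_power mult.commute)
        finally show "\<sigma> m * (real (N * 2 ^ m) * ((1 + 6 * C) * (real m)\<^sup>2 * Q)) \<le> D * ((real m)\<^sup>2 * r ^ m)" .
      qed
      finally show ?thesis by (simp add: mult_left_mono)
    qed
    have ev_k0: "\<forall>\<^sub>F m in sequentially. k0 \<le> k m"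
    proof -
      have gt1: "1 < (2::real) powr \<kappa>" using \<kappa> powr_less_mono[of 0 \<kappa> 2] by simp
      then obtain m1 where m1: "real k0 < (2 powr \<kappa>) ^ m1" using real_arch_pow by blast
      have "real k0 \<le> (2 powr \<kappa>) ^ m" if "m1 \<le> m" for m
        using m1 power_increasing[OF that less_imp_le[OF gt1]] by linarith
      then have "\<forall>\<^sub>F m in sequentially. real k0 \<le> (2 powr \<kappa>) ^ m"
        unfolding eventually_sequentially by blast
      then show ?thesis
        by eventually_elim (simp add: k_def q_def powr_power le_nat_floor mult.commute)
    qed
    have ev1: "\<forall>\<^sub>F m in sequentially. 1 \<le> (m::nat)" by (rule eventually_ge_at_top)
    have EY0: "(\<lambda>m. \<integral>\<^sup>+\<omega>. Y (m + 1) \<omega> \<partial>M) \<longlonglongrightarrow> 0"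
    proof -
      have "(\<lambda>m. \<integral>\<^sup>+\<omega>. Y m \<omega> \<partial>M) \<longlonglongrightarrow> 0"
      proof (rule tendsto_sandwich[where f="\<lambda>_. 0" and h="\<lambda>m. ennreal (D * ((real m)\<^sup>2 * r ^ m))"])
        show "\<forall>\<^sub>F m in sequentially. (\<integral>\<^sup>+\<omega>. Y m \<omega> \<partial>M) \<le> ennreal (D * ((real m)\<^sup>2 * r ^ m))"
          using ev_k0 ev1 by eventually_elim (rule EY)
        have "(\<lambda>m. D * ((real m)\<^sup>2 * r ^ m)) \<longlonglongrightarrow> D * 0"
          by (intro tendsto_mult_left square_times_power_tendsto_0 r)
        then have "(\<lambda>m. ennreal (D * ((real m)\<^sup>2 * r ^ m))) \<longlonglongrightarrow> ennreal (D * 0)" by (rule tendsto_ennrealI)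
        then show "(\<lambda>m. ennreal (D * ((real m)\<^sup>2 * r ^ m))) \<longlonglongrightarrow> 0" by simp
      qed auto
      then show ?thesis by (rule LIMSEQ_ignore_initial_segment)
    qed
    \<comment> \<open>Fatou's lemma is enough, since one good level is wanted for each
      \<open>e\<close>. The index is shifted because the facts about \<open>Y m\<close> are stated
      for \<open>1 \<le> m\<close>.\<close>
    have "(\<integral>\<^sup>+\<omega>. liminf (\<lambda>m. Y (m + 1) \<omega>) \<partial>M) \<le> liminf (\<lambda>m. \<integral>\<^sup>+\<omega>. Y (m + 1) \<omega> \<partial>M)"
      by (intro nn_integral_liminf Y_meas) simp
    also have "\<dots> = 0" using EY0 by (intro lim_imp_Liminf) auto
    finally have "(\<integral>\<^sup>+\<omega>. liminf (\<lambda>m. Y (m + 1) \<omega>) \<partial>M) = 0" by simp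
    then have "AE \<omega> in M. liminf (\<lambda>m. Y (m + 1) \<omega>) = 0"
      using Y_meas by (subst (asm) nn_integral_0_iff_AE) auto
    moreover have "AE \<omega> in M. \<forall>\<^sub>F m in sequentially. \<forall>t::real. 0 \<le> t \<and> t < real N \<longrightarrow>
      norm (B t \<omega> - B (dyadic_floor m t) \<omega>) \<le> 1 / (1 - 2 powr (- (1 - \<zeta>) / 2)) * (2 powr (- (1 - \<zeta>) / 2)) ^ m"
      by (rule dyadic_oscillation) (use \<zeta> in auto)
    moreover have "AE \<omega> in M. \<omega> \<in> space M" by simp
    ultimately show ?thesis
    proof eventually_elim
      case (elim \<omega>)
      define \<rho> :: real where "\<rho> = 2 powr (- (1 - \<zeta>) / 2)"
      define c where "c = 1 / (1 - \<rho>)"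
      have \<rho>: "0 < \<rho>" "\<rho> < 1" using \<zeta> powr_less_mono[of "- (1 - \<zeta>) / 2" 0 2] by (auto simp: \<rho>_def)
      \<comment> \<open>After squaring, what has to be small is a multiple of
        \<open>m * (\<rho> ^ m)\<^sup>2 * q m\<close>, and
        \<open>(\<rho> ^ m)\<^sup>2 * q m = 2 powr (- \<zeta> * m)\<close>.\<close>
      have ev_\<sigma>: "\<forall>\<^sub>F m in sequentially. c * \<rho> ^ m \<le> \<sigma> m"
      proof -
        define s :: real where "s = 2 powr (- \<zeta>)"
        have s: "0 < s" "s < 1" using \<zeta> powr_less_mono[of "- \<zeta>" 0 2] by (auto simp: s_def)
        have "(\<lambda>m. c\<^sup>2 * (real m * s ^ m)) \<longlonglongrightarrow> c\<^sup>2 * 0"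
          using powser_times_n_limit_0[of s] s by (intro tendsto_mult_left) simp
        then have "\<forall>\<^sub>F m in sequentially. c\<^sup>2 * (real m * s ^ m) < \<delta>"
          using \<delta> by (intro order_tendstoD(2)) auto
        then show ?thesis using ev1
        proof eventually_elim
          case (elim m)
          have mk: "0 < real m * real (k m)" using elim kq(3)[of m] by simp
          have sq: "(\<rho> ^ m)\<^sup>2 * q m = s ^ m"
          proof -
            have "(\<rho> ^ m)\<^sup>2 = \<rho> ^ (m * 2)" by (rule power_mult[symmetric])
            also have "\<dots> = 2 powr (real (m * 2) * (- (1 - \<zeta>) / 2))"
              unfolding \<rho>_def by (rule powr_power) simp
            also have "\<dots> = 2 powr (- (1 - \<zeta>) * m)"
              by (rule arg_cong[where f="\<lambda>a. 2 powr a"]) (simp add: field_simps)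
            finally have "(\<rho> ^ m)\<^sup>2 = 2 powr (- (1 - \<zeta>) * m)" .
            then show ?thesis unfolding q_def s_def \<kappa>_def
              by (simp add: powr_add[symmetric] powr_power algebra_simps)
          qed
          have "(c * \<rho> ^ m)\<^sup>2 * (real m * real (k m)) \<le> (c * \<rho> ^ m)\<^sup>2 * (real m * q m)"
            using kq(2)[of m] by (intro mult_left_mono) auto
          also have "\<dots> = c\<^sup>2 * (real m * ((\<rho> ^ m)\<^sup>2 * q m))" by (simp add: power_mult_distrib mult_ac)
          also have "\<dots> \<le> \<delta>" unfolding sq using elim by simp
          finally have "(c * \<rho> ^ m)\<^sup>2 \<le> \<delta> / (real m * real (k m))" using mk by (simp add: pos_le_divide_eq)
          then show ?case unfolding \<sigma>_def by (rule real_le_rsqrt)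
        qed
      qed
      have ev_\<delta>: "\<forall>\<^sub>F m in sequentially. 1 / 2 ^ m \<le> \<delta>"
      proof -
        have "(\<lambda>m. (1 / 2 :: real) ^ m) \<longlonglongrightarrow> 0" by (intro LIMSEQ_realpow_zero) auto
        then have "\<forall>\<^sub>F m in sequentially. (1 / 2) ^ m < \<delta>" using \<delta> by (rule order_tendstoD(2))
        then show ?thesis by eventually_elim (simp add: power_one_over)
      qed
      show ?case
      proof (intro allI impI)
        fix e :: real assume e: "0 < e"
        \<comment> \<open>A vanishing lower limit provides infinitely many levels with small
          \<open>Y\<close>; one of them also satisfies the conditions that hold eventually.\<close>
        have "\<not> (\<forall>\<^sub>F m in sequentially. ennreal e \<le> Y (m + 1) \<omega>)"
        proof
          assume "\<forall>\<^sub>F m in sequentially. ennreal e \<le> Y (m + 1) \<omega>"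
          then have "ennreal e \<le> liminf (\<lambda>m. Y (m + 1) \<omega>)" by (rule Liminf_bounded)
          then show False using elim(1) e by simp
        qed
        then have "\<exists>\<^sub>F m in sequentially. Y m \<omega> < ennreal e"
          unfolding frequently_def not_less using eventually_sequentially_Suc[of "\<lambda>m. ennreal e \<le> Y m \<omega>"] by simp
        moreover have "\<forall>\<^sub>F m in sequentially. 1 \<le> m \<and> c * \<rho> ^ m \<le> \<sigma> m \<and> 1 / 2 ^ m \<le> \<delta> \<and>
            (\<forall>t::real. 0 \<le> t \<and> t < real N \<longrightarrow> norm (B t \<omega> - B (dyadic_floor m t) \<omega>) \<le> c * \<rho> ^ m)"
          using ev1 ev_\<sigma> ev_\<delta> elim(2) unfolding c_def \<rho>_def by eventually_elim auto
        ultimately have "\<exists>\<^sub>F m in sequentially. Y m \<omega> < ennreal e \<and> 1 \<le> m \<and> c * \<rho> ^ m \<le> \<sigma> m \<and> 1 / 2 ^ m \<le> \<delta> \<and>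
            (\<forall>t::real. 0 \<le> t \<and> t < real N \<longrightarrow> norm (B t \<omega> - B (dyadic_floor m t) \<omega>) \<le> c * \<rho> ^ m)"
          by (rule frequently_eventually_frequently)
        from frequently_ex[OF this] obtain m where m: "Y m \<omega> < ennreal e" "1 \<le> m" "c * \<rho> ^ m \<le> \<sigma> m" "1 / 2 ^ m \<le> \<delta>"
          "\<And>t::real. 0 \<le> t \<Longrightarrow> t < real N \<Longrightarrow> norm (B t \<omega> - B (dyadic_floor m t) \<omega>) \<le> c * \<rho> ^ m"
          by blast
        define I where "I = {i\<in>I0 m. \<omega> \<in> E m i}"
        have "(\<Sum>i\<in>I0 m. indicator (E m i) \<omega>) = (of_nat (card I) :: ennreal)"
        proof -
          have "(\<Sum>i\<in>I0 m. indicator (E m i) \<omega>) = (\<Sum>i\<in>I0 m. if \<omega> \<in> E m i then 1 else (0::ennreal))"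
            by (simp only: indicator_def of_bool_def)
          also have "\<dots> = (\<Sum>i\<in>I. 1)" unfolding I_def by (rule sum.inter_filter[symmetric, OF I0(1)])
          finally show ?thesis by simp
        qed
        then have "ennreal (\<sigma> m) * of_nat (card I) < ennreal e" using m(1) by (simp add: Y_def)
        then have "ennreal (\<sigma> m * real (card I)) < ennreal e"
          using \<sigma>(1)[OF m(2)] by (simp add: ennreal_mult ennreal_of_nat_eq_real_of_nat)
        then have card: "\<sigma> m * real (card I) \<le> e" using \<sigma>(1)[OF m(2)] by (subst (asm) ennreal_less_iff) auto
        have cov: "nat \<lfloor>t * 2 ^ m\<rfloor> \<in> I \<and> norm (B t \<omega> - B (dyadic_floor m t) \<omega>) \<le> \<sigma> m"
          if t: "2 * \<delta> \<le> t" "t < real N" and cone: "\<forall>s\<in>{t - 2 * \<delta>..t}. B s \<omega> - B t \<omega> \<in> wide_cone a b (\<epsilon> / 2)" for t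
        proof
          have t0: "0 \<le> t" using t \<delta> by linarith
          show osc: "norm (B t \<omega> - B (dyadic_floor m t) \<omega>) \<le> \<sigma> m" using m(5)[OF t0 t(2)] m(3) by linarith
          define i where "i = nat \<lfloor>t * 2 ^ m\<rfloor>"
          have di: "dyadic_floor m t = real i / 2 ^ m" by (simp add: dyadic_floor_def i_def)
          note db = dyadic_floor_bounds[OF t0, of m, unfolded di]
          have "real i / 2 ^ m < real N" using db(2) t(2) by linarith
          then have "real i < real (N * 2 ^ m)" by (simp add: divide_less_eq)
          then have "i < N * 2 ^ m" by linarith
          moreover have "\<delta> \<le> real i / 2 ^ m" using db(3) m(4) t(1) by linarith
          ultimately have iI: "i \<in> I0 m" by (simp add: I0_def)
          have "\<omega> \<in> E m i"
            unfolding E_def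
          proof (intro CollectI conjI ballI elim(3))
            fix j assume j: "j \<in> {1..m * k m}"
            have "real j * (\<sigma> m)\<^sup>2 \<le> real (m * k m) * (\<sigma> m)\<^sup>2"
              using j by (intro mult_right_mono) (auto simp del: of_nat_mult)
            then have j\<delta>: "real j * (\<sigma> m)\<^sup>2 \<le> \<delta>" unfolding \<sigma>(2)[OF m(2)] .
            define s where "s = real i / 2 ^ m - real j * (\<sigma> m)\<^sup>2"
            have "0 \<le> real j * (\<sigma> m)\<^sup>2" by simp
            \<comment> \<open>Passing from \<open>t\<close> to the dyadic time costs at most
              \<open>\<delta>\<close> and the walk goes back by at most \<open>\<delta>\<close>,
              which is why the window has length \<open>2 * \<delta>\<close>.\<close>
            then have s: "s \<in> {t - 2 * \<delta>..t}" using db j\<delta> m(4) unfolding s_def atLeastAtMost_iff by linarith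
            define v where "v = B s \<omega> - B t \<omega>"
            define w where "w = B t \<omega> - B (real i / 2 ^ m) \<omega>"
            have vK: "v \<in> wide_cone a b (\<epsilon> / 2)" using cone s by (simp add: v_def)
            have w: "norm w \<le> \<sigma> m" using osc by (simp add: w_def di)
            have bw: "back_walk (real i / 2 ^ m) ((\<sigma> m)\<^sup>2) j \<omega> = - (v + w)"
              by (simp add: back_walk_def v_def w_def s_def)
            show "back_walk (real i / 2 ^ m) ((\<sigma> m)\<^sup>2) j \<omega> \<in> ball 0 (R0 * \<sigma> m) \<union> wide_cone (- a) (- b) \<epsilon>"
            proof (cases "norm (v + w) < R0 * \<sigma> m")
              case True
              then show ?thesis unfolding bw by (simp add: norm_minus_commute del: minus_add_distrib)
            next
              case False
              then have "v + w \<in> wide_cone a b \<epsilon>"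
                by (intro wide_cone_perturb_far[OF ab(1,2) \<epsilon> vK w _ \<sigma>(1)[OF m(2)]]) simp
              then show ?thesis unfolding bw wide_cone_uminus Un_iff by blast
            qed
          qed
          then show "nat \<lfloor>t * 2 ^ m\<rfloor> \<in> I" using iI by (simp add: I_def i_def)
        qed
        show "\<exists>m \<sigma> I. 0 < \<sigma> \<and> finite I \<and> \<sigma> * real (card I) \<le> e \<and> 1 / 2 ^ m \<le> \<delta> \<and>
          (\<forall>t. 2 * \<delta> \<le> t \<longrightarrow> t < real N \<longrightarrow> (\<forall>s\<in>{t - 2 * \<delta>..t}. B s \<omega> - B t \<omega> \<in> wide_cone a b (\<epsilon> / 2)) \<longrightarrow>
          nat \<lfloor>t * 2 ^ m\<rfloor> \<in> I \<and> norm (B t \<omega> - B (dyadic_floor m t) \<omega>) \<le> \<sigma>)"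
          using \<sigma>(1)[OF m(2)] card m(4) cov I0(1)[of m]
          by (intro exI[of _ m] exI[of _ "\<sigma> m"] exI[of _ I]) (auto simp: I_def)
      qed
    qed
  qed
  show ?thesis
  proof (rule that[of "\<epsilon> / 2"])
    show "0 < \<epsilon> / 2" using \<epsilon>(1) by simp
    show "AE \<omega> in M. cone_times_coverable (\<lambda>t. B t \<omega>) a b (\<epsilon> / 2) \<delta> N" if "0 < \<delta>" for \<delta> N
      unfolding cone_times_coverable_def by (rule AE[OF that])
  qed
qed

end

section \<open>Boundary times of the Skorokhod equation\<close>

lemma C2_defining_functionE:
  assumes "C2_boundary D" "z \<in> frontier D"
  obtains U \<rho> g where "open U" "z \<in> U" "C2_defining_function D z U \<rho>"
    "\<And>u. u \<in> U \<Longrightarrow> GDERIV \<rho> u :> g u" "\<And>u. u \<in> U \<Longrightarrow> g u \<noteq> 0" "continuous_on U g"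
    "\<And>u. u \<in> U \<Longrightarrow> C2_defining_function D u U \<rho>"
proof -
  obtain U \<rho> where d: "C2_defining_function D z U \<rho>" using assms unfolding C2_boundary_def by blast
  then obtain g H where g: "\<forall>u\<in>U. GDERIV \<rho> u :> g u" "\<forall>u\<in>U. (g has_derivative blinfun_apply (H u)) (at u)"
    unfolding C2_defining_function_def C2_on_def by blast
  have U: "open U" "z \<in> U" using d by (auto simp: C2_defining_function_def)
  have nz: "g u \<noteq> 0" if "u \<in> U" for u
    using d g(1) that unfolding C2_defining_function_def by metis
  have "continuous_on U g"
    using g(2) by (intro continuous_at_imp_continuous_on ballI has_derivative_continuous) blast
  moreover have "C2_defining_function D u U \<rho>" if "u \<in> U" for u
    using d that unfolding C2_defining_function_def by blast
  ultimately show ?thesis by (intro that[OF U d _ nz]) (use g(1) in blast)+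
qed

lemma norm_inward_normal:
  assumes "open D" "C2_boundary D" "z \<in> frontier D"
  shows "norm (inward_normal D z) = 1"
proof -
  obtain U \<rho> g where U: "open U" "z \<in> U" "C2_defining_function D z U \<rho>" "\<And>u. u \<in> U \<Longrightarrow> GDERIV \<rho> u :> g u"
    "\<And>u. u \<in> U \<Longrightarrow> g u \<noteq> 0" "continuous_on U g" "\<And>u. u \<in> U \<Longrightarrow> C2_defining_function D u U \<rho>"
    by (rule C2_defining_functionE[OF assms(2,3)]) blast
  show ?thesis using inward_normal_eq[OF assms(1,3) U(3) U(4)[OF U(2)]] U(5)[OF U(2)] by simp
qed

lemma continuous_on_inward_normal:
  assumes "open D" "C2_boundary D"
  shows "continuous_on (frontier D) (inward_normal D)"
  unfolding continuous_on_eq_continuous_within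
proof
  fix z assume z: "z \<in> frontier D"
  obtain U \<rho> g where U: "open U" "z \<in> U" "C2_defining_function D z U \<rho>" "\<And>u. u \<in> U \<Longrightarrow> GDERIV \<rho> u :> g u"
    "\<And>u. u \<in> U \<Longrightarrow> g u \<noteq> 0" "continuous_on U g" "\<And>u. u \<in> U \<Longrightarrow> C2_defining_function D u U \<rho>"
    by (rule C2_defining_functionE[OF assms(2) z]) blast
  have eq: "inward_normal D u = g u /\<^sub>R norm (g u)" if "u \<in> frontier D" "u \<in> U" for u
    using inward_normal_eq[OF assms(1) that(1) U(7)[OF that(2)] U(4)[OF that(2)]] .
  have "isCont g z" using U(1,2,6) continuous_on_eq_continuous_at by blast
  then have "isCont (\<lambda>u. g u /\<^sub>R norm (g u)) z"
    using U(5)[OF U(2)] by (intro continuous_intros) auto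
  then have "((\<lambda>u. g u /\<^sub>R norm (g u)) \<longlongrightarrow> inward_normal D z) (at z within frontier D)"
    unfolding isCont_def eq[OF z U(2)] by (rule tendsto_within_subset) auto
  moreover have "\<forall>\<^sub>F u in at z within frontier D. g u /\<^sub>R norm (g u) = inward_normal D u"
    using U(1,2) eq unfolding eventually_at_topological by metis
  ultimately show "continuous (at z within frontier D) (inward_normal D)"
    unfolding continuous_within by (rule Lim_transform_eventually)
qed

lemma borel_measurable_inward_normal [measurable]:
  assumes "open D" "C2_boundary D"
  shows "inward_normal D \<in> borel_measurable borel"
proof -
  have "(\<lambda>z. if z \<in> frontier D then inward_normal D z else 0) \<in> borel_measurable borel"
    by (rule borel_measurable_continuous_on_if)
       (use continuous_on_inward_normal[OF assms] in auto)
  moreover have "(\<lambda>z. if z \<in> frontier D then inward_normal D z else 0) = inward_normal D"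
    by (auto simp: fun_eq_iff inward_normal_def)
  ultimately show ?thesis by simp
qed

text \<open>A defining function vanishes at \<open>z\<close> and is nonnegative on the closed domain
  near \<open>z\<close>, while its expansion at \<open>z\<close> is a positive multiple of the
  normal component of \<open>u - z\<close> up to an error of smaller order than
  \<open>norm (u - z)\<close>.\<close>

lemma inward_normal_cone:
  assumes "open D" "C2_boundary D" "z \<in> frontier D" "0 < \<epsilon>"
  shows "\<forall>\<^sub>F u in nhds z. u \<in> closure D \<longrightarrow> - \<epsilon> * norm (u - z) \<le> inward_normal D z \<bullet> (u - z)"
proof -
  obtain U \<rho> g where U: "open U" "z \<in> U" "C2_defining_function D z U \<rho>" "\<And>u. u \<in> U \<Longrightarrow> GDERIV \<rho> u :> g u"
    "\<And>u. u \<in> U \<Longrightarrow> g u \<noteq> 0" "continuous_on U g" "\<And>u. u \<in> U \<Longrightarrow> C2_defining_function D u U \<rho>"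
    by (rule C2_defining_functionE[OF assms(2,3)]) blast
  have gz: "0 < norm (g z)" using U(2,5) by simp
  have nz: "inward_normal D z = g z /\<^sub>R norm (g z)"
    by (rule inward_normal_eq[OF assms(1,3) U(3) U(4)[OF U(2)]])
  have \<rho>z: "\<rho> z = 0" by (rule C2_defining_function_zero[OF assms(1,3) U(3) U(4)[OF U(2)]])
  have \<rho>_nonneg: "0 \<le> \<rho> u" if "u \<in> U" "u \<in> closure D" for u
  proof (cases "u \<in> D")
    case True
    then have "u \<in> {u \<in> U. 0 < \<rho> u}" using U(3) that unfolding C2_defining_function_def by blast
    then show ?thesis by simp
  next
    case False
    then have "u \<in> frontier D" using that assms(1) by (simp add: frontier_def interior_open)
    then show ?thesis using C2_defining_function_zero[OF assms(1) _ U(7) U(4)] that by simp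
  qed
  have "(\<rho> has_derivative (\<lambda>h. h \<bullet> g z)) (at z)" using U(4)[OF U(2)] by (simp add: gderiv_def)
  then obtain d where d: "0 < d"
    "\<And>u. norm (u - z) < d \<Longrightarrow> norm (\<rho> u - \<rho> z - (u - z) \<bullet> g z) \<le> (\<epsilon> * norm (g z)) * norm (u - z)"
    unfolding has_derivative_at_alt using assms(4) gz by (meson mult_pos_pos)
  have "\<forall>\<^sub>F u in nhds z. u \<in> U" using U(1,2) by (rule eventually_nhds_in_open)
  moreover have "\<forall>\<^sub>F u in nhds z. dist u z < d" using d(1) eventually_nhds_metric by blast
  ultimately show ?thesis
  proof eventually_elim
    case (elim u)
    show ?case
    proof
      assume "u \<in> closure D"
      then have "0 \<le> \<rho> u" using \<rho>_nonneg elim by blast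
      then have "- (\<epsilon> * norm (g z)) * norm (u - z) \<le> (u - z) \<bullet> g z"
        using d(2)[of u] elim \<rho>z by (simp add: dist_norm abs_le_iff)
      then have "norm (g z) * (- \<epsilon> * norm (u - z)) \<le> norm (g z) * (inward_normal D z \<bullet> (u - z))"
      proof -
        have "norm (g z) * (inward_normal D z \<bullet> (u - z)) = (u - z) \<bullet> g z"
          using gz unfolding nz by (simp add: inner_commute)
        then show ?thesis using \<open>- (\<epsilon> * norm (g z)) * norm (u - z) \<le> (u - z) \<bullet> g z\<close> by (simp add: mult_ac)
      qed
      then show "- \<epsilon> * norm (u - z) \<le> inward_normal D z \<bullet> (u - z)"
        using gz by (rule mult_left_le_imp_le)
    qed
  qed
qed

section \<open>Local time as a measure on the half line\<close>

lemma sets_stieltjes_measure: "sets (stieltjes_measure F) = sets (restrict_space borel {0..})"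
  unfolding stieltjes_measure_def by (simp add: sets_restrict_space)

lemma space_stieltjes_measure [simp]: "space (stieltjes_measure F) = {0..}"
  by (simp add: stieltjes_measure_def space_restrict_space)

lemma measurable_stieltjes_measure_continuous:
  assumes "continuous_on {0..} f"
  shows "f \<in> borel_measurable (stieltjes_measure F)"
proof -
  have "f \<in> borel_measurable (restrict_space borel {0..})"
    by (rule borel_measurable_continuous_on_restrict[OF assms])
  then show ?thesis by (simp only: measurable_cong_sets[OF sets_stieltjes_measure refl])
qed

lemma sets_stieltjes_measure_interval [simp, measurable]:
  "0 \<le> s \<Longrightarrow> {s..t} \<in> sets (stieltjes_measure F)" "0 \<le> s \<Longrightarrow> {s<..t} \<in> sets (stieltjes_measure F)"
  by (auto simp: sets_stieltjes_measure sets_restrict_space_iff)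

context
  fixes D :: "'a::euclidean_space set" and x :: 'a and w X :: "real \<Rightarrow> 'a" and L :: "real \<Rightarrow> real"
  assumes D: "open D" "C2_boundary D" and sk: "skorokhod_solution D x w X L"
begin

lemma skorokhod_local_time:
  shows "continuous_on {0..} L" "mono_on {0..} L"
    "\<And>s t. 0 \<le> s \<Longrightarrow> s \<le> t \<Longrightarrow> emeasure (stieltjes_measure L) {s..t} = ennreal (L t - L s)"
    "\<And>s t. 0 \<le> s \<Longrightarrow> s \<le> t \<Longrightarrow> 0 \<le> L t - L s"
proof -
  show L: "continuous_on {0..} L" "mono_on {0..} L" using sk by (auto simp: skorokhod_solution_def)
  show "emeasure (stieltjes_measure L) {s..t} = ennreal (L t - L s)" if "0 \<le> s" "s \<le> t" for s t
    by (rule emeasure_stieltjes_measure_Icc[OF L(2,1) that])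
  show "0 \<le> L t - L s" if "0 \<le> s" "s \<le> t" for s t
    using mono_onD[OF L(2), of s t] that by simp
qed

lemma stieltjes_singleton: "0 \<le> s \<Longrightarrow> emeasure (stieltjes_measure L) {s} = 0"
  using skorokhod_local_time(3)[of s s] by simp

lemma emeasure_stieltjes_Ioc:
  assumes "0 \<le> s" "s \<le> t"
  shows "emeasure (stieltjes_measure L) {s<..t} = ennreal (L t - L s)"
proof -
  have "emeasure (stieltjes_measure L) {s..t} = emeasure (stieltjes_measure L) ({s} \<union> {s<..t})"
    using assms by (intro arg_cong2[where f=emeasure]) auto
  also have "\<dots> = emeasure (stieltjes_measure L) {s} + emeasure (stieltjes_measure L) {s<..t}"
    using assms sets_stieltjes_measure_interval(1)[of s s] by (intro plus_emeasure[symmetric]) auto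
  finally show ?thesis using assms by (simp add: skorokhod_local_time(3) stieltjes_singleton)
qed

lemma skorokhod_X:
  shows "continuous_on {0..} X" "\<And>t. 0 \<le> t \<Longrightarrow> X t \<in> closure D"
  using sk by (auto simp: skorokhod_solution_def)

lemma AE_stieltjes_frontier: "AE r in stieltjes_measure L. X r \<in> frontier D"
proof -
  have [measurable]: "X \<in> borel_measurable (stieltjes_measure L)"
    by (rule measurable_stieltjes_measure_continuous[OF skorokhod_X(1)])
  have [measurable]: "D \<in> sets borel" using D(1) by simp
  have "(\<integral>\<^sup>+ t. indicator D (X t) \<partial>stieltjes_measure L) = 0" using sk by (simp add: skorokhod_solution_def)
  then have "AE r in stieltjes_measure L. indicator D (X r) = (0::ennreal)"
    by (subst (asm) nn_integral_0_iff_AE) auto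
  moreover have "AE r in stieltjes_measure L. r \<in> {0..}" using AE_space[of "stieltjes_measure L"] by simp
  ultimately show ?thesis
  proof eventually_elim
    case (elim r)
    then have "X r \<notin> D" "X r \<in> closure D" using skorokhod_X(2) by (auto simp: indicator_def split: if_splits)
    then show ?case using D(1) by (simp add: frontier_def interior_open)
  qed
qed

text \<open>\<open>J\<close> is the integral of the normal against the local time over
  \<open>{s<..t}\<close>. As long as the normals met have a component of at least 1/2 along
  \<open>n\<close>, no cancellation can occur and \<open>J\<close> is comparable with the local time
  spent.\<close>

lemma skorokhod_increment:
  assumes st: "0 \<le> s" "s \<le> t" and n1: "\<And>r. r \<in> {s..t} \<Longrightarrow> X r \<in> frontier D \<Longrightarrow> 1 / 2 \<le> n \<bullet> inward_normal D (X r)"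
  obtains J where "X t - X s = w t - w s + J" "norm J \<le> L t - L s" "(L t - L s) / 2 \<le> n \<bullet> J"
proof -
  let ?M = "stieltjes_measure L"
  define f where "f = (\<lambda>r. inward_normal D (X r))"
  have X_meas [measurable]: "X \<in> borel_measurable ?M"
    by (rule measurable_stieltjes_measure_continuous[OF skorokhod_X(1)])
  have [measurable]: "f \<in> borel_measurable ?M"
    unfolding f_def by (rule measurable_compose[OF X_meas borel_measurable_inward_normal[OF D]])
  have fb: "norm (f r) \<le> 1" for r
    using norm_inward_normal[OF D, of "X r"] by (cases "X r \<in> frontier D") (auto simp: f_def inward_normal_def)
  have bnd: "integrable ?M (\<lambda>r. indicator A r *\<^sub>R f r)" if A: "A \<in> sets ?M" "emeasure ?M A < \<infinity>" for A
  proof (rule Bochner_Integration.integrable_bound)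
    show "integrable ?M (indicator A :: real \<Rightarrow> real)" using A by simp
    show "AE r in ?M. norm (indicator A r *\<^sub>R f r) \<le> norm (indicator A r :: real)"
      using fb by (intro AE_I2) (simp add: indicator_def)
  qed (use A in measurable)
  have t0: "0 \<le> t" using st by simp
  have i: "integrable ?M (\<lambda>r. indicator {0..t} r *\<^sub>R f r)" "integrable ?M (\<lambda>r. indicator {0..s} r *\<^sub>R f r)"
    by (intro bnd; use st t0 in \<open>simp add: skorokhod_local_time(3)\<close>)+
  define J where "J = (\<integral>r. indicator {s<..t} r *\<^sub>R f r \<partial>?M)"
  have e: "emeasure ?M {s<..t} = ennreal (L t - L s)" "{s<..t} \<in> sets ?M"
    using st by (auto simp: emeasure_stieltjes_Ioc)
  have iJ: "integrable ?M (\<lambda>r. indicator {s<..t} r *\<^sub>R f r)" using e by (intro bnd) auto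
  have iI: "integrable ?M (indicator {s<..t} :: real \<Rightarrow> real)" using e by simp
  have \<mu>: "(\<integral>r. indicator {s<..t} r \<partial>?M) = L t - L s"
  proof -
    have "{s<..t} \<inter> {0..} = {s<..t}" using st by auto
    then show ?thesis using e skorokhod_local_time(4)[OF st] by (simp add: measure_def)
  qed
  have eqX: "X u = x + w u + (\<integral>r. indicator {0..u} r *\<^sub>R f r \<partial>?M)" if "0 \<le> u" for u
    using sk that unfolding skorokhod_solution_def set_lebesgue_integral_def f_def by blast
  have "(\<integral>r. indicator {0..t} r *\<^sub>R f r \<partial>?M) - (\<integral>r. indicator {0..s} r *\<^sub>R f r \<partial>?M) = J"
  proof -
    have "(\<integral>r. indicator {0..t} r *\<^sub>R f r \<partial>?M) - (\<integral>r. indicator {0..s} r *\<^sub>R f r \<partial>?M)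
      = (\<integral>r. indicator {0..t} r *\<^sub>R f r - indicator {0..s} r *\<^sub>R f r \<partial>?M)"
      using i by simp
    also have "\<dots> = J" unfolding J_def
      by (rule Bochner_Integration.integral_cong) (use st in \<open>auto simp: indicator_def\<close>)
    finally show ?thesis .
  qed
  then have 1: "X t - X s = w t - w s + J" using eqX[OF t0] eqX[OF st(1)] by (simp add: algebra_simps)
  have "norm J \<le> (\<integral>r. norm (indicator {s<..t} r *\<^sub>R f r) \<partial>?M)" unfolding J_def by (rule integral_norm_bound)
  also have "\<dots> \<le> (\<integral>r. indicator {s<..t} r \<partial>?M)"
  proof (rule integral_mono[OF integrable_norm[OF iJ] iI])
    show "norm (indicator {s<..t} r *\<^sub>R f r) \<le> indicator {s<..t} r" for r
      using fb[of r] by (simp add: indicator_def)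
  qed
  finally have 2: "norm J \<le> L t - L s" using \<mu> by simp
  have "(L t - L s) / 2 = (\<integral>r. (1 / 2) * indicator {s<..t} r \<partial>?M)" using \<mu> by simp
  also have "\<dots> \<le> (\<integral>r. n \<bullet> (indicator {s<..t} r *\<^sub>R f r) \<partial>?M)"
  proof (rule integral_mono_AE)
    show "integrable ?M (\<lambda>r. (1 / 2) * indicator {s<..t} r :: real)" using iI by simp
    show "integrable ?M (\<lambda>r. n \<bullet> (indicator {s<..t} r *\<^sub>R f r))" using iJ by (rule integrable_inner_right)
    show "AE r in ?M. (1 / 2) * indicator {s<..t} r \<le> n \<bullet> (indicator {s<..t} r *\<^sub>R f r)"
      using AE_stieltjes_frontier by eventually_elim (use n1 in \<open>auto simp: indicator_def f_def\<close>)
  qed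
  also have "\<dots> = n \<bullet> J" unfolding J_def using iJ by (rule integral_inner_right)
  finally have 3: "(L t - L s) / 2 \<le> n \<bullet> J" .
  show ?thesis by (rule that[OF 1 2 3])
qed

text \<open>Going back in time removes the inward push \<open>J\<close>:
  \<open>X s - X t = (w s - w t) - J\<close>. Since \<open>X s\<close> is in the closed domain,
  hence nearly in the half space at \<open>X t\<close>, the increment \<open>w s - w t\<close> must
  make up for \<open>J\<close> along the normal. This bounds its normal component from below and the
  local time from above.\<close>

lemma skorokhod_boundary_time:
  assumes t: "0 < t" "X t \<in> frontier D" and \<epsilon>: "0 < \<epsilon>"
  obtains \<delta> where "0 < \<delta>" "\<delta> \<le> t" "\<And>s. s \<in> {t - \<delta>..t} \<Longrightarrow>
      - \<epsilon> * norm (w s - w t) \<le> inward_normal D (X t) \<bullet> (w s - w t) \<and> L t - L s \<le> 5 * norm (w s - w t)"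
proof -
  define n where "n = inward_normal D (X t)"
  \<comment> \<open>With \<open>\<epsilon>' \<le> 1 / 4\<close> the error
    \<open>\<epsilon>' * l\<close> uses half of the gain \<open>l / 2\<close>, leaving
    \<open>l / 4\<close>. The resulting inequality \<open>l / 4 \<le> (1 + 1 / 4) * norm v\<close>
    is the origin of the constant 5.\<close>
  define \<epsilon>' where "\<epsilon>' = min \<epsilon> (1 / 4)"
  have \<epsilon>': "0 < \<epsilon>'" "\<epsilon>' \<le> \<epsilon>" "\<epsilon>' \<le> 1 / 4" using \<epsilon> by (auto simp: \<epsilon>'_def)
  have n: "norm n = 1" "n \<bullet> n = 1" using norm_inward_normal[OF D t(2)] by (auto simp: n_def dot_square_norm)
  have ev1: "\<forall>\<^sub>F u in nhds (X t). u \<in> closure D \<longrightarrow> - \<epsilon>' * norm (u - X t) \<le> n \<bullet> (u - X t)"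
    unfolding n_def by (rule inward_normal_cone[OF D t(2) \<epsilon>'(1)])
  have "((\<lambda>u. n \<bullet> inward_normal D u) \<longlongrightarrow> n \<bullet> n) (at (X t) within frontier D)"
    using continuous_on_inward_normal[OF D] t(2) unfolding continuous_on_def n_def by (intro tendsto_intros) blast
  then have "\<forall>\<^sub>F u in at (X t) within frontier D. 1 / 2 < n \<bullet> inward_normal D u"
    by (rule order_tendstoD(1)) (simp add: n)
  then have "\<forall>\<^sub>F u in nhds (X t). u \<noteq> X t \<longrightarrow> u \<in> frontier D \<longrightarrow> 1 / 2 < n \<bullet> inward_normal D u"
    by (simp add: eventually_at_filter)
  then have ev2: "\<forall>\<^sub>F u in nhds (X t). u \<in> frontier D \<longrightarrow> 1 / 2 \<le> n \<bullet> inward_normal D u"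
    by eventually_elim (use n in \<open>auto simp: n_def[symmetric]\<close>)
  obtain V where V: "open V" "X t \<in> V"
    "\<And>u. u \<in> V \<Longrightarrow> u \<in> closure D \<Longrightarrow> - \<epsilon>' * norm (u - X t) \<le> n \<bullet> (u - X t)"
    "\<And>u. u \<in> V \<Longrightarrow> u \<in> frontier D \<Longrightarrow> 1 / 2 \<le> n \<bullet> inward_normal D u"
    using eventually_conj[OF ev1 ev2] unfolding eventually_nhds by blast
  have "\<forall>\<^sub>F s in at t within {0..}. X s \<in> V"
    using skorokhod_X(1) t V(1,2) unfolding continuous_on_def by (metis atLeast_iff less_imp_le topological_tendstoD)
  then obtain d where d: "0 < d" "\<And>s. 0 \<le> s \<Longrightarrow> s \<noteq> t \<Longrightarrow> dist s t < d \<Longrightarrow> X s \<in> V"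
    unfolding eventually_at by auto
  define \<delta> where "\<delta> = min (d / 2) t"
  show ?thesis
  proof (rule that[of \<delta>])
    show "0 < \<delta>" "\<delta> \<le> t" using d t by (auto simp: \<delta>_def)
    fix s assume s: "s \<in> {t - \<delta>..t}"
    have XV: "X r \<in> V" if "r \<in> {s..t}" for r
    proof (cases "r = t")
      case False
      have "dist r t < d" "0 \<le> r" using that s d(1) t(1) by (auto simp: \<delta>_def dist_real_def min_def split: if_splits)
      then show ?thesis using d(2) False by blast
    qed (use V in simp)
    have s0: "0 \<le> s" "s \<le> t" using s by (auto simp: \<delta>_def)
    obtain J where J: "X t - X s = w t - w s + J" "norm J \<le> L t - L s" "(L t - L s) / 2 \<le> n \<bullet> J"
      by (rule skorokhod_increment[OF s0, of n]) (use V(4) XV in blast)+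
    define v where "v = w s - w t"
    define l where "l = L t - L s"
    have \<Delta>: "X s - X t = v - J" using J(1) unfolding v_def by (metis minus_diff_eq minus_add_distrib uminus_add_conv_diff diff_conv_add_uminus)
    have "- \<epsilon>' * norm (X s - X t) \<le> n \<bullet> (X s - X t)"
      using V(3)[OF XV[of s]] skorokhod_X(2)[OF s0(1)] s0 by simp
    then have a: "- \<epsilon>' * norm (v - J) \<le> n \<bullet> v - n \<bullet> J" unfolding \<Delta> inner_diff_right .
    have "norm (v - J) \<le> norm v + l" using norm_triangle_ineq4[of v J] J(2) by (simp add: l_def)
    then have "\<epsilon>' * norm (v - J) \<le> \<epsilon>' * (norm v + l)" using \<epsilon>' by (intro mult_left_mono) auto
    moreover have l0: "0 \<le> l" unfolding l_def by (rule skorokhod_local_time(4)[OF s0])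
    have "\<epsilon>' * l \<le> 1 / 4 * l" using \<epsilon>' l0 by (intro mult_right_mono) auto
    ultimately have b: "l / 4 - \<epsilon>' * norm v \<le> n \<bullet> v" using a J(3) by (simp add: l_def[symmetric] distrib_left)
    have c: "\<epsilon>' * norm v \<le> \<epsilon> * norm v" "\<epsilon>' * norm v \<le> 1 / 4 * norm v"
      by (rule mult_right_mono[OF \<epsilon>'(2) norm_ge_zero] mult_right_mono[OF \<epsilon>'(3) norm_ge_zero])+
    have "n \<bullet> v \<le> norm v" using norm_cauchy_schwarz[of n v] n by simp
    then have "l \<le> 5 * norm v" using b c by linarith
    moreover have "- \<epsilon> * norm v \<le> n \<bullet> v" using b c l0 by linarith
    ultimately show "- \<epsilon> * norm (w s - w t) \<le> inward_normal D (X t) \<bullet> (w s - w t) \<and> L t - L s \<le> 5 * norm (w s - w t)"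
      by (simp add: v_def l_def n_def)
  qed
qed

text \<open>By compactness a nonempty set of this kind has a last point, up to which
  \<open>L\<close> has grown by at most \<open>c\<close>. In this way a bound for each cone time in
  an interval becomes a bound for the mass of all of them.\<close>

lemma emeasure_local_time_sublevel:
  assumes u: "0 \<le> u" and c: "0 \<le> c"
  shows "{r\<in>{u..u'}. L r \<le> L u + c} \<in> sets (stieltjes_measure L)"
    and "emeasure (stieltjes_measure L) {r\<in>{u..u'}. L r \<le> L u + c} \<le> ennreal c"
proof -
  let ?A = "{r\<in>{u..u'}. L r \<le> L u + c}"
  have cont: "continuous_on {u..u'} L" using skorokhod_local_time(1) by (rule continuous_on_subset) (use u in auto)
  have cl: "closed ?A"
    using continuous_closed_preimage[OF cont closed_atLeastAtMost closed_atMost[of "L u + c"]]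
    by (simp add: vimage_def Int_def conj_commute)
  show s: "?A \<in> sets (stieltjes_measure L)"
    using cl u by (auto simp: sets_stieltjes_measure sets_restrict_space_iff)
  show "emeasure (stieltjes_measure L) ?A \<le> ennreal c"
  proof (cases "?A = {}")
    case False
    have "bounded ?A" using bounded_closed_interval[of u u'] by (rule bounded_subset) auto
    then have "compact ?A" using cl compact_eq_bounded_closed by blast
    then obtain r where r: "r \<in> ?A" "\<And>q. q \<in> ?A \<Longrightarrow> q \<le> r" using compact_attains_sup[of ?A] False by blast
    have "emeasure (stieltjes_measure L) ?A \<le> emeasure (stieltjes_measure L) {u..r}"
      using r u by (intro emeasure_mono) auto
    also have "\<dots> = ennreal (L r - L u)" using r u by (intro skorokhod_local_time(3)) auto
    also have "\<dots> \<le> ennreal c" using r by (intro ennreal_leI) auto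
    finally show ?thesis .
  next
    case True
    show ?thesis unfolding True by simp
  qed
qed

end

section \<open>Common boundary times\<close>

text \<open>Lets one pair of vectors serve for all normals nearby, at the price of half the
  slack.\<close>

lemma wide_cone_near:
  assumes "norm (a' - a) \<le> \<epsilon> / 2" "norm (b' - b) \<le> \<epsilon> / 2"
  shows "wide_cone a' b' (\<epsilon> / 2) \<subseteq> wide_cone a b \<epsilon>"
proof
  fix v assume v: "v \<in> wide_cone a' b' (\<epsilon> / 2)"
  have "- \<epsilon> * norm v \<le> c \<bullet> v" if "norm (c' - c) \<le> \<epsilon> / 2" "- (\<epsilon> / 2) * norm v \<le> c' \<bullet> v" for c c' :: 'a
  proof -
    have "(c' - c) \<bullet> v \<le> norm (c' - c) * norm v" by (rule norm_cauchy_schwarz)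
    also have "\<dots> \<le> \<epsilon> / 2 * norm v" using that(1) by (intro mult_right_mono) auto
    finally have "c' \<bullet> v - c \<bullet> v \<le> \<epsilon> / 2 * norm v" by (simp add: inner_diff_left)
    moreover have "- \<epsilon> * norm v = - (\<epsilon> / 2) * norm v - \<epsilon> / 2 * norm v" by simp
    ultimately show ?thesis using that(2) by linarith
  qed
  then show "v \<in> wide_cone a b \<epsilon>" using assms v by (simp add: wide_cone_def)
qed

context
  fixes D :: "'a::euclidean_space set" and x :: 'a and w X :: "real \<Rightarrow> 'a" and L :: "real \<Rightarrow> real"
  assumes D: "open D" "C2_boundary D" and sk: "skorokhod_solution D x w X L"
begin

text \<open>In an interval with index in \<open>I\<close>, the local time at a cone time exceeds
  that at the left end by at most \<open>5 * \<sigma>\<close>, and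
  \<open>5 * \<sigma> * card I\<close> can be made arbitrarily small. A null set around the cone
  times is produced, so that their own measurability need not be settled.\<close>

lemma cone_times_null:
  assumes cov: "cone_times_coverable w a b \<epsilon> \<delta> N" and \<delta>: "0 < \<delta>"
  obtains Z where "Z \<in> null_sets (stieltjes_measure L)"
    "{t. 2 * \<delta> \<le> t \<and> t < real N \<and> (\<forall>s\<in>{t - 2 * \<delta>..t}. w s - w t \<in> wide_cone a b \<epsilon> \<and> L t - L s \<le> 5 * norm (w s - w t))} \<subseteq> Z"
proof -
  let ?M = "stieltjes_measure L"
  let ?S = "{t. 2 * \<delta> \<le> t \<and> t < real N \<and> (\<forall>s\<in>{t - 2 * \<delta>..t}. w s - w t \<in> wide_cone a b \<epsilon> \<and> L t - L s \<le> 5 * norm (w s - w t))}"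
  have cover: "\<exists>C. C \<in> sets ?M \<and> ?S \<subseteq> C \<and> emeasure ?M C \<le> ennreal e" if e: "0 < e" for e
  proof -
    obtain m \<sigma> I where m: "0 < \<sigma>" "finite I" "\<sigma> * real (card I) \<le> e / 5" "1 / 2 ^ m \<le> \<delta>"
      "\<And>t. 2 * \<delta> \<le> t \<Longrightarrow> t < real N \<Longrightarrow> (\<forall>s\<in>{t - 2 * \<delta>..t}. w s - w t \<in> wide_cone a b \<epsilon>) \<Longrightarrow>
        nat \<lfloor>t * 2 ^ m\<rfloor> \<in> I \<and> norm (w t - w (dyadic_floor m t)) \<le> \<sigma>"
      using cov e unfolding cone_times_coverable_def by (metis divide_pos_pos zero_less_numeral)
    \<comment> \<open>The local time of the whole interval is not controlled; only the part is kept
      in which \<open>L\<close> has grown by at most \<open>5 * \<sigma>\<close>.\<close>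
    define C where "C = (\<lambda>i. {r\<in>{real i / 2 ^ m..real i / 2 ^ m + 1 / 2 ^ m}. L r \<le> L (real i / 2 ^ m) + 5 * \<sigma>})"
    have C: "C i \<in> sets ?M" "emeasure ?M (C i) \<le> ennreal (5 * \<sigma>)" for i
      unfolding C_def using m(1) by (intro emeasure_local_time_sublevel[OF D sk]; simp)+
    have "emeasure ?M (\<Union>i\<in>I. C i) \<le> (\<Sum>i\<in>I. emeasure ?M (C i))"
      using m(2) C by (intro emeasure_subadditive_finite) auto
    also have "\<dots> \<le> (\<Sum>i\<in>I. ennreal (5 * \<sigma>))" by (intro sum_mono C)
    also have "\<dots> = ennreal (\<Sum>i\<in>I. 5 * \<sigma>)" using m(1) by (intro sum_ennreal) auto
    also have "\<dots> \<le> ennreal e" using m(3) by (intro ennreal_leI) (simp add: mult_ac)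
    finally have "emeasure ?M (\<Union>i\<in>I. C i) \<le> ennreal e" .
    moreover have "?S \<subseteq> (\<Union>i\<in>I. C i)"
    proof
      fix t assume t: "t \<in> ?S"
      define i where "i = nat \<lfloor>t * 2 ^ m\<rfloor>"
      have t0: "0 \<le> t" using t \<delta> by auto
      have i: "i \<in> I" "norm (w t - w (dyadic_floor m t)) \<le> \<sigma>" using m(5)[of t] t by (auto simp: i_def)
      have di: "dyadic_floor m t = real i / 2 ^ m" by (simp add: dyadic_floor_def i_def)
      note db = dyadic_floor_bounds[OF t0, of m, unfolded di]
      have "real i / 2 ^ m \<in> {t - 2 * \<delta>..t}" using db m(4) \<delta> by auto
      then have "L t - L (real i / 2 ^ m) \<le> 5 * norm (w (real i / 2 ^ m) - w t)" using t by blast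
      also have "\<dots> \<le> 5 * \<sigma>" using i(2) by (simp add: di norm_minus_commute)
      finally have "t \<in> C i" using db by (simp add: C_def)
      then show "t \<in> (\<Union>i\<in>I. C i)" using i(1) by blast
    qed
    moreover have "(\<Union>i\<in>I. C i) \<in> sets ?M" using m(2) C by auto
    ultimately show ?thesis by blast
  qed
  have "\<forall>q::nat. \<exists>C. C \<in> sets ?M \<and> ?S \<subseteq> C \<and> emeasure ?M C \<le> ennreal (1 / Suc q)"
    by (intro allI cover) simp
  from choice[OF this] obtain C where C: "\<And>q::nat. C q \<in> sets ?M" "\<And>q. ?S \<subseteq> C q"
    "\<And>q. emeasure ?M (C q) \<le> ennreal (1 / Suc q)"
    by blast
  have sets: "(\<Inter>q. C q) \<in> sets ?M" using C(1) by auto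
  have "emeasure ?M (\<Inter>q. C q) \<le> 0"
  proof (rule LIMSEQ_le_const)
    have "(\<lambda>q. 1 / real (Suc q)) \<longlonglongrightarrow> 0" using LIMSEQ_inverse_real_of_nat by (simp add: inverse_eq_divide)
    then show "(\<lambda>q. ennreal (1 / Suc q)) \<longlonglongrightarrow> 0" using tendsto_ennrealI by fastforce
    show "\<exists>q0. \<forall>q\<ge>q0. emeasure ?M (\<Inter>q. C q) \<le> ennreal (1 / Suc q)"
    proof (intro exI allI impI)
      fix q :: nat
      have "emeasure ?M (\<Inter>q. C q) \<le> emeasure ?M (C q)" using C(1) by (intro emeasure_mono) auto
      then show "emeasure ?M (\<Inter>q. C q) \<le> ennreal (1 / Suc q)" using C(3)[of q] by (rule order_trans)
    qed
  qed
  then have "(\<Inter>q. C q) \<in> null_sets ?M" using sets by (simp add: null_sets_def)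
  moreover have "?S \<subseteq> (\<Inter>q. C q)" using C(2) by blast
  ultimately show ?thesis by (rule that)
qed

text \<open>Both the normals and the length of the window given by
  \<open>skorokhod_boundary_time\<close> depend on \<open>t\<close>. Countably many pairs
  \<open>p\<close>, windows \<open>2 / Suc n\<close> and horizons \<open>N\<close> exhaust the
  possibilities, and the null sets add up to a null set.\<close>

lemma common_boundary_times_null:
  fixes y :: 'a and Y :: "real \<Rightarrow> 'a" and K :: "real \<Rightarrow> real"
  assumes sk': "skorokhod_solution D y w Y K"
    and P: "countable P"
    and P_cover: "\<And>a b. norm a = 1 \<Longrightarrow> norm b = 1 \<Longrightarrow> a \<noteq> b \<Longrightarrow>
      \<exists>p\<in>P. norm (a - fst p) \<le> \<epsilon> p / 2 \<and> norm (b - snd p) \<le> \<epsilon> p / 2"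
    and \<epsilon>: "\<And>p. p \<in> P \<Longrightarrow> 0 < \<epsilon> p"
    and cov: "\<And>p n N. p \<in> P \<Longrightarrow> cone_times_coverable w (fst p) (snd p) (\<epsilon> p) (1 / Suc n) N"
  obtains Z where "Z \<in> null_sets (stieltjes_measure L)"
    "{t. 0 \<le> t \<and> X t \<in> frontier D \<and> Y t \<in> frontier D \<and> inward_normal D (X t) \<noteq> inward_normal D (Y t)} \<subseteq> Z"
proof -
  let ?M = "stieltjes_measure L"
  define S where "S = (\<lambda>p n N. {t. 2 * (1 / real (Suc n)) \<le> t \<and> t < real N \<and>
    (\<forall>s\<in>{t - 2 * (1 / real (Suc n))..t}. w s - w t \<in> wide_cone (fst p) (snd p) (\<epsilon> p) \<and> L t - L s \<le> 5 * norm (w s - w t))})"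
  have ex: "\<exists>Z. Z \<in> null_sets ?M \<and> S p n N \<subseteq> Z" if "p \<in> P" for p n N
  proof (rule cone_times_null[OF cov[OF that, of n N]])
    fix Z assume "Z \<in> null_sets ?M" "{t. 2 * (1 / real (Suc n)) \<le> t \<and> t < real N \<and>
      (\<forall>s\<in>{t - 2 * (1 / real (Suc n))..t}. w s - w t \<in> wide_cone (fst p) (snd p) (\<epsilon> p) \<and> L t - L s \<le> 5 * norm (w s - w t))} \<subseteq> Z"
    then show ?thesis unfolding S_def by (intro exI[of _ Z] conjI)
  qed simp
  define Z where "Z = (\<lambda>p n N. SOME Z. Z \<in> null_sets ?M \<and> S p n N \<subseteq> Z)"
  have Z: "Z p n N \<in> null_sets ?M" "S p n N \<subseteq> Z p n N" if "p \<in> P" for p n N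
    using someI_ex[OF ex[OF that, of n N]] unfolding Z_def by blast+
  define W where "W = {0} \<union> (\<Union>p\<in>P. \<Union>n::nat. \<Union>N::nat. Z p n N)"
  have "{0} \<in> null_sets ?M"
    using stieltjes_singleton[OF D sk, of 0] sets_stieltjes_measure_interval(1)[of 0 0 L] by (auto simp: null_sets_def)
  then have W: "W \<in> null_sets ?M"
    unfolding W_def using P Z(1) by (intro null_sets.Un null_sets_UN' null_sets_UN) auto
  have "t \<in> W" if t: "0 \<le> t" "X t \<in> frontier D" "Y t \<in> frontier D" and ne: "inward_normal D (X t) \<noteq> inward_normal D (Y t)" for t
  \<comment> \<open>Time 0 has no past to look at; it carries no mass because \<open>L\<close> is
    continuous.\<close>
  proof (cases "t = 0")
    case False
    then have t0: "0 < t" using t by simp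
    define a where "a = inward_normal D (X t)"
    define b where "b = inward_normal D (Y t)"
    have ab: "norm a = 1" "norm b = 1" "a \<noteq> b" using norm_inward_normal[OF D] t ne by (auto simp: a_def b_def)
    obtain p where p: "p \<in> P" "norm (a - fst p) \<le> \<epsilon> p / 2" "norm (b - snd p) \<le> \<epsilon> p / 2" using P_cover[OF ab] by blast
    have e: "0 < \<epsilon> p / 2" using \<epsilon>[OF p(1)] by simp
    obtain \<delta>1 where \<delta>1: "0 < \<delta>1" "\<delta>1 \<le> t" "\<And>s. s \<in> {t - \<delta>1..t} \<Longrightarrow>
      - (\<epsilon> p / 2) * norm (w s - w t) \<le> a \<bullet> (w s - w t) \<and> L t - L s \<le> 5 * norm (w s - w t)"
      unfolding a_def by (rule skorokhod_boundary_time[OF D sk t0 t(2) e]) blast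
    obtain \<delta>2 where \<delta>2: "0 < \<delta>2" "\<delta>2 \<le> t" "\<And>s. s \<in> {t - \<delta>2..t} \<Longrightarrow>
      - (\<epsilon> p / 2) * norm (w s - w t) \<le> b \<bullet> (w s - w t) \<and> K t - K s \<le> 5 * norm (w s - w t)"
      unfolding b_def by (rule skorokhod_boundary_time[OF D sk' t0 t(3) e]) blast
    have "0 < min \<delta>1 \<delta>2 / 2" using \<delta>1 \<delta>2 by simp
    then obtain n where n: "inverse (real (Suc n)) < min \<delta>1 \<delta>2 / 2" using reals_Archimedean by blast
    then have n2: "2 * (1 / real (Suc n)) \<le> \<delta>1" "2 * (1 / real (Suc n)) \<le> \<delta>2" by (auto simp: inverse_eq_divide min_def split: if_splits)
    obtain N :: nat where N: "t < real N" using reals_Archimedean2 by blast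
    have "w s - w t \<in> wide_cone (fst p) (snd p) (\<epsilon> p) \<and> L t - L s \<le> 5 * norm (w s - w t)"
      if s: "s \<in> {t - 2 * (1 / real (Suc n))..t}" for s
    proof -
      have "s \<in> {t - \<delta>1..t}" "s \<in> {t - \<delta>2..t}" using s n2 unfolding atLeastAtMost_iff by linarith+
      then have "w s - w t \<in> wide_cone a b (\<epsilon> p / 2)" "L t - L s \<le> 5 * norm (w s - w t)"
        using \<delta>1(3) \<delta>2(3) unfolding wide_cone_def by blast+
      then show ?thesis using wide_cone_near[OF p(2,3)] by blast
    qed
    then have "t \<in> S p n N" using N n2(1) \<delta>1(2) unfolding S_def by auto
    then show ?thesis using Z(2)[OF p(1)] p(1) unfolding W_def by blast
  qed (simp add: W_def)
  then show ?thesis using that[OF W] by blast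
qed

section \<open>The set that separates the two measures\<close>

lemma skorokhod_frontier_sets:
  "{t. 0 \<le> t \<and> X t \<in> frontier D} \<in> sets (stieltjes_measure F)"
proof -
  have "closed ({0..} \<inter> X -` frontier D)"
    using continuous_closed_preimage[OF skorokhod_X(1)[OF D sk] closed_atLeast frontier_closed] .
  also have "{0..} \<inter> X -` frontier D = {t. 0 \<le> t \<and> X t \<in> frontier D}" by auto
  finally show ?thesis by (auto simp: sets_stieltjes_measure sets_restrict_space_iff)
qed

lemma skorokhod_off_frontier_null:
  "{0..} - {t. 0 \<le> t \<and> X t \<in> frontier D} \<in> null_sets (stieltjes_measure L)"
proof -
  have "{0..} - {t. 0 \<le> t \<and> X t \<in> frontier D} \<in> sets (stieltjes_measure L)"
    using sets.compl_sets[OF skorokhod_frontier_sets[of L]] by simp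
  moreover have e: "{0..} - {t. 0 \<le> t \<and> X t \<in> frontier D} = {t \<in> space (stieltjes_measure L). \<not> X t \<in> frontier D}"
    by auto
  ultimately show ?thesis
    using AE_stieltjes_frontier[OF D sk] unfolding e by (simp only: AE_iff_null)
qed

lemma mutually_singular_local_times:
  fixes y :: 'a and Y :: "real \<Rightarrow> 'a" and K :: "real \<Rightarrow> real" and T :: ereal
  assumes sk': "skorokhod_solution D y w Y K"
    and Z: "Z \<in> null_sets (stieltjes_measure L)"
      "{t. 0 \<le> t \<and> X t \<in> frontier D \<and> Y t \<in> frontier D \<and> inward_normal D (X t) \<noteq> inward_normal D (Y t)} \<subseteq> Z"
    and off: "{0..} - {t. 0 \<le> t \<and> Y t \<in> frontier D} \<in> null_sets (stieltjes_measure K)"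
      "{t. 0 \<le> t \<and> Y t \<in> frontier D} \<in> sets (stieltjes_measure L)"
    and T: "T = Inf {ereal t | t. 0 \<le> t \<and> X t \<in> frontier D \<and> Y t \<in> frontier D \<and>
              inward_normal D (X t) = inward_normal D (Y t)}"
  shows "mutually_singular (restrict_space (stieltjes_measure L) {t. 0 \<le> t \<and> ereal t \<le> T})
           (restrict_space (stieltjes_measure K) {t. 0 \<le> t \<and> ereal t \<le> T})"
proof -
  define \<Omega> where "\<Omega> = {t. 0 \<le> t \<and> ereal t \<le> T}"
  define FX where "FX = {t. 0 \<le> t \<and> X t \<in> frontier D}"
  define FY where "FY = {t. 0 \<le> t \<and> Y t \<in> frontier D}"
  have eqs: "sets (stieltjes_measure L) = sets (stieltjes_measure K)" by (simp add: sets_stieltjes_measure)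
  have \<Omega>: "\<Omega> \<in> sets (stieltjes_measure L)"
  proof -
    have "{t. ereal t \<le> T} \<in> sets borel" by measurable
    then have "{0..} \<inter> {t. ereal t \<le> T} \<in> sets borel" by auto
    moreover have "{0..} \<inter> {t. ereal t \<le> T} = \<Omega>" by (auto simp: \<Omega>_def)
    ultimately show ?thesis by (auto simp: sets_stieltjes_measure sets_restrict_space_iff \<Omega>_def)
  qed
  have \<Omega>0: "\<Omega> \<subseteq> {0..}" by (auto simp: \<Omega>_def)
  have FX: "FX \<in> sets (stieltjes_measure L)" unfolding FX_def by (rule skorokhod_frontier_sets)
  have FY: "FY \<in> sets (stieltjes_measure L)" unfolding FY_def by (rule off(2))
  have FXnull: "{0..} - FX \<in> null_sets (stieltjes_measure L)" unfolding FX_def by (rule skorokhod_off_frontier_null)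
  \<comment> \<open>Its complement in \<open>\<Omega>\<close> consists of boundary times of
    \<open>X\<close> that are not boundary times of \<open>Y\<close>, null for \<open>K\<close>.
    \<open>A\<close> itself is null for \<open>L\<close>: off \<open>FX\<close> there is no local
    time, and times before \<open>T\<close> that are in both \<open>FX\<close> and \<open>FY\<close>
    belong to \<open>Z\<close>.\<close>
  define A where "A = \<Omega> - (FX - FY)"
  have A: "A \<in> sets (stieltjes_measure L)" using \<Omega> FX FY by (simp add: A_def)
  \<comment> \<open>The interval is closed on the right, and at \<open>T\<close> the normals may
    agree; this single time is disposed of by continuity of \<open>L\<close>.\<close>
  have tau: "{t. 0 \<le> t \<and> ereal t = T} \<in> null_sets (stieltjes_measure L)"
  proof (cases "\<exists>t\<ge>0. ereal t = T")
    case True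
    then obtain t where t: "0 \<le> t" "ereal t = T" by blast
    then have "{t. 0 \<le> t \<and> ereal t = T} = {t}" by auto
    then show ?thesis
      using stieltjes_singleton[OF D sk t(1)] sets_stieltjes_measure_interval(1)[of t t L] t by (auto simp: null_sets_def)
  next
    case False
    then have "{t. 0 \<le> t \<and> ereal t = T} = {}" by auto
    then show ?thesis by (simp only: null_sets.empty_sets)
  qed
  have sub: "A \<subseteq> ({0..} - FX) \<union> (Z \<union> {t. 0 \<le> t \<and> ereal t = T})"
  proof
    fix t assume t: "t \<in> A"
    show "t \<in> ({0..} - FX) \<union> (Z \<union> {t. 0 \<le> t \<and> ereal t = T})"
    proof (cases "t \<in> FX \<and> ereal t \<noteq> T")
      case True
      then have FYt: "t \<in> FY" using t by (auto simp: A_def)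
      have "ereal t < T" using t True by (auto simp: A_def \<Omega>_def)
      have "inward_normal D (X t) \<noteq> inward_normal D (Y t)"
      proof
        assume "inward_normal D (X t) = inward_normal D (Y t)"
        then have "T \<le> ereal t" unfolding T by (intro Inf_lower) (use True FYt in \<open>auto simp: FX_def FY_def\<close>)
        then show False using \<open>ereal t < T\<close> by simp
      qed
      then have "t \<in> Z" using True FYt Z(2) by (auto simp: FX_def FY_def)
      then show ?thesis by simp
    next
      case False
      then show ?thesis using t \<Omega>0 by (auto simp: A_def)
    qed
  qed
  have "({0..} - FX) \<union> (Z \<union> {t. 0 \<le> t \<and> ereal t = T}) \<in> null_sets (stieltjes_measure L)"
    using FXnull Z(1) tau by auto
  then have A0: "emeasure (stieltjes_measure L) A = 0"
    using sub A by (meson null_setsD1 null_sets_subset)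
  have "\<Omega> - A \<subseteq> {0..} - FY" using \<Omega>0 by (auto simp: A_def)
  moreover have "\<Omega> - A \<in> sets (stieltjes_measure K)" using \<Omega> A eqs by simp
  ultimately have B0: "emeasure (stieltjes_measure K) (\<Omega> - A) = 0"
    using off(1) unfolding FY_def by (meson null_setsD1 null_sets_subset)
  have r1: "sets (restrict_space (stieltjes_measure L) \<Omega>) = sets (restrict_space (stieltjes_measure K) \<Omega>)"
    using eqs by (simp add: sets_restrict_space)
  have r2: "A \<in> sets (restrict_space (stieltjes_measure L) \<Omega>)"
    using A \<Omega> \<Omega>0 by (subst sets_restrict_space_iff) (auto simp: A_def Int_absorb2)
  have r3: "emeasure (restrict_space (stieltjes_measure L) \<Omega>) A = 0"
    using A0 \<Omega> \<Omega>0 by (subst emeasure_restrict_space) (auto simp: A_def Int_absorb2)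
  have r4: "space (restrict_space (stieltjes_measure K) \<Omega>) = \<Omega>"
    using \<Omega>0 by (auto simp: space_restrict_space)
  have r5: "emeasure (restrict_space (stieltjes_measure K) \<Omega>) (\<Omega> - A) = 0"
    using B0 \<Omega> \<Omega>0 eqs by (subst emeasure_restrict_space) (auto simp: Int_absorb2)
  show ?thesis
    unfolding mutually_singular_def \<Omega>_def[symmetric]
    by (intro conjI bexI[of _ A] r1 r2 r3) (simp only: r4 r5)
qed

end

theorem theorem2p2:
  fixes D :: "'a::euclidean_space set"
    and M :: "'w measure"
    and B :: "real \<Rightarrow> 'w \<Rightarrow> 'a"
    and X :: "'a \<Rightarrow> real \<Rightarrow> 'w \<Rightarrow> 'a"
    and L :: "'a \<Rightarrow> real \<Rightarrow> 'w \<Rightarrow> real"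
    and T :: "'w \<Rightarrow> ereal"
    and x y :: 'a
  assumes "DIM('a) \<ge> 2"
    and "open D" and "connected D" and "bounded D" and "C2_boundary D"
    and "synchronous_coupling M B D X L"
    and "x \<in> closure D" and "y \<in> closure D" and "x \<noteq> y"
    and T: "\<And>\<omega>. T \<omega> = Inf {ereal t | t. 0 \<le> t \<and> X x t \<omega> \<in> frontier D \<and> X y t \<omega> \<in> frontier D \<and>
              inward_normal D (X x t \<omega>) = inward_normal D (X y t \<omega>)}"
  shows "AE \<omega> in M. mutually_singular
           (restrict_space (stieltjes_measure (\<lambda>t. L x t \<omega>)) {t. 0 \<le> t \<and> ereal t \<le> T \<omega>})
           (restrict_space (stieltjes_measure (\<lambda>t. L y t \<omega>)) {t. 0 \<le> t \<and> ereal t \<le> T \<omega>})"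
proof -
  interpret synchronous_coupling M B D X L by fact
  define Q where "Q = {p :: 'a \<times> 'a. norm (fst p) = 1 \<and> norm (snd p) = 1 \<and> fst p \<noteq> snd p}"
  have "\<exists>\<epsilon>>0. \<forall>\<delta> N. 0 < \<delta> \<longrightarrow> (AE \<omega> in M. cone_times_coverable (\<lambda>t. B t \<omega>) (fst p) (snd p) \<epsilon> \<delta> N)"
    if "p \<in> Q" for p
  proof (rule cone_times_cover[OF assms(1), of "fst p" "snd p"])
    show "norm (fst p) = 1" "norm (snd p) = 1" "fst p \<noteq> snd p" using that by (auto simp: Q_def)
    fix \<epsilon> :: real
    assume "0 < \<epsilon>" "\<And>\<delta> N. 0 < \<delta> \<Longrightarrow> AE \<omega> in M. cone_times_coverable (\<lambda>t. B t \<omega>) (fst p) (snd p) \<epsilon> \<delta> N"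
    then show ?thesis by blast
  qed
  then have "\<forall>p\<in>Q. \<exists>\<epsilon>>0. \<forall>\<delta> N. 0 < \<delta> \<longrightarrow> (AE \<omega> in M. cone_times_coverable (\<lambda>t. B t \<omega>) (fst p) (snd p) \<epsilon> \<delta> N)"
    by blast
  from bchoice[OF this] obtain \<epsilon> where \<epsilon>: "\<And>p. p \<in> Q \<Longrightarrow> 0 < \<epsilon> p"
    and cov: "\<And>p \<delta> N. p \<in> Q \<Longrightarrow> 0 < \<delta> \<Longrightarrow> AE \<omega> in M. cone_times_coverable (\<lambda>t. B t \<omega>) (fst p) (snd p) (\<epsilon> p) \<delta> N"
    by blast
  \<comment> \<open>The slack \<open>\<epsilon> p\<close> depends on the pair and may degenerate as
    the two vectors approach each other. \<open>Q\<close> is not compact, so a finite subcover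
    cannot be expected, but the Lindelof property gives a countable one.\<close>
  define U where "U = (\<lambda>p. ball (fst p) (\<epsilon> p / 2) \<times> ball (snd p) (\<epsilon> p / 2))"
  have "open S" if "S \<in> U ` Q" for S using that by (auto simp: U_def open_Times)
  then obtain \<F> where \<F>: "\<F> \<subseteq> U ` Q" "countable \<F>" "\<Union>\<F> = \<Union>(U ` Q)"
    by (rule Lindelof)
  obtain P where P: "countable P" "P \<subseteq> Q" "\<F> = U ` P"
    using countable_subset_image[of \<F> U Q] \<F>(1,2) by blast
  have P_cover: "\<exists>p\<in>P. norm (a - fst p) \<le> \<epsilon> p / 2 \<and> norm (b - snd p) \<le> \<epsilon> p / 2"
    if "norm a = 1" "norm b = 1" "a \<noteq> b" for a b
  proof -
    have "(a, b) \<in> Q" using that by (simp add: Q_def)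
    moreover have "(a, b) \<in> U (a, b)" using \<epsilon>[OF \<open>(a, b) \<in> Q\<close>] by (simp add: U_def)
    ultimately have "(a, b) \<in> \<Union>\<F>" unfolding \<F>(3) by blast
    then obtain p where "p \<in> P" "(a, b) \<in> U p" unfolding P(3) by blast
    then show ?thesis by (intro bexI[of _ p]) (auto simp: U_def dist_norm norm_minus_commute)
  qed
  \<comment> \<open>Pairs, windows and horizons now range over countable sets, so there is one
    exceptional null set for all of them; the rest of the argument is about a fixed path.\<close>
  have "AE \<omega> in M. \<forall>p\<in>P. \<forall>n N. cone_times_coverable (\<lambda>t. B t \<omega>) (fst p) (snd p) (\<epsilon> p) (1 / Suc n) N"
    using P cov by (intro AE_ball_countable[THEN iffD2] ballI AE_all_countable[THEN iffD2] allI) auto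
  with skorokhod show ?thesis
  proof eventually_elim
    case (elim \<omega>)
    have skx: "skorokhod_solution D x (\<lambda>t. B t \<omega>) (\<lambda>t. X x t \<omega>) (\<lambda>t. L x t \<omega>)"
      and sky: "skorokhod_solution D y (\<lambda>t. B t \<omega>) (\<lambda>t. X y t \<omega>) (\<lambda>t. L y t \<omega>)"
      using elim(1) assms(7,8) by blast+
    obtain Z where Z: "Z \<in> null_sets (stieltjes_measure (\<lambda>t. L x t \<omega>))"
      "{t. 0 \<le> t \<and> X x t \<omega> \<in> frontier D \<and> X y t \<omega> \<in> frontier D \<and>
         inward_normal D (X x t \<omega>) \<noteq> inward_normal D (X y t \<omega>)} \<subseteq> Z"
    proof (rule common_boundary_times_null[where \<epsilon>=\<epsilon>, OF assms(2,5) skx sky P(1)])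
      show "\<exists>p\<in>P. norm (a - fst p) \<le> \<epsilon> p / 2 \<and> norm (b - snd p) \<le> \<epsilon> p / 2"
        if "norm a = 1" "norm b = 1" "a \<noteq> b" for a b using that by (rule P_cover)
      show "0 < \<epsilon> p" if "p \<in> P" for p using that P(2) \<epsilon> by blast
      show "cone_times_coverable (\<lambda>t. B t \<omega>) (fst p) (snd p) (\<epsilon> p) (1 / real (Suc n)) N" if "p \<in> P" for p n N
        using elim(2) that by blast
    qed (rule that)
    show ?case
      by (rule mutually_singular_local_times[OF assms(2,5) skx sky Z
            skorokhod_off_frontier_null[OF assms(2,5) sky] skorokhod_frontier_sets[OF assms(2,5) sky] T])
  qed
qed

end
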